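(* Let $K=\mathbb C(x)$ with derivation $\partial_x$, let $V\in\mathbb C[x]$ be a monic polynomial of degree $k>0$, let $\lambda\in\mathbb C$, and consider the Schrödinger equation $\partial_x^2\Psi=(V(x)-\lambda)\Psi$ with Picard–Vessiot extension $L_\lambda$ over $K$. Then $\mathrm{DGal}(L_\lambda/K)$ is either $\mathrm{SL}(2,\mathbb C)$ or the Borel group $\mathbb B$, and in both cases the eigenring of $H-\lambda=-\partial_x^2+V-\lambda$ is trivial (equal to $\mathbb C$). Moreover, $\mathrm{DGal}(L_\lambda/K)=\mathbb B$ if and only if all of the following hold: (1) $k=2n$ is even, and $V-\lambda$ is written (uniquely) as $V(x)-\lambda=\big(x^n+\sum_{j=0}^{n-1}a_jx^j\big)^2+\sum_{j=0}^{n-1}b_jx^j$ with $a_j,b_j\in\mathbb C$; (2) either $b_{n-1}-n=2m$ or $-b_{n-1}-n=2m$ for some integer $m\ge 0$; (3) correspondingly, there exists a monic polynomial $P_m\in\mathbb C[x]$ of degree $m$ satisfying, in the first case, $$\partial_x^2P_m+2\Big(x^n+\sum_{j=0}^{n-1}a_jx^j\Big)\partial_xP_m+\Big(nx^{n-1}+\sum_{j=0}^{n-2}(j+1)a_{j+1}x^j-\sum_{j=0}^{n-1}b_jx^j\Big)P_m=0,$$ or, in the second case, $$\partial_x^2P_m-2\Big(x^n+\sum_{j=0}^{n-1}a_jx^j\Big)\partial_xP_m-\Big(nx^{n-1}+\sum_{j=0}^{n-2}(j+1)a_{j+1}x^j+\sum_{j=0}^{n-1}b_jx^j\Big)P_m=0.$$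 In that situation $\Psi=P_m e^{f}$ (first case) respectively $\Psi=P_me^{-f}$ (second case) is a solution, where $f(x)=\frac{x^{n+1}}{n+1}+\sum_{j=0}^{n-1}\frac{a_jx^{j+1}}{j+1}$.
   Context: $\mathbb B=\left\{\begin{pmatrix}c&d\\0&c^{-1}\end{pmatrix}: c\in\mathbb C^*,d\in\mathbb C\right\}$. The differential Galois group is regarded as an algebraic subgroup of $\mathrm{SL}(2,\mathbb C)$ (up to conjugation). The eigenring of a second-order operator $\mathfrak L\in K[\partial_x]$ is the $\mathbb C$-algebra of operators $\mathfrak R\in K[\partial_x]$ of order $<2$ such that $\mathfrak L\mathfrak R=\mathfrak S\mathfrak L$ for some $\mathfrak S\in K[\partial_x]$ (equivalently, operators mapping the solution space of $\mathfrak L$ into itself); it is trivial if it consists only of constants. *)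

theory Defs
  imports "HOL-Analysis.Analysis" "HOL-Computational_Algebra.Computational_Algebra"
begin

type_synonym ratfun = "complex poly fract"

definition polyK :: "complex poly \<Rightarrow> ratfun" where
  "polyK p = to_fract p"

definition constK :: "complex \<Rightarrow> ratfun" where
  "constK c = to_fract [:c:]"

text \<open>The derivation d/dx on K, via the quotient rule on any
  representative p/q (the result does not depend on the representative).\<close>
definition dK :: "ratfun \<Rightarrow> ratfun" where
  "dK r = (SOME d. \<exists>p q. q \<noteq> 0 \<and> r = Fract p q
             \<and> d = Fract (pderiv p * q - p * pderiv q) (q * q))"

text \<open>An operator is a coefficient list: [c0, c1, ..., cr] means c0 + c1 d + ... + cr d^r.\<close>
definition op_coeff :: "ratfun list \<Rightarrow> nat \<Rightarrow> ratfun" where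
  "op_coeff A i = (if i < length A then A ! i else 0)"

text \<open>Product in K[d], using (a d^i)(b d^j) = sum_k (i choose k) a b^(k) d^(i+j-k).\<close>
definition op_mult :: "ratfun list \<Rightarrow> ratfun list \<Rightarrow> ratfun list" where
  "op_mult A B = map (\<lambda>m. \<Sum>i<length A. \<Sum>j<length B. \<Sum>k\<le>i.
       (if i + j - k = m then A ! i * of_nat (i choose k) * (dK ^^ k) (B ! j) else 0))
     [0..<length A + length B]"

definition op_eq :: "ratfun list \<Rightarrow> ratfun list \<Rightarrow> bool" where
  "op_eq A B \<longleftrightarrow> (\<forall>i. op_coeff A i = op_coeff B i)"

text \<open>Eigenring of a (second-order) operator L: operators R = r0 + r1 d of order < 2
  with L R = S L for some S in K[d].\<close>
definition eigenring :: "ratfun list \<Rightarrow> (ratfun \<times> ratfun) set" where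
  "eigenring L = {(r0, r1). \<exists>S. op_eq (op_mult L [r0, r1]) (op_mult S L)}"

definition eigenring_trivial :: "ratfun list \<Rightarrow> bool" where
  "eigenring_trivial L \<longleftrightarrow> eigenring L = {(constK c, 0) | c. True}"

definition schroedinger_op :: "complex poly \<Rightarrow> complex \<Rightarrow> ratfun list" where
  "schroedinger_op V lam = [polyK (V - [:lam:]), 0, -1]"

definition is_derivation :: "('L::field \<Rightarrow> 'L) \<Rightarrow> bool" where
  "is_derivation D \<longleftrightarrow> (\<forall>a b. D (a + b) = D a + D b) \<and> (\<forall>a b. D (a * b) = D a * b + a * D b)"

definition diff_field_emb :: "(ratfun \<Rightarrow> 'L::field) \<Rightarrow> ('L \<Rightarrow> 'L) \<Rightarrow> bool" where
  "diff_field_emb emb D \<longleftrightarrow> emb 1 = 1 \<and> (\<forall>a b. emb (a + b) = emb a + emb b)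
     \<and> (\<forall>a b. emb (a * b) = emb a * emb b) \<and> (\<forall>a. D (emb a) = emb (dK a))"

definition generated_field :: "'L::field set \<Rightarrow> 'L set" where
  "generated_field S = \<Inter>{F. S \<subseteq> F \<and> 0 \<in> F \<and> 1 \<in> F \<and> (\<forall>a\<in>F. \<forall>b\<in>F. a + b \<in> F \<and> a * b \<in> F)
       \<and> (\<forall>a\<in>F. - a \<in> F \<and> inverse a \<in> F)}"

definition PV_extension ::
  "(ratfun \<Rightarrow> 'L::field) \<Rightarrow> ('L \<Rightarrow> 'L) \<Rightarrow> complex poly \<Rightarrow> 'L \<Rightarrow> 'L \<Rightarrow> bool" where
  "PV_extension emb D W y1 y2 \<longleftrightarrow>
     is_derivation D \<and> diff_field_emb emb D
     \<and> D (D y1) = emb (polyK W) * y1 \<and> D (D y2) = emb (polyK W) * y2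
     \<and> y1 * D y2 - D y1 * y2 \<noteq> 0
     \<and> {c. D c = 0} = emb ` {c. dK c = 0}
     \<and> generated_field (range emb \<union> {y1, y2, D y1, D y2}) = UNIV"

definition diff_K_automorphism :: "(ratfun \<Rightarrow> 'L::field) \<Rightarrow> ('L \<Rightarrow> 'L) \<Rightarrow> ('L \<Rightarrow> 'L) \<Rightarrow> bool" where
  "diff_K_automorphism emb D \<sigma> \<longleftrightarrow> bij \<sigma> \<and> (\<forall>a b. \<sigma> (a + b) = \<sigma> a + \<sigma> b)
     \<and> (\<forall>a b. \<sigma> (a * b) = \<sigma> a * \<sigma> b) \<and> (\<forall>a. \<sigma> (D a) = D (\<sigma> a)) \<and> (\<forall>k. \<sigma> (emb k) = emb k)"

definition DGal :: "(ratfun \<Rightarrow> 'L::field) \<Rightarrow> ('L \<Rightarrow> 'L) \<Rightarrow> 'L \<Rightarrow> 'L \<Rightarrow> (complex^2^2) set" where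
  "DGal emb D y1 y2 = {M. \<exists>\<sigma>. diff_K_automorphism emb D \<sigma>
      \<and> \<sigma> y1 = emb (constK (M$1$1)) * y1 + emb (constK (M$2$1)) * y2
      \<and> \<sigma> y2 = emb (constK (M$1$2)) * y1 + emb (constK (M$2$2)) * y2}"

definition SL2 :: "(complex^2^2) set" where
  "SL2 = {M. det M = 1}"

definition Borel :: "(complex^2^2) set" where
  "Borel = {M. M$2$1 = 0 \<and> det M = 1}"

definition conj_to_Borel :: "(complex^2^2) set \<Rightarrow> bool" where
  "conj_to_Borel G \<longleftrightarrow> (\<exists>P. invertible P \<and> G = (\<lambda>M. P ** M ** matrix_inv P) ` Borel)"

end

theory Submission
  imports Defs "HOL-Computational_Algebra.Field_as_Ring"
begin

text \<open>
  Write \<open>W = V - \<lambda>\<close>. Everything hinges on whether the Riccati equation \<open>u' + u\<^sup>2 = W\<close> has a solution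
  in \<open>K\<close>. If \<open>p \<in> K[U]\<close> is irreducible and divides its own derivative for \<open>U' = W - U\<^sup>2\<close>, then its
  roots solve the Riccati equation. Among the Laurent series at infinity there are only two solutions,
  so \<open>deg p \<le> 2\<close>; and \<open>deg p = 2\<close> would make the inverse discriminant of \<open>p\<close> a rational solution of
  an equation belonging to the second symmetric power of \<open>y'' = W y\<close>, which is impossible by comparing
  poles and degrees. Hence without a rational Riccati solution \<open>y1'/y1\<close>, \<open>y1\<close> and \<open>y2/y1\<close> are
  algebraically independent over \<open>K\<close> for every fundamental system, so any two fundamental systems with
  the same Wronskian are exchanged by an automorphism, and the Galois group is \<open>SL2\<close>. If \<open>u \<in> K\<close> is a Riccati
  solution and \<open>y1' = u y1\<close>, then \<open>y1\<close> and \<open>y2/y1\<close> are still independent, and the Galois group is \<open>Borel\<close>.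
  The same symmetric power governs the eigenring. Finally, a rational Riccati solution with reduced
  denominator \<open>q\<close> has the form \<open>q'/q + g\<close> with a polynomial \<open>g\<close>, and \<open>\<plusminus>g\<close> is the
  polynomial part of the square root of \<open>W\<close>.
\<close>

section \<open>Derivations and embeddings of rational function fields\<close>

text \<open>The group is computed by making \<open>L\<close> explicit. It is K(y1, y2/y1), or K(u,
  y1, y2/y1) with u = y1'/y1: y1 is an exponential and y2/y1 a primitive, since (y2/y1)' is the
  Wronskian divided by y1^2. The derivation of the corresponding abstract function field depends
  only on W, or on u, and on the value of the Wronskian. Two bases with equal Wronskian thus give
  two isomorphisms from one differential field onto \<open>L\<close>. The symmetric power enters
  because u1 - u2 is a constant divided by y1 y2 when u1, u2 are the logarithmic derivatives of y1,
  y2, and because for r = y1 y2 the expression 4 W r^2 + r'^2 - 2 r r'' is the square of the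
  Wronskian. For an irreducible quadratic p the difference u1 - u2 of its roots is not in K but its
  square, the discriminant, is; so the equation is rewritten for S = r^2, which produces the
  coefficients 16, 3, -4. The same r comes back as a solution of g' - 2 u g = c, the obstruction to
  the transcendence of y2/y1, and as the coefficient \<open>r1\<close> of an operator in the
  eigenring.\<close>

instance fract :: ("{idom,ring_char_0}") ring_char_0
proof
  show "inj (of_nat :: nat \<Rightarrow> 'a fract)"
    by (auto simp: inj_def of_nat_fract eq_fract)
qed

instance fract :: ("{idom,ring_char_0}") field_char_0 ..

text \<open>The gcd operations on polynomials over a field require coefficients of class \<^class>\<open>field_gcd\<close>.\<close>
instantiation fract ::
  (idom) "{unique_euclidean_ring, normalization_euclidean_semiring, normalization_semidom_multiplicative}"
begin

definition [simp]: "normalize_fract = (normalize_field :: 'a fract \<Rightarrow> _)"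
definition [simp]: "unit_factor_fract = (unit_factor_field :: 'a fract \<Rightarrow> _)"
definition [simp]: "modulo_fract = (mod_field :: 'a fract \<Rightarrow> _)"
definition [simp]: "euclidean_size_fract = (euclidean_size_field :: 'a fract \<Rightarrow> _)"
definition [simp]: "division_segment (x :: 'a fract) = 1"

instance
  by standard
    (simp_all add: dvd_field_iff field_split_simps split: if_splits)

end

instantiation fract :: (idom) euclidean_ring_gcd
begin

definition "gcd_fract = (Euclidean_Algorithm.gcd :: 'a fract \<Rightarrow> _)"
definition "lcm_fract = (Euclidean_Algorithm.lcm :: 'a fract \<Rightarrow> _)"
definition "Gcd_fract = (Euclidean_Algorithm.Gcd :: 'a fract set \<Rightarrow> _)"
definition "Lcm_fract = (Euclidean_Algorithm.Lcm :: 'a fract set \<Rightarrow> _)"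

instance by standard (simp_all add: gcd_fract_def lcm_fract_def Gcd_fract_def Lcm_fract_def)

end

instance fract :: (idom) field_gcd ..

lemma Fract_coprime_cases:
  fixes r :: "'a::{factorial_ring_gcd, semiring_gcd_mult_normalize} fract"
  obtains a b where "r = to_fract a / to_fract b" "b \<noteq> 0" "coprime a b"
proof -
  have "r = to_fract (fst (quot_of_fract r)) / to_fract (snd (quot_of_fract r))"
    by (metis Fract_quot_of_fract Fract_conv_to_fract)
  then show ?thesis
    using that[of "fst (quot_of_fract r)" "snd (quot_of_fract r)"] coprime_quot_of_fract[of r] by simp
qed

locale derivation =
  fixes d :: "'a::comm_ring_1 \<Rightarrow> 'a"
  assumes add: "d (x + y) = d x + d y"
    and mult: "d (x * y) = d x * y + x * d y"
begin

lemma zero [simp]: "d 0 = 0"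
  using add[of 0 0] by simp

lemma one [simp]: "d 1 = 0"
  using mult[of 1 1] by simp

lemma minus: "d (- x) = - d x"
  using add[of x "- x"] by (simp add: eq_neg_iff_add_eq_0 add.commute)

lemma diff: "d (x - y) = d x - d y"
  using add[of x "- y"] by (simp add: minus)

lemma of_nat [simp]: "d (of_nat n) = 0"
  by (induction n) (simp_all add: add)

lemma numeral [simp]: "d (numeral n) = 0"
  using of_nat[of "numeral n"] by simp

lemma power: "d (x ^ n) = of_nat n * x ^ (n - 1) * d x"
proof (induction n)
  case (Suc n)
  then show ?case by (cases n) (simp_all add: mult algebra_simps)
qed simp

end

lemma derivation_inverse:
  fixes d :: "'a::field \<Rightarrow> 'a"
  assumes "derivation d" "x \<noteq> 0"
  shows "d (inverse x) = - d x / x\<^sup>2"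
proof -
  interpret derivation d by fact
  have "d (x * inverse x) = 0" using assms(2) by simp
  then have "x * d (inverse x) = - d x * inverse x"
    by (simp add: mult eq_neg_iff_add_eq_0 add.commute)
  then have "x * d (inverse x) = x * (- d x / x\<^sup>2)"
    using assms(2) by (simp add: field_simps power2_eq_square)
  then show ?thesis using assms(2) mult_left_cancel by blast
qed

lemma derivation_divide:
  fixes d :: "'a::field \<Rightarrow> 'a"
  assumes "derivation d" "y \<noteq> 0"
  shows "d (x / y) = (d x * y - x * d y) / y\<^sup>2"
proof -
  interpret derivation d by fact
  show ?thesis
    using assms by (simp add: divide_inverse mult derivation_inverse) (simp add: field_simps power2_eq_square)
qed

text \<open>The source is only an integral domain and injectivity is assumed, so that evaluation of
  polynomials at a transcendental element is an instance; \<open>fract_lift\<close> then carries it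
  to the fraction field.\<close>

locale embedding =
  fixes \<phi> :: "'a::idom \<Rightarrow> 'b::field"
  assumes add: "\<phi> (x + y) = \<phi> x + \<phi> y"
    and mult: "\<phi> (x * y) = \<phi> x * \<phi> y"
    and one [simp]: "\<phi> 1 = 1"
    and eq_0D: "\<phi> x = 0 \<Longrightarrow> x = 0"
begin

lemma zero [simp]: "\<phi> 0 = 0"
  using add[of 0 0] by (metis add_cancel_right_left add.right_neutral)

lemma eq_0_iff [simp]: "\<phi> x = 0 \<longleftrightarrow> x = 0"
  using eq_0D by auto

lemma minus: "\<phi> (- x) = - \<phi> x"
  using add[of x "- x"] by (simp add: eq_neg_iff_add_eq_0 add.commute)

lemma diff: "\<phi> (x - y) = \<phi> x - \<phi> y"
  using add[of x "- y"] by (simp add: minus)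

lemma eq_iff [simp]: "\<phi> x = \<phi> y \<longleftrightarrow> x = y"
  using eq_0_iff[of "x - y"] by (simp only: diff right_minus_eq)

lemma of_nat [simp]: "\<phi> (of_nat n) = of_nat n"
  by (induction n) (simp_all add: add)

lemma numeral [simp]: "\<phi> (numeral n) = numeral n"
  using of_nat[of "numeral n"] by (simp only: of_nat_numeral)

lemma power: "\<phi> (x ^ n) = \<phi> x ^ n"
  by (induction n) (simp_all add: mult)

lemma inj: "inj \<phi>"
  by (simp add: inj_def)

lemmas homs = add mult diff minus power

end

lemma embedding_field:
  fixes \<phi> :: "'a::field \<Rightarrow> 'b::field"
  assumes "\<And>x y. \<phi> (x + y) = \<phi> x + \<phi> y" "\<And>x y. \<phi> (x * y) = \<phi> x * \<phi> y" "\<phi> 1 = 1"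
  shows "embedding \<phi>"
proof
  fix x assume "\<phi> x = 0"
  moreover have "\<phi> x * \<phi> (inverse x) = 1" if "x \<noteq> 0"
    using that assms(2)[of x "inverse x"] assms(3) by simp
  ultimately show "x = 0" by force
qed (use assms in auto)

lemma embedding_divide:
  fixes \<phi> :: "'a::field \<Rightarrow> 'b::field"
  assumes "embedding \<phi>"
  shows "\<phi> (x / y) = \<phi> x / \<phi> y"
proof -
  interpret embedding \<phi> by fact
  show ?thesis
  proof (cases "y = 0")
    case False
    then have "\<phi> (x / y) * \<phi> y = \<phi> x" by (simp flip: mult)
    with False show ?thesis by (simp add: field_simps)
  qed simp
qed

lemma embedding_inverse:
  fixes \<phi> :: "'a::field \<Rightarrow> 'b::field"
  assumes "embedding \<phi>"
  shows "\<phi> (inverse x) = inverse (\<phi> x)"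
  using embedding_divide[OF assms, of 1 x] embedding.one[OF assms] by (simp add: divide_inverse)

text \<open>The extension of \<open>d\<close> to a derivation of the polynomial ring that maps the indeterminate to \<open>v\<close>.\<close>
definition poly_deriv :: "('a::idom \<Rightarrow> 'a) \<Rightarrow> 'a poly \<Rightarrow> 'a poly \<Rightarrow> 'a poly" where
  "poly_deriv d v p = map_poly d p + v * pderiv p"

text \<open>The body is that of \<open>dK\<close> with an arbitrary derivation for
  \<open>pderiv\<close>, so facts about fraction fields reach \<open>dK\<close> through
  \<open>dK_eq\<close>.\<close>

definition fract_deriv :: "('a::idom \<Rightarrow> 'a) \<Rightarrow> 'a fract \<Rightarrow> 'a fract" where
  "fract_deriv \<delta> r = (SOME d. \<exists>p q. q \<noteq> 0 \<and> r = Fract p q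
             \<and> d = Fract (\<delta> p * q - p * \<delta> q) (q * q))"

definition fract_lift :: "('a::idom \<Rightarrow> 'b::field) \<Rightarrow> 'a fract \<Rightarrow> 'b" where
  "fract_lift f r = (SOME y. \<exists>p q. q \<noteq> 0 \<and> r = Fract p q \<and> y = f p / f q)"

definition peval :: "('a::zero \<Rightarrow> 'b::comm_ring_1) \<Rightarrow> 'b \<Rightarrow> 'a poly \<Rightarrow> 'b" where
  "peval \<phi> \<theta> p = poly (map_poly \<phi> p) \<theta>"

lemma dK_eq: "dK = fract_deriv pderiv"
  by (simp add: dK_def fract_deriv_def fun_eq_iff)

lemma derivation_pderiv: "derivation (pderiv :: 'a::idom poly \<Rightarrow> 'a poly)"
  by unfold_locales (simp_all add: pderiv_add pderiv_mult algebra_simps)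

context derivation begin

lemma map_poly_smult: "map_poly d (smult a q) = smult (d a) q + smult a (map_poly d q)"
  by (rule poly_eqI) (simp add: coeff_map_poly mult)

lemma derivation_map_poly: "derivation (map_poly d)"
proof
  show A: "map_poly d (p + q) = map_poly d p + map_poly d q" for p q :: "'a poly"
    by (rule poly_eqI) (simp add: coeff_map_poly add)
  show "map_poly d (p * q) = map_poly d p * q + p * map_poly d q" for p q :: "'a poly"
    by (induction p)
      (simp_all add: map_poly_pCons A map_poly_smult algebra_simps)
qed

end

lemma derivation_poly_deriv:
  fixes d :: "'a::idom \<Rightarrow> 'a"
  assumes "derivation d"
  shows "derivation (poly_deriv d v)"
proof -
  interpret m: derivation "map_poly d" using assms by (rule derivation.derivation_map_poly)
  show ?thesis
    by unfold_locales (simp_all add: poly_deriv_def m.add m.mult pderiv_add pderiv_mult algebra_simps)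
qed

lemma fract_deriv_Fract:
  assumes "derivation \<delta>" "q \<noteq> 0"
  shows "fract_deriv \<delta> (Fract p q) = Fract (\<delta> p * q - p * \<delta> q) (q * q)"
proof -
  interpret derivation \<delta> by fact
  have "Fract (\<delta> p' * q' - p' * \<delta> q') (q' * q') = Fract (\<delta> p * q - p * \<delta> q) (q * q)"
    if "q' \<noteq> 0" "Fract p q = Fract p' q'" for p' q'
  proof -
    have e: "p * q' = p' * q" using that assms(2) by (simp add: eq_fract)
    \<comment> \<open>Differentiating the cross-multiplied identity is what makes the quotient rule
      independent of the representative.\<close>
    then have e': "\<delta> p * q' + p * \<delta> q' = \<delta> p' * q + p' * \<delta> q" by (metis mult)
    have "(\<delta> p' * q' - p' * \<delta> q') * (q * q) = q' * q * (\<delta> p' * q + p' * \<delta> q) - q' * \<delta> q * (p' * q) - q * \<delta> q' * (p' * q)"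
      by (simp add: algebra_simps)
    also have "\<dots> = (\<delta> p * q - p * \<delta> q) * (q' * q')"
      unfolding e[symmetric] e'[symmetric] by (simp add: algebra_simps)
    finally show ?thesis using that assms(2) by (simp add: eq_fract)
  qed
  then show ?thesis unfolding fract_deriv_def
    by (intro some_equality) (use assms(2) in blast)+
qed

lemma fract_deriv_to_fract:
  assumes "derivation \<delta>"
  shows "fract_deriv \<delta> (to_fract p) = to_fract (\<delta> p)"
proof -
  interpret derivation \<delta> by fact
  show ?thesis using fract_deriv_Fract[OF assms, of 1 p] by (simp add: to_fract_def)
qed

lemma derivation_fract_deriv:
  assumes "derivation \<delta>"
  shows "derivation (fract_deriv \<delta>)"
proof
  interpret derivation \<delta> by fact
  note [simp] = fract_deriv_Fract[OF assms] eq_fract mult add diff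
  show "fract_deriv \<delta> (x + y) = fract_deriv \<delta> x + fract_deriv \<delta> y" for x y
    by (cases x; cases y) (simp add: algebra_simps)
  show "fract_deriv \<delta> (x * y) = fract_deriv \<delta> x * y + x * fract_deriv \<delta> y" for x y
    by (cases x; cases y) (simp add: algebra_simps)
qed

lemma fract_lift_Fract:
  assumes "embedding f" "q \<noteq> 0"
  shows "fract_lift f (Fract p q) = f p / f q"
proof -
  interpret embedding f by fact
  have "f p' / f q' = f p / f q" if "q' \<noteq> 0" "Fract p q = Fract p' q'" for p' q'
  proof -
    have "p * q' = p' * q" using that assms(2) by (simp add: eq_fract)
    then have "f p * f q' = f p' * f q" by (metis mult)
    then show ?thesis using that assms(2) by (simp add: field_simps)
  qed
  then show ?thesis unfolding fract_lift_def
    by (intro some_equality) (use assms(2) in blast)+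
qed

lemma fract_lift_to_fract: "embedding f \<Longrightarrow> fract_lift f (to_fract p) = f p"
  using fract_lift_Fract[of f 1 p] by (simp add: to_fract_def embedding.one)

lemma embedding_fract_lift:
  assumes "embedding f"
  shows "embedding (fract_lift f)"
proof (rule embedding_field)
  interpret embedding f by fact
  note [simp] = fract_lift_Fract[OF assms]
  show "fract_lift f (x + y) = fract_lift f x + fract_lift f y" for x y
    by (cases x; cases y) (simp add: add mult field_simps)
  show "fract_lift f (x * y) = fract_lift f x * fract_lift f y" for x y
    by (cases x; cases y) (simp add: mult)
  show "fract_lift f 1 = 1" by (simp add: One_fract_def)
qed

lemma fract_lift_deriv:
  assumes "embedding f" "derivation \<delta>" "derivation D" "\<And>a. D (f a) = f (\<delta> a)"
  shows "D (fract_lift f r) = fract_lift f (fract_deriv \<delta> r)"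
proof (cases r)
  case (Fract p q)
  interpret embedding f by fact
  show ?thesis
    using Fract assms
    by (simp add: fract_lift_Fract fract_deriv_Fract derivation_divide mult diff power2_eq_square)
qed

section \<open>Evaluation of polynomials at an element of an extension field\<close>

context embedding begin

lemma peval_0 [simp]: "peval \<phi> \<theta> 0 = 0"
  by (simp add: peval_def)

lemma peval_pCons [simp]: "peval \<phi> \<theta> (pCons a p) = \<phi> a + \<theta> * peval \<phi> \<theta> p"
  by (simp add: peval_def map_poly_pCons)

lemma peval_1 [simp]: "peval \<phi> \<theta> 1 = 1"
  by (simp add: one_pCons)

lemma peval_add: "peval \<phi> \<theta> (p + q) = peval \<phi> \<theta> p + peval \<phi> \<theta> q"
proof -
  have "map_poly \<phi> (p + q) = map_poly \<phi> p + map_poly \<phi> q"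
    by (rule poly_eqI) (simp add: coeff_map_poly add)
  then show ?thesis by (simp add: peval_def)
qed

lemma peval_smult: "peval \<phi> \<theta> (smult c p) = \<phi> c * peval \<phi> \<theta> p"
  by (induction p) (simp_all add: mult algebra_simps)

lemma peval_mult: "peval \<phi> \<theta> (p * q) = peval \<phi> \<theta> p * peval \<phi> \<theta> q"
  by (induction p) (simp_all add: peval_add peval_smult algebra_simps)

lemma peval_diff: "peval \<phi> \<theta> (p - q) = peval \<phi> \<theta> p - peval \<phi> \<theta> q"
  using peval_add[of \<theta> "p - q" q] by simp

lemma embedding_peval:
  assumes "\<And>p. peval \<phi> \<theta> p = 0 \<Longrightarrow> p = 0"
  shows "embedding (peval \<phi> \<theta>)"
  using assms by unfold_locales (simp_all add: peval_add peval_mult)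

lemma peval_deriv:
  assumes "derivation d" "derivation D" "\<And>a. D (\<phi> a) = \<phi> (d a)" "D \<theta> = peval \<phi> \<theta> v"
  shows "D (peval \<phi> \<theta> p) = peval \<phi> \<theta> (poly_deriv d v p)"
proof -
  interpret D: derivation D by fact
  interpret d: derivation d by fact
  interpret dv: derivation "poly_deriv d v" using assms(1) by (rule derivation_poly_deriv)
  show ?thesis
  proof (induction p)
    case (pCons a p)
    have "pCons a p = [:a:] + [:0,1:] * p" by simp
    moreover have "poly_deriv d v [:a:] = [:d a:]" "poly_deriv d v [:0,1:] = v"
      by (simp_all add: poly_deriv_def map_poly_pCons pderiv_pCons)
    ultimately have "poly_deriv d v (pCons a p) = [:d a:] + v * p + [:0,1:] * poly_deriv d v p"
      by (simp only: dv.add dv.mult) (simp add: algebra_simps)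
    then show ?case using pCons
      by (simp add: D.add D.mult assms peval_add peval_mult algebra_simps)
  qed simp
qed

end

section \<open>Exponentials and primitives\<close>

text \<open>Opens each transcendence proof: applying \<open>D\<close> to a relation yields a
  relation, so the minimal polynomial of an algebraic element divides its own image under the lifted
  derivation.\<close>

lemma minimal_annihilator:
  fixes \<phi> :: "'k::field \<Rightarrow> 'L::field"
  assumes "embedding \<phi>" "p0 \<noteq> 0" "peval \<phi> \<theta> p0 = 0"
  obtains p where "lead_coeff p = 1" "peval \<phi> \<theta> p = 0" "irreducible p"
    "\<And>q. peval \<phi> \<theta> q = 0 \<Longrightarrow> p dvd q"
proof -
  interpret embedding \<phi> by fact
  obtain p1 where p1: "p1 \<noteq> 0" "peval \<phi> \<theta> p1 = 0"
    and min: "\<And>q. q \<noteq> 0 \<Longrightarrow> peval \<phi> \<theta> q = 0 \<Longrightarrow> degree p1 \<le> degree q"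
    using ex_has_least_nat[of "\<lambda>p. p \<noteq> 0 \<and> peval \<phi> \<theta> p = 0" p0 degree] assms(2,3) by blast
  define p where "p = smult (inverse (lead_coeff p1)) p1"
  have p: "lead_coeff p = 1" "p \<noteq> 0" "degree p = degree p1" "peval \<phi> \<theta> p = 0"
    using p1 by (auto simp: p_def peval_smult)
  have dvd: "p dvd q" if "peval \<phi> \<theta> q = 0" for q
  proof (rule ccontr)
    assume nd: "\<not> p dvd q"
    have "q mod p = q - q div p * p" by (simp add: minus_div_mult_eq_mod)
    then have "peval \<phi> \<theta> (q mod p) = 0" using that p by (simp add: peval_diff peval_mult)
    moreover have "q mod p \<noteq> 0" using nd by auto
    moreover have "degree (q mod p) < degree p1"
      using degree_mod_less_degree[of p q] nd p by simp
    ultimately show False using min by fastforce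
  qed
  have "irreducible p"
  proof (rule irreducibleI)
    show "p \<noteq> 0" by fact
    show "\<not> p dvd 1"
    proof
      assume "p dvd 1"
      then obtain k where "1 = p * k" by (rule dvdE)
      then have "peval \<phi> \<theta> 1 = peval \<phi> \<theta> p * peval \<phi> \<theta> k" by (simp only: peval_mult[symmetric])
      with p(4) show False by simp
    qed
    fix a b assume ab: "p = a * b"
    then have nz: "a \<noteq> 0" "b \<noteq> 0" using p by auto
    have "peval \<phi> \<theta> a = 0 \<or> peval \<phi> \<theta> b = 0" using p(4) ab by (simp add: peval_mult)
    moreover have "degree p = degree a + degree b" using ab nz by (simp add: degree_mult_eq)
    ultimately have "degree a = 0 \<or> degree b = 0"
      using min[of a] min[of b] nz p(3) by auto
    then show "a dvd 1 \<or> b dvd 1" using nz by (auto simp: is_unit_iff_degree)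
  qed
  with p dvd that show ?thesis by blast
qed

context derivation begin

lemma coeff_map_deriv [simp]: "coeff (map_poly d p) i = d (coeff p i)"
  by (simp add: coeff_map_poly)

end

lemma coeff_exp_deriv:
  fixes d :: "'a::idom \<Rightarrow> 'a"
  assumes "derivation d"
  shows "coeff (poly_deriv d [:0, h:] p) i = d (coeff p i) + of_nat i * h * coeff p i"
proof -
  interpret derivation d by fact
  show ?thesis by (cases i) (simp_all add: poly_deriv_def coeff_pderiv algebra_simps)
qed

lemma poly_deriv_smult:
  fixes d :: "'a::idom \<Rightarrow> 'a"
  assumes "derivation d"
  shows "poly_deriv d v (smult c p) = smult (d c) p + smult c (poly_deriv d v p)"
proof -
  interpret derivation d by fact
  show ?thesis by (simp add: poly_deriv_def map_poly_smult pderiv_smult smult_add_right add_ac)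
qed

lemma poly_deriv_const:
  fixes d :: "'a::idom \<Rightarrow> 'a"
  assumes "derivation d"
  shows "poly_deriv d v [:c:] = [:d c:]"
  using derivation.zero[OF assms] by (simp add: poly_deriv_def map_poly_pCons pderiv_pCons)

lemma poly_deriv_X:
  fixes d :: "'a::idom \<Rightarrow> 'a"
  assumes "derivation d"
  shows "poly_deriv d v [:0, 1:] = v"
  using derivation.zero[OF assms] derivation.one[OF assms]
  by (simp add: poly_deriv_def map_poly_pCons pderiv_pCons)

text \<open>The derivation with X' = h X does not raise degrees, so for a monic polynomial of degree
  n only the cofactor n h is possible; the constant coefficient then solves f' = n h f. Vanishing at
  0 must be excluded because X divides its own derivative.\<close>

lemma exp_darboux_const:
  fixes d :: "'k::field \<Rightarrow> 'k"
  assumes d: "derivation d"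
    and no_exp: "\<And>f N. f \<noteq> 0 \<Longrightarrow> N > 0 \<Longrightarrow> d f \<noteq> of_nat N * h * f"
    and p: "coeff p 0 \<noteq> 0" "p dvd poly_deriv d [:0, h:] p"
  shows "degree p = 0"
proof (rule ccontr)
  assume deg: "degree p \<noteq> 0"
  interpret derivation d by fact
  define q where "q = smult (inverse (lead_coeff p)) p"
  have "p \<noteq> 0" using p by auto
  then have q: "lead_coeff q = 1" "degree q = degree p" "coeff q 0 \<noteq> 0"
    using p by (auto simp: q_def)
  have "p dvd poly_deriv d [:0, h:] q"
    unfolding q_def poly_deriv_smult[OF d] by (intro dvd_add dvd_smult p) auto
  then have dv: "q dvd poly_deriv d [:0, h:] q"
    using \<open>p \<noteq> 0\<close> by (simp add: q_def smult_dvd_iff)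
  define r where "r = poly_deriv d [:0, h:] q - smult (of_nat (degree q) * h) q"
  have coeff_r: "coeff r i = d (coeff q i) + (of_nat i - of_nat (degree q)) * h * coeff q i" for i
    by (simp add: r_def coeff_exp_deriv[OF d] algebra_simps)
  have "coeff r i = 0" if "i \<ge> degree q" for i
    using that q(1) by (cases "i = degree q") (auto simp: coeff_r coeff_eq_0)
  then have "r = 0 \<or> degree r < degree q"
    using deg q(2) by (metis leading_coeff_0_iff not_le_imp_less)
  moreover have "q dvd r" unfolding r_def by (intro dvd_diff dv dvd_smult) simp
  ultimately have "r = 0" using dvd_imp_degree_le[of q r] by (cases "r = 0") auto
  then have "d (coeff q 0) = of_nat (degree q) * h * coeff q 0"
    using coeff_r[of 0] by simp
  with no_exp q deg show False by simp
qed

lemma exp_transcendental: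
  fixes \<phi> :: "'k::field \<Rightarrow> 'L::field"
  assumes \<phi>: "embedding \<phi>" and d: "derivation d" and D: "derivation D" "\<And>a. D (\<phi> a) = \<phi> (d a)"
    and y: "y \<noteq> 0" "D y = \<phi> h * y"
    and no_exp: "\<And>f N. f \<noteq> 0 \<Longrightarrow> N > 0 \<Longrightarrow> d f \<noteq> of_nat N * h * f"
    and p0: "peval \<phi> y p0 = 0"
  shows "p0 = 0"
proof (rule ccontr)
  assume "p0 \<noteq> 0"
  interpret embedding \<phi> by fact
  from minimal_annihilator[OF \<phi> \<open>p0 \<noteq> 0\<close> p0] obtain p where
    p: "lead_coeff p = 1" "peval \<phi> y p = 0" "irreducible p" "\<And>q. peval \<phi> y q = 0 \<Longrightarrow> p dvd q"
    by blast
  have "peval \<phi> y (poly_deriv d [:0, h:] p) = D (peval \<phi> y p)"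
    using peval_deriv[OF d D, of y "[:0, h:]"] y by simp
  then have "p dvd poly_deriv d [:0, h:] p"
    using p(2,4) derivation.zero[OF D(1)] by simp
  \<comment> \<open>Otherwise p = X r, and y being nonzero would make r a relation of smaller
    degree.\<close>
  moreover have "coeff p 0 \<noteq> 0"
  proof
    assume "coeff p 0 = 0"
    then obtain r where r: "p = pCons 0 r" by (cases p) auto
    with p(2) y have "peval \<phi> y r = 0" by simp
    then have "p dvd r" by (rule p)
    moreover have "r \<noteq> 0" using r p(1) by auto
    ultimately have "degree p \<le> degree r" by (simp add: dvd_imp_degree_le)
    with r \<open>r \<noteq> 0\<close> show False by simp
  qed
  ultimately have "degree p = 0" by (intro exp_darboux_const[OF d no_exp])
  with p show False by (metis irreducible_def is_unit_iff_degree)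
qed

text \<open>On a monic minimal polynomial of degree n + 1 the rule X' = c lowers the degree, so its
  image, being a multiple of it, is zero. The coefficient of X^n reads p_n' + (n + 1) c = 0, and -
  p_n / (n + 1) is a primitive of c.\<close>

lemma primitive_transcendental:
  fixes \<phi> :: "'k::field_char_0 \<Rightarrow> 'L::field"
  assumes \<phi>: "embedding \<phi>" and d: "derivation d" and D: "derivation D" "\<And>a. D (\<phi> a) = \<phi> (d a)"
    and z: "D z = \<phi> c"
    and no_prim: "\<And>f. d f \<noteq> c"
    and p0: "peval \<phi> z p0 = 0"
  shows "p0 = 0"
proof (rule ccontr)
  assume "p0 \<noteq> 0"
  interpret embedding \<phi> by fact
  interpret d: derivation d by fact
  from minimal_annihilator[OF \<phi> \<open>p0 \<noteq> 0\<close> p0] obtain p where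
    p: "lead_coeff p = 1" "peval \<phi> z p = 0" "irreducible p" "\<And>q. peval \<phi> z q = 0 \<Longrightarrow> p dvd q"
    by blast
  have "degree p \<noteq> 0" using p by (metis irreducible_def is_unit_iff_degree)
  then obtain n where n: "degree p = Suc n" by (cases "degree p") auto
  define r where "r = poly_deriv d [:c:] p"
  have coeff_r: "coeff r i = d (coeff p i) + c * (of_nat (Suc i) * coeff p (Suc i))" for i
    by (simp add: r_def poly_deriv_def coeff_pderiv algebra_simps)
  have "peval \<phi> z r = D (peval \<phi> z p)"
    unfolding r_def using peval_deriv[OF d D, of z "[:c:]"] z by simp
  then have "p dvd r"
    using p(2,4) derivation.zero[OF D(1)] by simp
  moreover have "coeff r i = 0" if "i \<ge> degree p" for i
    using that p(1) by (cases "i = degree p") (auto simp: coeff_r coeff_eq_0)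
  then have "r = 0 \<or> degree r < degree p"
    using n by (metis leading_coeff_0_iff not_le_imp_less)
  ultimately have "r = 0" using dvd_imp_degree_le[of p r] by (cases "r = 0") auto
  then have e: "d (coeff p n) + c * of_nat (Suc n) = 0"
    using coeff_r[of n] p(1) n by simp
  have "d (- coeff p n / of_nat (Suc n)) * of_nat (Suc n) = d (- coeff p n / of_nat (Suc n) * of_nat (Suc n))"
    by (simp only: d.mult d.of_nat) simp
  also have "\<dots> = - d (coeff p n)" by (simp add: d.minus del: of_nat_Suc)
  also have "\<dots> = c * of_nat (Suc n)" using e by (metis add_eq_0_iff minus_minus)
  finally have "d (- coeff p n / of_nat (Suc n)) = c" by (simp del: of_nat_Suc)
  with no_prim show False by blast
qed

text \<open>Here X' = h X. The denominator of a primitive of c / X^2 can only be a power of X, so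
  the primitive is a Laurent polynomial, and its coefficient g of X^-2 would solve g' - 2 h g =
  c.\<close>

lemma no_primitive_over_exp:
  fixes d :: "'k::{field_gcd,ring_char_0} \<Rightarrow> 'k"
  assumes d: "derivation d"
    and no_exp: "\<And>f N. f \<noteq> 0 \<Longrightarrow> N > 0 \<Longrightarrow> d f \<noteq> of_nat N * h * f"
    and no_sol: "\<And>g. d g - 2 * h * g \<noteq> c"
  shows "fract_deriv (poly_deriv d [:0, h:]) f \<noteq> to_fract [:c:] / (to_fract [:0, 1:])\<^sup>2"
proof
  assume asm: "fract_deriv (poly_deriv d [:0, h:]) f = to_fract [:c:] / (to_fract [:0, 1:])\<^sup>2"
  define \<delta> where "\<delta> = poly_deriv d [:0, h:]"
  define X where "X = [:0, 1 :: 'k:]"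
  have X: "prime_elem X" "X \<noteq> 0" unfolding X_def using prime_elem_linear_field_poly[of 1 0] by simp_all
  have \<delta>: "derivation \<delta>" unfolding \<delta>_def using d by (rule derivation_poly_deriv)
  interpret d: derivation d by fact
  interpret derivation \<delta> by fact
  have F: "derivation (fract_deriv \<delta>)" using \<delta> by (rule derivation_fract_deriv)
  have \<delta>X: "\<delta> (X ^ m) = smult (of_nat m * h) (X ^ m)" for m
  proof -
    have "\<delta> X = smult h X" unfolding \<delta>_def X_def poly_deriv_X[OF d] by simp
    then have "\<delta> (X ^ m) = smult (of_nat m * h) (X ^ (m - 1) * X)"
      by (simp add: power of_nat_poly mult.commute)
    then show ?thesis by (cases m) (simp_all add: mult.commute)
  qed
  have eq: "X\<^sup>2 * (\<delta> a * b - a * \<delta> b) = [:c:] * b\<^sup>2"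
    if f: "f = to_fract a / to_fract b" and "b \<noteq> 0" for a b
  proof -
    have "to_fract [:c:] / (to_fract X)\<^sup>2 = (to_fract (\<delta> a) * to_fract b - to_fract a * to_fract (\<delta> b)) / (to_fract b)\<^sup>2"
      using derivation_divide[OF F, of "to_fract b" "to_fract a"] that asm
      by (simp add: fract_deriv_to_fract[OF \<delta>] flip: \<delta>_def X_def)
    then have "to_fract [:c:] * (to_fract b)\<^sup>2 = (to_fract (\<delta> a) * to_fract b - to_fract a * to_fract (\<delta> b)) * (to_fract X)\<^sup>2"
      using that X by (simp add: frac_eq_eq)
    then have "to_fract ([:c:] * b\<^sup>2) = to_fract (X\<^sup>2 * (\<delta> a * b - a * \<delta> b))"
      by (simp only: power2_eq_square to_fract_mult to_fract_diff mult_ac)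
    then show ?thesis by (metis to_fract_eq_iff)
  qed
  obtain a b where ab: "f = to_fract a / to_fract b" "b \<noteq> 0" "coprime a b"
    by (rule Fract_coprime_cases)
  \<comment> \<open>The power of X is split off because X divides its own derivative; what remains
    is forced to be constant by \<open>exp_darboux_const\<close>.\<close>
  obtain b1 where b1: "b = X ^ order 0 b * b1" "\<not> X dvd b1"
    using order_decomp[OF ab(2), of 0] by (auto simp: X_def)
  define m where "m = order 0 b"
  have "b dvd X\<^sup>2 * a * \<delta> b"
  proof -
    have "X\<^sup>2 * a * \<delta> b = b * (X\<^sup>2 * \<delta> a - [:c:] * b)"
      using eq[OF ab(1,2)] by (simp add: algebra_simps power2_eq_square)
    then show ?thesis by simp
  qed
  then have "b dvd a * (X\<^sup>2 * \<delta> b)" by (simp add: mult_ac)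
  then have "b dvd X\<^sup>2 * \<delta> b"
    using ab(3) coprime_dvd_mult_right_iff coprime_commute by blast
  then have "b1 dvd X\<^sup>2 * \<delta> b" using b1 dvd_mult_right by metis
  also have "X\<^sup>2 * \<delta> b = X ^ (m + 2) * \<delta> b1 + b1 * smult (of_nat m * h) (X ^ (m + 2))"
    by (subst b1) (simp add: mult \<delta>X algebra_simps power2_eq_square flip: m_def)
  finally have "b1 dvd (X ^ (m + 2) * \<delta> b1 + b1 * smult (of_nat m * h) (X ^ (m + 2)))
      - b1 * smult (of_nat m * h) (X ^ (m + 2))"
    by (rule dvd_diff) (rule dvd_triv_left)
  then have "b1 dvd X ^ (m + 2) * \<delta> b1" by (simp only: add_diff_cancel_right')
  moreover have "coprime b1 (X ^ (m + 2))"
    using prime_elem_imp_coprime[OF X(1) b1(2)] by (simp add: coprime_commute del: power_Suc)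
  ultimately have "b1 dvd \<delta> b1" using coprime_dvd_mult_right_iff by blast
  moreover have "coeff b1 0 \<noteq> 0"
    using b1(2) by (auto simp: X_def dvd_iff_poly_eq_0 poly_0_coeff_0)
  ultimately have "degree b1 = 0"
    unfolding \<delta>_def by (intro exp_darboux_const[OF d no_exp])
  then obtain l where l: "b1 = [:l:]" by (metis degree_eq_zeroE)
  have "l \<noteq> 0" using l b1 X by auto
  define a' where "a' = smult (inverse l) a"
  have "f = to_fract a' / to_fract (X ^ m)"
  proof -
    have "b = smult l (X ^ m)" by (subst b1) (simp add: l m_def)
    then have "a * X ^ m = a' * b" using \<open>l \<noteq> 0\<close> by (simp add: a'_def)
    then have "to_fract a * to_fract (X ^ m) = to_fract a' * to_fract b" by (metis to_fract_mult)
    then show ?thesis using ab X by (simp add: frac_eq_eq)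
  qed
  from eq[OF this] X have "(X\<^sup>2 * (\<delta> a' - smult (of_nat m * h) a')) * X ^ m = ([:c:] * X ^ m) * X ^ m"
    by (simp add: \<delta>X power2_eq_square algebra_simps)
  moreover have "X ^ m \<noteq> 0" using X by simp
  ultimately have "X\<^sup>2 * (\<delta> a' - smult (of_nat m * h) a') = [:c:] * X ^ m"
    using mult_right_cancel by blast
  then have *: "monom 1 2 * (\<delta> a' - smult (of_nat m * h) a') = monom c m"
    by (simp add: X_def monom_altdef)
  \<comment> \<open>Coefficient m here is the coefficient of X^-2 in the derivative of a' /
    X^m.\<close>
  have c: "coeff (monom 1 2 * (\<delta> a' - smult (of_nat m * h) a')) m = c"
    unfolding * by simp
  show False
  proof (cases "m \<ge> 2")
    case True
    then have "d (coeff a' (m - 2)) + of_nat (m - 2) * h * coeff a' (m - 2) - of_nat m * h * coeff a' (m - 2) = c"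
      using c by (simp add: coeff_monom_mult \<delta>_def coeff_exp_deriv[OF d])
    moreover have "of_nat m = of_nat (m - 2) + (2 :: 'k)" using True by (simp add: of_nat_diff)
    ultimately have "d (coeff a' (m - 2)) - 2 * h * coeff a' (m - 2) = c"
      by (simp add: algebra_simps)
    with no_sol show False by blast
  next
    \<comment> \<open>With m < 2 there is no term in X^-2, so c = 0, and then g = 0 contradicts
      \<open>no_sol\<close>.\<close>
    case False
    then have "c = 0" using c by (simp add: coeff_monom_mult)
    with no_sol[of 0] show False by simp
  qed
qed

text \<open>On the field \<open>k(y, z)\<close> of rational functions in two variables, the derivation with \<open>y' = h y\<close>
  and \<open>z' = c / y\<^sup>2\<close>.\<close>
definition exp_int_deriv ::
  "('k::{field_gcd,ring_char_0} \<Rightarrow> 'k) \<Rightarrow> 'k \<Rightarrow> 'k \<Rightarrow> 'k poly fract poly fract \<Rightarrow> 'k poly fract poly fract"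
  where "exp_int_deriv d h c =
    fract_deriv (poly_deriv (fract_deriv (poly_deriv d [:0, h:])) [:to_fract [:c:] / (to_fract [:0, 1:])\<^sup>2:])"

text \<open>Applied over K when a rational Riccati solution exists and over K(U) otherwise. The
  hypotheses \<open>no_exp\<close> and \<open>no_sol\<close> are what the transcendence of y over k
  and of z over k(y) come down to.\<close>

lemma exp_int_embedding:
  fixes \<phi> :: "'k::{field_gcd,ring_char_0} \<Rightarrow> 'L::field"
  assumes \<phi>: "embedding \<phi>" and d: "derivation d" and D: "derivation D" "\<And>a. D (\<phi> a) = \<phi> (d a)"
    and y: "y \<noteq> 0" "D y = \<phi> h * y" and z: "D z = \<phi> c / y\<^sup>2"
    and no_exp: "\<And>f N. f \<noteq> 0 \<Longrightarrow> N > 0 \<Longrightarrow> d f \<noteq> of_nat N * h * f"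
    and no_sol: "\<And>g. d g - 2 * h * g \<noteq> c"
  obtains \<Psi> where "embedding \<Psi>" "\<And>r. D (\<Psi> r) = \<Psi> (exp_int_deriv d h c r)"
    "\<And>a. \<Psi> (to_fract [:to_fract [:a:]:]) = \<phi> a"
    "\<Psi> (to_fract [:to_fract [:0, 1:]:]) = y" "\<Psi> (to_fract [:0, 1:]) = z"
proof -
  define d1 where "d1 = fract_deriv (poly_deriv d [:0, h:])"
  define c1 where "c1 = to_fract [:c:] / (to_fract [:0, 1:])\<^sup>2"
  define \<phi>1 where "\<phi>1 = fract_lift (peval \<phi> y)"
  define \<Psi> where "\<Psi> = fract_lift (peval \<phi>1 z)"
  interpret embedding \<phi> by fact
  have E: "embedding (peval \<phi> y)"
    by (rule embedding_peval) (rule exp_transcendental[OF \<phi> d D y no_exp])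
  have \<phi>1: "embedding \<phi>1" unfolding \<phi>1_def by (rule embedding_fract_lift[OF E])
  interpret \<phi>1: embedding \<phi>1 by fact
  have dd: "derivation (poly_deriv d [:0, h:])" using d by (rule derivation_poly_deriv)
  have d1: "derivation d1" unfolding d1_def using dd by (rule derivation_fract_deriv)
  have D1: "D (\<phi>1 a) = \<phi>1 (d1 a)" for a
    unfolding \<phi>1_def d1_def
    by (rule fract_lift_deriv[OF E dd D(1)], rule peval_deriv[OF d D]) (use y in simp)
  have \<phi>1_const: "\<phi>1 (to_fract [:a:]) = \<phi> a" for a
    by (simp add: \<phi>1_def fract_lift_to_fract[OF E])
  have \<phi>1_X: "\<phi>1 (to_fract [:0, 1:]) = y"
    by (simp add: \<phi>1_def fract_lift_to_fract[OF E])
  have z1: "D z = \<phi>1 c1"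
    unfolding c1_def by (simp add: embedding_divide[OF \<phi>1] \<phi>1.power \<phi>1_const \<phi>1_X z)
  have no_prim: "d1 f \<noteq> c1" for f
    unfolding d1_def c1_def by (rule no_primitive_over_exp[OF d no_exp no_sol])
  have E1: "embedding (peval \<phi>1 z)"
    by (rule \<phi>1.embedding_peval) (rule primitive_transcendental[OF \<phi>1 d1 D(1) D1 z1 no_prim])
  have dd1: "derivation (poly_deriv d1 [:c1:])" using d1 by (rule derivation_poly_deriv)
  have "D (\<Psi> r) = \<Psi> (exp_int_deriv d h c r)" for r
    unfolding \<Psi>_def exp_int_deriv_def d1_def[symmetric] c1_def[symmetric]
    by (rule fract_lift_deriv[OF E1 dd1 D(1)], rule \<phi>1.peval_deriv[OF d1 D(1) D1]) (simp add: z1)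
  moreover have "embedding \<Psi>" unfolding \<Psi>_def by (rule embedding_fract_lift[OF E1])
  ultimately show ?thesis
    by (intro that[of \<Psi>]) (simp_all add: \<Psi>_def fract_lift_to_fract[OF E1] \<phi>1_const \<phi>1_X)
qed

section \<open>Laurent expansions of rational functions\<close>

notation fls_nth (infixl \<open>$$\<close> 75)

lemma embedding_fls_const: "embedding (fls_const :: complex \<Rightarrow> complex fls)"
  by (rule embedding_field) (simp_all add: fls_plus_const)

text \<open>Differentiation with respect to \<open>x\<close>, for Laurent series in a parameter \<open>t\<close> with \<open>x = \<xi>(t)\<close>.\<close>
definition local_deriv :: "complex fls \<Rightarrow> complex fls \<Rightarrow> complex fls" where
  "local_deriv \<xi> f = fls_deriv f / fls_deriv \<xi>"

text \<open>Used with \<open>fls_const a + fls_X\<close> at a finite point and with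
  \<open>inf_pt\<close> at infinity; it is injective for every nonconstant \<xi>.\<close>

definition expand_at :: "complex fls \<Rightarrow> ratfun \<Rightarrow> complex fls" where
  "expand_at \<xi> = fract_lift (peval fls_const \<xi>)"

lemma derivation_local_deriv: "derivation (local_deriv \<xi>)"
  by unfold_locales (simp_all add: local_deriv_def add_divide_distrib)

text \<open>A complex polynomial splits into linear factors, and no factor \<xi> - r vanishes when
  \<xi> is nonconstant; the induction removes one factor at a time.\<close>

lemma embedding_peval_fls:
  fixes \<xi> :: "complex fls"
  assumes "\<And>c. \<xi> \<noteq> fls_const c"
  shows "embedding (peval fls_const \<xi>)"
proof -
  interpret embedding "fls_const :: complex \<Rightarrow> _" by (rule embedding_fls_const)
  show ?thesis
  proof (rule embedding_peval)
    fix p assume "peval fls_const \<xi> p = 0"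
    then show "p = 0"
    proof (induction "degree p" arbitrary: p)
      case 0
      then show ?case by (auto elim!: degree_eq_zeroE)
    next
      case (Suc n)
      then have "p \<noteq> 0" by auto
      from Suc obtain r where "poly p r = 0"
        using fundamental_theorem_of_algebra[of p] constant_degree[of p] by auto
      then obtain q where q: "p = [:- r, 1:] * q" by (auto simp: poly_eq_0_iff_dvd)
      have "\<xi> - fls_const r \<noteq> 0" using assms[of r] by simp
      moreover have "(\<xi> - fls_const r) * peval fls_const \<xi> q = 0"
        using Suc.prems(1) unfolding q peval_mult by simp
      ultimately have "peval fls_const \<xi> q = 0" by simp
      moreover have "q \<noteq> 0" using q \<open>p \<noteq> 0\<close> by auto
      moreover have "n = degree q" using Suc.hyps(2) \<open>q \<noteq> 0\<close> unfolding q by (subst (asm) degree_mult_eq) auto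
      ultimately show ?case using Suc.hyps(1) by blast
    qed
  qed
qed

lemma embedding_expand_at: "(\<And>c. \<xi> \<noteq> fls_const c) \<Longrightarrow> embedding (expand_at \<xi>)"
  unfolding expand_at_def by (intro embedding_fract_lift embedding_peval_fls)

lemma expand_at_polyK: "(\<And>c. \<xi> \<noteq> fls_const c) \<Longrightarrow> expand_at \<xi> (polyK p) = peval fls_const \<xi> p"
  unfolding expand_at_def polyK_def by (intro fract_lift_to_fract embedding_peval_fls)

lemma expand_at_dK:
  assumes nc: "\<And>c. \<xi> \<noteq> fls_const c" and "fls_deriv \<xi> \<noteq> 0"
  shows "local_deriv \<xi> (expand_at \<xi> r) = expand_at \<xi> (dK r)"
  unfolding expand_at_def dK_eq
proof (rule fract_lift_deriv[OF embedding_peval_fls[OF nc] derivation_pderiv derivation_local_deriv])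
  fix p
  interpret embedding "fls_const :: complex \<Rightarrow> _" by (rule embedding_fls_const)
  have d: "derivation (\<lambda>_::complex. 0 :: complex)" by unfold_locales simp_all
  have "local_deriv \<xi> (peval fls_const \<xi> p) = peval fls_const \<xi> (poly_deriv (\<lambda>_. 0) 1 p)"
    by (rule peval_deriv[OF d derivation_local_deriv]) (use assms(2) in \<open>simp_all add: local_deriv_def\<close>)
  also have "poly_deriv (\<lambda>_. 0) 1 p = pderiv p"
    by (simp add: poly_deriv_def poly_eq_iff coeff_map_poly)
  finally show "local_deriv \<xi> (peval fls_const \<xi> p) = peval fls_const \<xi> (pderiv p)" .
qed

text \<open>Phrased with lower bounds instead of subdegrees, so that it applies even where the
  coefficient at the bound vanishes, as it may for derivatives.\<close>

lemma fls_times_nth_bound: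
  fixes f g :: "'a::semiring_no_zero_divisors fls"
  assumes "\<And>i. i < a \<Longrightarrow> f $$ i = 0" "\<And>i. i < b \<Longrightarrow> g $$ i = 0"
  shows "(f * g) $$ (a + b) = f $$ a * g $$ b" and "i < a + b \<Longrightarrow> (f * g) $$ i = 0"
proof -
  have le: "a \<le> fls_subdegree f" if "f \<noteq> 0" using assms that by (intro fls_subdegree_geI) auto
  have le': "b \<le> fls_subdegree g" if "g \<noteq> 0" using assms that by (intro fls_subdegree_geI) auto
  show "(f * g) $$ (a + b) = f $$ a * g $$ b"
  proof (cases "f = 0 \<or> g = 0")
    case False
    show ?thesis
    proof (cases "fls_subdegree f = a \<and> fls_subdegree g = b")
      case True
      then show ?thesis using fls_times_base[of f g] by simp
    next
      case F: False
      then have "a + b < fls_subdegree f + fls_subdegree g" using le le' False by force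
      moreover have "f $$ a = 0 \<or> g $$ b = 0" using F le le' False by force
      ultimately show ?thesis by (auto simp: fls_times_nth_eq0)
    qed
  qed auto
  show "(f * g) $$ i = 0" if "i < a + b"
    using le le' that by (cases "f = 0"; cases "g = 0") (auto intro!: fls_times_nth_eq0)
qed

section \<open>The field K: its polynomials, its derivation, poles at finite points\<close>

lemma polyK_hom [simp]: "polyK (p + q) = polyK p + polyK q" "polyK (p * q) = polyK p * polyK q"
  "polyK (p - q) = polyK p - polyK q" "polyK (- p) = - polyK p" "polyK 0 = 0" "polyK 1 = 1"
  by (simp_all add: polyK_def)

lemma polyK_eq_iff [simp]: "polyK p = polyK q \<longleftrightarrow> p = q"
  by (simp add: polyK_def)

lemma embedding_polyK: "embedding polyK"
  by unfold_locales (simp_all add: polyK_def)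

lemmas polyK_power [simp] = embedding.power[OF embedding_polyK]
  and polyK_numeral [simp] = embedding.numeral[OF embedding_polyK]

lemma constK_conv_polyK: "constK c = polyK [:c:]"
  by (simp add: constK_def polyK_def)

lemma derivation_dK: "derivation dK"
  unfolding dK_eq by (intro derivation_fract_deriv derivation_pderiv)

lemma dK_polyK [simp]: "dK (polyK p) = polyK (pderiv p)"
  unfolding dK_eq polyK_def by (intro fract_deriv_to_fract derivation_pderiv)

text \<open>If the expansion of \<open>S\<close> had no pole, S q = p would have constant term 0 on
  the left and the nonzero value of \<open>p\<close> at \<open>a\<close> on the right.\<close>

lemma expand_at_pole:
  assumes "poly q a = 0" "coprime p q" "q \<noteq> 0" "S = to_fract p / to_fract q"
  shows "fls_subdegree (expand_at (fls_const a + fls_X) S) < 0"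
proof -
  define \<xi> where "\<xi> = fls_const a + (fls_X :: complex fls)"
  have nc: "\<xi> \<noteq> fls_const c" for c
    by (auto simp: \<xi>_def fls_eq_iff intro!: exI[of _ 1])
  interpret c: embedding "fls_const :: complex \<Rightarrow> _" by (rule embedding_fls_const)
  interpret embedding "expand_at \<xi>" by (rule embedding_expand_at[OF nc])
  have reg: "fls_subdegree (peval fls_const \<xi> r) \<ge> 0" for r
  proof (induction r)
    case (pCons b r)
    have "fls_subdegree \<xi> \<ge> 0" by (rule fls_subdegree_ge0I) (simp add: \<xi>_def)
    show ?case
      by (rule fls_subdegree_ge0I) (use pCons \<open>fls_subdegree \<xi> \<ge> 0\<close> in \<open>auto intro!: fls_times_nth_eq0\<close>)
  qed simp
  have val: "peval fls_const \<xi> r $$ 0 = poly r a" for r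
  proof -
    have "poly (r - [:poly r a:]) a = 0" by simp
    then obtain s where "r - [:poly r a:] = [:- a, 1:] * s"
      unfolding poly_eq_0_iff_dvd by (rule dvdE)
    then have s: "r = [:poly r a:] + [:- a, 1:] * s" by (simp only: diff_eq_eq add.commute)
    then have "peval fls_const \<xi> r = fls_const (poly r a) + fls_X * peval fls_const \<xi> s"
      by (subst s, unfold c.peval_add c.peval_mult) (simp add: \<xi>_def)
    moreover have "(fls_X * peval fls_const \<xi> s) $$ 0 = 0"
      using reg[of s] by (intro fls_times_nth_eq0) simp
    ultimately show ?thesis by simp
  qed
  have "poly p a \<noteq> 0" using assms(1,2) coprime_poly_0 by blast
  have "S * polyK q = polyK p" using assms by (simp add: polyK_def)
  then have e: "expand_at \<xi> S * peval fls_const \<xi> q = peval fls_const \<xi> p"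
    by (metis mult expand_at_polyK[OF nc])
  show ?thesis
  proof (rule ccontr)
    assume "\<not> ?thesis"
    then have "expand_at \<xi> S $$ i = 0" if "i < 0" for i using that by (simp add: \<xi>_def)
    moreover have "peval fls_const \<xi> q $$ i = 0" if "i < 1" for i
      using that reg[of q] val[of q] assms(1) by (cases "i = 0") auto
    ultimately have "(expand_at \<xi> S * peval fls_const \<xi> q) $$ 0 = 0"
      by (intro fls_times_nth_bound(2)[of 0 _ 1]) auto
    then show False using e val[of p] \<open>poly p a \<noteq> 0\<close> by simp
  qed
qed

text \<open>At a pole, with v < 0 the order of S, the two terms containing derivatives start at
  exponent 2 v - 2 and the others later. Their coefficient there is 3 v^2 - 4 v (v - 1) = v (4 - v)
  times a nonzero square, which does not vanish.\<close>

lemma rational_solution_polynomial: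
  assumes "16 * polyK W * S\<^sup>2 + 3 * (dK S)\<^sup>2 - 4 * S * dK (dK S) = constK c * S"
  obtains s where "S = polyK s"
proof -
  obtain p q where pq: "S = to_fract p / to_fract q" "q \<noteq> 0" "coprime p q"
    by (rule Fract_coprime_cases)
  have "degree q = 0"
  proof (rule ccontr)
    assume "degree q \<noteq> 0"
    then obtain a where a: "poly q a = 0"
      using fundamental_theorem_of_algebra[of q] constant_degree[of q] by auto
    define \<xi> where "\<xi> = fls_const a + (fls_X :: complex fls)"
    have nc: "\<xi> \<noteq> fls_const c" for c
      by (auto simp: \<xi>_def fls_eq_iff intro!: exI[of _ 1])
    have \<xi>': "fls_deriv \<xi> = 1" by (simp add: \<xi>_def)
    interpret embedding "expand_at \<xi>" by (rule embedding_expand_at[OF nc])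
    have D: "expand_at \<xi> (dK r) = fls_deriv (expand_at \<xi> r)" for r
      using expand_at_dK[OF nc, of r] \<xi>' by (simp add: local_deriv_def)
    interpret c: embedding "fls_const :: complex \<Rightarrow> _" by (rule embedding_fls_const)
    have reg: "peval fls_const \<xi> r $$ i = 0" if "i < 0" for r i
      using that
    proof (induction r arbitrary: i)
      case (pCons b r)
      have "(\<xi> * peval fls_const \<xi> r) $$ i = 0"
        by (rule fls_times_nth_bound(2)[of 0 _ 0]) (use pCons in \<open>auto simp: \<xi>_def\<close>)
      with pCons show ?case by simp
    qed simp
    define f where "f = expand_at \<xi> S"
    define v where "v = fls_subdegree f"
    have v: "v < 0" unfolding v_def f_def \<xi>_def by (rule expand_at_pole[OF a _ pq(2,1)]) (fact pq)
    then have nz: "f $$ v \<noteq> 0" unfolding v_def by (metis fls_zero_subdegree less_irrefl nth_fls_subdegree_nonzero)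
    define w C where "w = expand_at \<xi> (polyK W)" and "C = expand_at \<xi> (constK c)"
    have wC: "w $$ i = 0" "C $$ i = 0" if "i < 0" for i
      using that by (simp_all add: w_def C_def constK_conv_polyK expand_at_polyK[OF nc] reg)
    have eq: "16 * w * f\<^sup>2 + 3 * (fls_deriv f)\<^sup>2 - 4 * f * fls_deriv (fls_deriv f) = C * f"
      using arg_cong[OF assms, of "expand_at \<xi>"] by (simp add: homs D f_def w_def C_def)
    have f0: "f $$ i = 0" if "i < v" for i using that by (simp add: v_def)
    have f1: "fls_deriv f $$ i = 0" if "i < v - 1" for i using that f0 by simp
    have f2: "fls_deriv (fls_deriv f) $$ i = 0" if "i < v - 2" for i using that f0 by simp
    let ?i = "2 * v - 2"
    have 1: "(w * (f * f)) $$ ?i = 0"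
      by (rule fls_times_nth_bound(2)[of 0 _ "v + v"])
        (use wC v fls_times_nth_bound(2)[of v f v f, OF f0 f0] in auto)
    have 2: "(fls_deriv f * fls_deriv f) $$ ?i = of_int v * f $$ v * (of_int v * f $$ v)"
      using fls_times_nth_bound(1)[of "v - 1" "fls_deriv f" "v - 1" "fls_deriv f", OF f1 f1] by simp
    have 3: "(f * fls_deriv (fls_deriv f)) $$ ?i = f $$ v * (of_int (v - 1) * (of_int v * f $$ v))"
      using fls_times_nth_bound(1)[of v f "v - 2" "fls_deriv (fls_deriv f)", OF f0 f2] by simp
    have 4: "(C * f) $$ ?i = 0"
      by (rule fls_times_nth_bound(2)[of 0 _ v]) (use wC f0 v in auto)
    have "(16 * (w * (f * f)) + 3 * (fls_deriv f * fls_deriv f) - 4 * (f * fls_deriv (fls_deriv f))) $$ ?i = (C * f) $$ ?i"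
      using eq by (simp add: power2_eq_square mult_ac)
    then have "3 * (of_int v * f $$ v * (of_int v * f $$ v)) = 4 * (f $$ v * (of_int (v - 1) * (of_int v * f $$ v)))"
      by (simp only: fls_plus_nth fls_minus_nth fls_mult_of_numeral_nth 1 2 3 4) simp
    then have "(of_int v * (4 - of_int v)) * (f $$ v)\<^sup>2 = (0 :: complex)"
      by (simp add: power2_eq_square algebra_simps)
    then have "of_int (v * (4 - v)) = (0 :: complex)" using nz by simp
    then have "v * (4 - v) = 0" by (simp only: of_int_eq_0_iff)
    then show False using v by simp
  qed
  then obtain b where b: "q = [:b:]" by (metis degree_eq_zeroE)
  have "b \<noteq> 0" using b pq by simp
  have "S = polyK (smult (inverse b) p)"
  proof -
    have "smult (inverse b) p * q = p" using b \<open>b \<noteq> 0\<close> by simp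
    then have "polyK (smult (inverse b) p) * polyK q = polyK p" by (metis polyK_hom(2))
    moreover have "S * polyK q = polyK p" using pq by (simp add: polyK_def)
    moreover have "polyK q \<noteq> 0" using pq by (simp add: polyK_def)
    ultimately show ?thesis by (metis mult_right_cancel)
  qed
  then show ?thesis by (rule that)
qed

text \<open>For \<open>S = r\<^sup>2 \<noteq> 0\<close> the equation says that \<open>4 W r\<^sup>2 + r'\<^sup>2 - 2 r r''\<close>, a first integral of the second
  symmetric power \<open>r''' = 4 W r' + 2 W' r\<close> of \<open>y'' = W y\<close>, is constant.\<close>
lemma no_rational_solution:
  assumes "degree W > 0"
    and eq: "16 * polyK W * S\<^sup>2 + 3 * (dK S)\<^sup>2 - 4 * S * dK (dK S) = constK c * S"
  shows "S = 0"
proof -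
  obtain s where s: "S = polyK s" using rational_solution_polynomial[OF eq] .
  have "polyK (16 * W * s\<^sup>2 + 3 * (pderiv s)\<^sup>2 - 4 * s * pderiv (pderiv s)) = polyK ([:c:] * s)"
    using eq unfolding s dK_polyK constK_conv_polyK
    by (simp only: polyK_hom polyK_power polyK_numeral)
  then have e: "16 * (W * s\<^sup>2) = [:c:] * s - 3 * (pderiv s)\<^sup>2 + 4 * (s * pderiv (pderiv s))"
    by (simp only: polyK_eq_iff) (simp add: algebra_simps)
  have "s = 0"
  proof (rule ccontr)
    assume "s \<noteq> 0"
    have "16 * (W * s\<^sup>2) = smult 16 (W * s\<^sup>2)" by (simp add: numeral_poly)
    moreover have "W \<noteq> 0" using assms(1) by auto
    ultimately have "degree (16 * (W * s\<^sup>2)) = degree W + 2 * degree s"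
      using \<open>s \<noteq> 0\<close> by (simp add: degree_mult_eq degree_power_eq)
    \<comment> \<open>Derivatives do not raise the degree, so the positive degree of
      \<open>W\<close> on the left cannot be matched.\<close>
    moreover have "degree ([:c:] * s - 3 * (pderiv s)\<^sup>2 + 4 * (s * pderiv (pderiv s))) \<le> 2 * degree s"
    proof -
      have a: "3 * (pderiv s)\<^sup>2 = smult 3 ((pderiv s)\<^sup>2)" "4 * (s * pderiv (pderiv s)) = smult 4 (s * pderiv (pderiv s))"
        by (simp_all add: numeral_poly)
      have "degree (pderiv s * pderiv s) \<le> 2 * degree s"
        using degree_mult_le[of "pderiv s" "pderiv s"] by (simp add: degree_pderiv)
      moreover have "degree (s * pderiv (pderiv s)) \<le> 2 * degree s"
        using degree_mult_le[of s "pderiv (pderiv s)"] by (simp add: degree_pderiv)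
      ultimately show ?thesis unfolding a unfolding power2_eq_square
        by (intro degree_add_le degree_diff_le) auto
    qed
    ultimately show False using e assms(1) by simp
  qed
  then show ?thesis by (simp add: s)
qed

section \<open>Riccati solutions at infinity\<close>

text \<open>With \<open>t\<^sup>-\<^sup>2\<close> in place of \<open>x\<close>, square roots of polynomials of odd degree are
  Laurent series in \<open>t\<close> as well.\<close>
definition inf_pt :: "complex fls" where
  "inf_pt = fls_shift 2 1"

lemma inf_pt_nonconst: "inf_pt \<noteq> fls_const c"
  by (auto simp: inf_pt_def fls_eq_iff intro!: exI[of _ "-2"])

lemma fls_deriv_inf_pt: "fls_deriv inf_pt = - 2 * fls_shift 3 1"
  by (simp add: inf_pt_def fls_deriv_shift)

lemma fls_deriv_inf_pt_nonzero: "fls_deriv inf_pt \<noteq> 0"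
  by (auto simp: fls_eq_iff inf_pt_def intro!: exI[of _ "-3"])

lemma embedding_expand_inf: "embedding (expand_at inf_pt)"
  by (intro embedding_expand_at inf_pt_nonconst)

lemma expand_inf_dK: "local_deriv inf_pt (expand_at inf_pt r) = expand_at inf_pt (dK r)"
  by (intro expand_at_dK inf_pt_nonconst fls_deriv_inf_pt_nonzero)

text \<open>From x = t^-2 one gets d/dx = - (t^3 / 2) d/dt, so differentiation raises exponents by
  two.\<close>

lemma local_deriv_inf_nth:
  "local_deriv inf_pt f $$ n = - of_int (n - 2) / 2 * f $$ (n - 2)"
proof -
  define g where "g = fls_const (- 1 / 2) * fls_shift (- 3) (fls_deriv f)"
  have "fls_const (- 1 / 2) * - 2 = (1 :: complex fls)"
    by (rule fls_eqI) simp
  then have "g * fls_deriv inf_pt = fls_deriv f"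
    unfolding g_def fls_deriv_inf_pt
    by (simp add: fls_shifted_times_simps mult.assoc[symmetric])
  then have "local_deriv inf_pt f = g"
    unfolding local_deriv_def using fls_deriv_inf_pt_nonzero by (simp add: field_simps)
  then show ?thesis by (simp add: g_def algebra_simps)
qed

lemma peval_inf_nth:
  "peval fls_const inf_pt p $$ n = (if n \<le> 0 \<and> even n then coeff p (nat (- n) div 2) else 0)"
proof (induction p arbitrary: n)
  case 0
  then show ?case using embedding.peval_0[OF embedding_fls_const] by simp
next
  case (pCons b p)
  have "peval fls_const inf_pt (pCons b p) $$ n
      = (if n = 0 then b else 0) + peval fls_const inf_pt p $$ (n + 2)"
    using embedding.peval_pCons[OF embedding_fls_const] by (simp add: inf_pt_def fls_shifted_times_simps)
  also have "\<dots> = (if n \<le> 0 \<and> even n then coeff (pCons b p) (nat (- n) div 2) else 0)"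
  proof (cases "n \<le> 0 \<and> even n")
    case True
    define j where "j = nat (- (n div 2))"
    have n: "n = - 2 * int j" using True by (auto simp: j_def elim!: evenE)
    show ?thesis
    proof (cases j)
      case (Suc i)
      have "nat (- n) div 2 = j" "nat (- (n + 2)) div 2 = i" unfolding n Suc by auto
      then show ?thesis using n Suc by (simp add: pCons.IH)
    qed (simp add: n pCons.IH)
  qed (auto simp: pCons.IH)
  finally show ?case .
qed

lemma expand_inf_polyK_nth:
  "expand_at inf_pt (polyK p) $$ n = (if n \<le> 0 \<and> even n then coeff p (nat (- n) div 2) else 0)"
  using expand_at_polyK[OF inf_pt_nonconst] by (simp add: peval_inf_nth)

text \<open>The coefficients of the solution of the Riccati equation at infinity with leading coefficient \<open>e\<close>,
  where \<open>w\<close> lists the coefficients of the right hand side.\<close>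
fun riccati_coeff :: "(nat \<Rightarrow> complex) \<Rightarrow> nat \<Rightarrow> complex \<Rightarrow> nat \<Rightarrow> complex" where
  "riccati_coeff w k e m = (if m = 0 then e else
     (w m - (\<Sum>i\<in>{1..<m}. riccati_coeff w k e i * riccati_coeff w k e (m - i))
      - (if k + 2 \<le> m then - of_int (int m - 2 * int k - 2) / 2 * riccati_coeff w k e (m - (k + 2)) else 0)) / (2 * e))"

declare riccati_coeff.simps [simp del]

text \<open>At exponent m - 2 k the coefficient \<open>c m\<close> occurs in u^2 only as 2 e c_m,
  while u' contributes an earlier coefficient; hence the recursion. That e is a square root of 1
  reflects the leading coefficient of W.\<close>

lemma riccati_solution_inf:
  assumes "lead_coeff W = 1" "degree W > 0" "e\<^sup>2 = 1"
  obtains u where "local_deriv inf_pt u = expand_at inf_pt (polyK W) - u\<^sup>2"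
    "u $$ (- int (degree W)) = e" "\<And>i. i < - int (degree W) \<Longrightarrow> u $$ i = 0"
proof -
  define k where "k = degree W"
  \<comment> \<open>x^j sits at t^(-2 j), so the expansion of \<open>W\<close> starts at exponent -
    2 k and \<open>w\<close> counts from there.\<close>
  define w where "w m = expand_at inf_pt (polyK W) $$ (int m - 2 * int k)" for m :: nat
  define c where "c = riccati_coeff w k e"
  define C where "C = Abs_fps c"
  define u where "u = fls_shift (int k) (fps_to_fls C)"
  have nth: "u $$ i = (if i < - int k then 0 else c (nat (i + int k)))" for i
    by (simp add: u_def C_def)
  have e: "e \<noteq> 0" using assms by auto
  have c0: "c 0 = e" by (simp add: c_def riccati_coeff.simps)
  have w0: "w 0 = 1" using assms(1) by (simp add: w_def expand_inf_polyK_nth k_def nat_mult_distrib)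
  have wneg: "expand_at inf_pt (polyK W) $$ i = 0" if "i < - 2 * int k" for i
  proof -
    have "nat (- i) div 2 > degree W" if "even i" using that \<open>i < - 2 * int k\<close> by (auto simp: k_def elim!: evenE)
    then show ?thesis by (auto simp: expand_inf_polyK_nth coeff_eq_0)
  qed
  have sq: "u\<^sup>2 $$ (int m - 2 * int k) = (\<Sum>i\<le>m. c i * c (m - i))" for m
  proof -
    have "u\<^sup>2 = fls_shift (2 * int k) (fps_to_fls (C * C))"
      unfolding u_def power2_eq_square by (simp add: fls_times_both_shifted_simp fls_times_fps_to_fls)
    then show ?thesis by (simp add: fps_mult_nth C_def atLeast0AtMost)
  qed
  have sqneg: "u\<^sup>2 $$ i = 0" if "i < - 2 * int k" for i
    unfolding power2_eq_square
    by (rule fls_times_nth_bound(2)[of "- int k" _ "- int k"]) (use that in \<open>auto simp: nth\<close>)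
  have rec: "w m = (\<Sum>i\<le>m. c i * c (m - i)) + local_deriv inf_pt u $$ (int m - 2 * int k)" for m
  proof (cases m)
    case 0
    then show ?thesis using w0 c0 assms(2,3)
      by (simp add: local_deriv_inf_nth nth k_def power2_eq_square)
  next
    case (Suc n)
    \<comment> \<open>\<open>u\<close> starts at - k rather than - 2 k and differentiation shifts by
      2; together this delays its contribution by k + 2.\<close>
    let ?D = "if k + 2 \<le> m then - of_int (int m - 2 * int k - 2) / 2 * c (m - (k + 2)) else 0"
    have D: "local_deriv inf_pt u $$ (int m - 2 * int k) = ?D"
    proof (cases "k + 2 \<le> m")
      case True
      then have "nat (int m - 2 * int k - 2 + int k) = m - (k + 2)" by simp
      with True show ?thesis by (simp add: local_deriv_inf_nth nth)
    qed (simp add: local_deriv_inf_nth nth)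
    have "{..m} = insert 0 (insert m {1..<m})" using Suc by auto
    then have s: "(\<Sum>i\<le>m. c i * c (m - i)) = 2 * e * c m + (\<Sum>i\<in>{1..<m}. c i * c (m - i))"
      using Suc c0 by simp
    have "c m = (w m - (\<Sum>i\<in>{1..<m}. c i * c (m - i)) - ?D) / (2 * e)"
      using Suc unfolding c_def by (subst riccati_coeff.simps) simp
    then have "2 * e * c m = w m - (\<Sum>i\<in>{1..<m}. c i * c (m - i)) - ?D"
      using e by (simp add: field_simps)
    then show ?thesis unfolding s D by (simp add: algebra_simps)
  qed
  have "local_deriv inf_pt u = expand_at inf_pt (polyK W) - u\<^sup>2"
  proof (rule fls_eqI)
    fix n :: int
    show "local_deriv inf_pt u $$ n = (expand_at inf_pt (polyK W) - u\<^sup>2) $$ n"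
    proof (cases "n < - 2 * int k")
      case True
      then show ?thesis
        using wneg sqneg by (simp add: local_deriv_inf_nth nth)
    next
      case False
      then have "int (nat (n + 2 * int k)) - 2 * int k = n" by simp
      then show ?thesis
        using rec[of "nat (n + 2 * int k)"] sq[of "nat (n + 2 * int k)"] by (simp add: w_def)
    qed
  qed
  then show ?thesis by (rule that) (simp_all add: nth c0 flip: k_def)
qed

section \<open>Darboux polynomials over the Laurent series field\<close>

lemma poly_deriv_eval:
  fixes d :: "'a::field \<Rightarrow> 'a"
  assumes "derivation d" "d u = poly v u"
  shows "d (poly p u) = poly (poly_deriv d v p) u"
proof -
  interpret embedding "\<lambda>x::'a. x" by unfold_locales auto
  have e: "peval (\<lambda>x. x) u q = poly q u" for q
    unfolding peval_def by (subst map_poly_idI) simp_all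
  have "d (peval (\<lambda>x. x) u p) = peval (\<lambda>x. x) u (poly_deriv d v p)"
    by (rule peval_deriv[OF assms(1,1)]) (simp_all only: e assms(2))
  then show ?thesis by (simp only: e)
qed

lemma coeff_riccati_deriv:
  fixes d :: "'a::field \<Rightarrow> 'a"
  assumes "derivation d"
  shows "coeff (poly_deriv d [:w, 0, -1:] Q) (Suc i) =
    d (coeff Q (Suc i)) + w * of_nat (Suc (Suc i)) * coeff Q (Suc (Suc i)) - of_nat i * coeff Q i"
proof -
  interpret derivation d by fact
  show ?thesis by (cases i) (simp_all add: poly_deriv_def coeff_pderiv algebra_simps)
qed

text \<open>U' = w - U^2 raises the degree by at most one, so the cofactor is at most linear; its
  top coefficient is read off from U^n turning into - n U^(n+1).\<close>

lemma riccati_cofactor: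
  fixes d :: "'a::field \<Rightarrow> 'a"
  assumes "derivation d" "Q \<noteq> 0" "Q dvd poly_deriv d [:w, 0, -1:] Q"
  obtains k0 where "poly_deriv d [:w, 0, -1:] Q = [:k0, - of_nat (degree Q):] * Q"
proof -
  interpret derivation d by fact
  define DQ where "DQ = poly_deriv d [:w, 0, -1:] Q"
  note c = coeff_riccati_deriv[OF assms(1), of w Q, folded DQ_def]
  have hi: "coeff DQ i = 0" if "i > Suc (degree Q)" for i
    using that c[of "i - 1"] by (simp add: coeff_eq_0)
  obtain k where k: "DQ = Q * k" using assms(3) unfolding DQ_def by (rule dvdE)
  have "degree k \<le> 1"
  proof (cases "k = 0")
    case False
    then have "degree DQ = degree Q + degree k" using k assms(2) by (simp add: degree_mult_eq)
    moreover have "degree DQ \<le> Suc (degree Q)" using hi by (intro degree_le) auto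
    ultimately show ?thesis by simp
  qed simp
  then have "k = [:coeff k 0, coeff k 1:]"
    by (intro poly_eqI) (auto simp: coeff_pCons coeff_eq_0 split: nat.splits)
  then obtain k0 k1 where k01: "k = [:k0, k1:]" by blast
  have "coeff DQ (Suc (degree Q)) = k1 * lead_coeff Q"
    unfolding k k01 by (simp add: coeff_eq_0 mult.commute)
  then have "k1 * lead_coeff Q = - of_nat (degree Q) * lead_coeff Q"
    using c[of "degree Q"] by (simp add: coeff_eq_0)
  then have "k1 = - of_nat (degree Q)" using assms(2) by (metis leading_coeff_0_iff mult_right_cancel)
  then show ?thesis using that[of k0] k k01 by (simp add: DQ_def mult.commute)
qed

text \<open>If \<open>Q\<close> vanished at neither of the two solutions \<open>u\<close>, \<open>v\<close>, the logarithmic derivative of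
  \<open>Q(u) / Q(v)\<close> would be a nonzero integer multiple of \<open>u - v\<close>, which has a pole.\<close>
lemma riccati_darboux_root:
  assumes Q: "degree Q > 0" "Q dvd poly_deriv (local_deriv inf_pt) [:w, 0, -1:] Q"
    and u: "local_deriv inf_pt u = w - u\<^sup>2" and v: "local_deriv inf_pt v = w - v\<^sup>2"
    and neg: "fls_subdegree (u - v) < 0"
  shows "poly Q u = 0 \<or> poly Q v = 0"
proof (rule ccontr)
  assume "\<not> ?thesis"
  then have nz: "poly Q u \<noteq> 0" "poly Q v \<noteq> 0" by auto
  let ?\<delta> = "local_deriv inf_pt"
  define f g where "f = poly Q u" and "g = poly Q v"
  define N where "N = of_nat (degree Q) * (u - v) * (f * g)"
  have "Q \<noteq> 0" using Q by auto
  then obtain k0 where k0: "poly_deriv ?\<delta> [:w, 0, -1:] Q = [:k0, - of_nat (degree Q):] * Q"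
    using riccati_cofactor[OF derivation_local_deriv _ Q(2)] by blast
  have \<delta>: "?\<delta> f = (k0 - of_nat (degree Q) * u) * f" "?\<delta> g = (k0 - of_nat (degree Q) * v) * g"
    using poly_deriv_eval[OF derivation_local_deriv, of inf_pt u "[:w, 0, -1:]" Q] u
      poly_deriv_eval[OF derivation_local_deriv, of inf_pt v "[:w, 0, -1:]" Q] v
    unfolding f_def g_def k0 by (simp_all add: power2_eq_square algebra_simps)
  have N: "N = f * ?\<delta> g - ?\<delta> f * g" unfolding N_def \<delta> by (simp add: algebra_simps)
  define a b where "a = fls_subdegree f" and "b = fls_subdegree g"
  have z: "u - v \<noteq> 0" using neg by auto
  have nz': "f \<noteq> 0" "g \<noteq> 0" using nz by (simp_all add: f_def g_def)
  have deg: "(of_nat (degree Q) :: complex fls) \<noteq> 0" using Q by simp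
  have "N \<noteq> 0" using z nz' deg by (simp add: N_def)
  \<comment> \<open>The pole of u - v puts the order of \<open>N\<close> below a + b, whereas
    \<open>f * ?\<delta> g - ?\<delta> f * g\<close> has order at least a + b because
    \<open>?\<delta>\<close> never lowers orders.\<close>
  have "fls_subdegree N = fls_subdegree (u - v) + a + b"
    unfolding N_def a_def b_def using z nz' deg by simp
  moreover have "N $$ i = 0" if "i < a + b" for i
  proof -
    have "?\<delta> f $$ i = 0" if "i < a" for i using that by (simp add: local_deriv_inf_nth a_def)
    moreover have "?\<delta> g $$ i = 0" if "i < b" for i using that by (simp add: local_deriv_inf_nth b_def)
    ultimately have "(f * ?\<delta> g) $$ i = 0" "(?\<delta> f * g) $$ i = 0"
      using that by (auto intro!: fls_times_nth_bound(2)[of a _ b] simp: a_def b_def)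
    then show ?thesis by (simp add: N)
  qed
  ultimately show False using neg nth_fls_subdegree_nonzero[OF \<open>N \<noteq> 0\<close>] by simp
qed

text \<open>(U - u)' = (w - U^2) - (w - u^2), so U - u is a Darboux polynomial with cofactor - (U +
  u).\<close>

lemma linear_riccati_deriv:
  fixes d :: "'a::field \<Rightarrow> 'a"
  assumes "derivation d" "d u = w - u\<^sup>2"
  shows "poly_deriv d [:w, 0, -1:] [:- u, 1:] = - [:u, 1:] * [:- u, 1:]"
  using derivation.zero[OF assms(1)] derivation.one[OF assms(1)] assms(2)
  by (simp add: poly_deriv_def map_poly_pCons pderiv_pCons derivation.minus[OF assms(1)] power2_eq_square)

text \<open>By the product rule the known cofactor of U - u can be subtracted, after which the
  common factor cancels.\<close>

lemma riccati_darboux_split: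
  fixes d :: "'a::field \<Rightarrow> 'a"
  assumes d: "derivation d" and u: "d u = w - u\<^sup>2"
    and Q: "[:- u, 1:] * R dvd poly_deriv d [:w, 0, -1:] ([:- u, 1:] * R)"
  shows "R dvd poly_deriv d [:w, 0, -1:] R"
proof -
  interpret derivation "poly_deriv d [:w, 0, -1:]" using d by (rule derivation_poly_deriv)
  have E: "[:- u, 1:] * poly_deriv d [:w, 0, -1:] R =
      poly_deriv d [:w, 0, -1:] ([:- u, 1:] * R) - [:- u, 1:] * R * (- [:u, 1:])"
    unfolding mult linear_riccati_deriv[OF d u] by (simp only: algebra_simps)
  have "[:- u, 1:] * R dvd [:- u, 1:] * poly_deriv d [:w, 0, -1:] R"
    unfolding E by (rule dvd_diff[OF Q dvd_triv_left])
  then show ?thesis by (simp only: dvd_mult_cancel_left) simp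
qed

no_notation fls_nth (infixl \<open>$$\<close> 75)

section \<open>Darboux polynomials of the Riccati equation\<close>

context embedding begin

lemma map_poly_add: "map_poly \<phi> (p + q) = map_poly \<phi> p + map_poly \<phi> q"
  by (rule poly_eqI) (simp add: coeff_map_poly add)

lemma map_poly_smult: "map_poly \<phi> (smult c p) = smult (\<phi> c) (map_poly \<phi> p)"
  by (rule poly_eqI) (simp add: coeff_map_poly mult)

lemma map_poly_mult: "map_poly \<phi> (p * q) = map_poly \<phi> p * map_poly \<phi> q"
  by (induction p) (simp_all add: map_poly_pCons map_poly_add map_poly_smult)

lemma map_poly_dvd: "p dvd q \<Longrightarrow> map_poly \<phi> p dvd map_poly \<phi> q"
  by (auto simp: map_poly_mult elim!: dvdE)

lemma map_poly_pderiv: "map_poly \<phi> (pderiv p) = pderiv (map_poly \<phi> p)"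
  by (rule poly_eqI) (simp add: coeff_map_poly coeff_pderiv mult add)

lemma degree_map_poly_eq: "degree (map_poly \<phi> p) = degree p"
  by (rule degree_map_poly) simp

lemma map_poly_poly_deriv:
  assumes "derivation d" "derivation D" "\<And>a. D (\<phi> a) = \<phi> (d a)"
  shows "map_poly \<phi> (poly_deriv d v p) = poly_deriv D (map_poly \<phi> v) (map_poly \<phi> p)"
proof -
  interpret d: derivation d by fact
  interpret D: derivation D by fact
  have "map_poly \<phi> (map_poly d p) = map_poly D (map_poly \<phi> p)"
    by (rule poly_eqI) (simp add: coeff_map_poly assms(3))
  then show ?thesis by (simp add: poly_deriv_def map_poly_add map_poly_mult map_poly_pderiv)
qed

end

text \<open>Write p = q^(n+1) r with r not divisible by q. Dividing \<delta> p by q^n leaves, modulo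
  q, the term (n + 1) (\<delta> q) r, in which n + 1 is a unit by characteristic zero.\<close>

lemma darboux_prime_factor:
  fixes \<delta> :: "'a::{field_gcd,ring_char_0} poly \<Rightarrow> 'a poly"
  assumes \<delta>: "derivation \<delta>" and p: "p \<noteq> 0" "p dvd \<delta> p" and q: "prime_elem q" "q dvd p"
  shows "q dvd \<delta> q"
proof -
  interpret derivation \<delta> by fact
  have "q \<noteq> 0" "\<not> is_unit q" using q by auto
  then obtain r where r: "p = q ^ multiplicity q p * r" "\<not> q dvd r"
    using multiplicity_decompose'[of p q] p(1) by blast
  have "multiplicity q p > 0" using q(2) p(1) \<open>\<not> is_unit q\<close> by (simp add: prime_multiplicity_gt_zero_iff q(1))
  then obtain n where n: "multiplicity q p = Suc n" using gr0_implies_Suc by blast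
  have pq: "p = q ^ n * (q * r)" using r(1) n by (simp add: mult_ac)
  have "\<delta> p = q ^ n * (of_nat (Suc n) * (\<delta> q * r) + q * \<delta> r)"
  proof -
    have "\<delta> (q ^ Suc n) = of_nat (Suc n) * q ^ n * \<delta> q" by (simp only: power diff_Suc_1)
    then show ?thesis unfolding r(1)[unfolded n] mult by (simp only: power_Suc algebra_simps)
  qed
  with p(2) pq have "q ^ n * (q * r) dvd q ^ n * (of_nat (Suc n) * (\<delta> q * r) + q * \<delta> r)"
    by metis
  then have "q * r dvd of_nat (Suc n) * (\<delta> q * r) + q * \<delta> r"
    using \<open>q \<noteq> 0\<close> by (simp only: dvd_mult_cancel_left) simp
  then have "q dvd of_nat (Suc n) * (\<delta> q * r) + q * \<delta> r" by (rule dvd_mult_left)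
  then have "q dvd of_nat (Suc n) * (\<delta> q * r)" using dvd_add_left_iff dvd_triv_left by blast
  moreover have "is_unit (of_nat (Suc n) :: 'a poly)"
    by (simp add: of_nat_poly is_unit_const_poly_iff dvd_field_iff del: of_nat_Suc)
  then have "\<not> q dvd of_nat (Suc n)" using \<open>\<not> is_unit q\<close> dvd_unit_imp_unit by blast
  ultimately show ?thesis using q(1) r(2) by (metis prime_elem_dvd_mult_iff)
qed

text \<open>A Bezout identity for p and its derivative persists in every extension field, so the two
  have no common root there.\<close>

lemma irreducible_no_double_root:
  fixes p :: "'k::{field_gcd,ring_char_0} poly" and \<phi> :: "'k \<Rightarrow> 'F::field"
  assumes "embedding \<phi>" "irreducible p" "poly (map_poly \<phi> p) \<alpha> = 0"
  shows "poly (pderiv (map_poly \<phi> p)) \<alpha> \<noteq> 0"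
proof
  interpret embedding \<phi> by fact
  assume z: "poly (pderiv (map_poly \<phi> p)) \<alpha> = 0"
  have "p \<noteq> 0" "degree p > 0" using assms(2) by (auto simp: irreducible_def is_unit_iff_degree)
  then have nd: "\<not> p dvd pderiv p" by (intro not_dvd_pderiv) simp
  have "prime_elem p" using assms(2) by (simp add: field_poly_irreducible_imp_prime)
  then have "coprime p (pderiv p)" using nd by (rule prime_elem_imp_coprime)
  then obtain s t where "s * p + t * pderiv p = 1"
    using bezout_coefficients_fst_snd[of p "pderiv p"] by (metis coprime_iff_gcd_eq_1)
  then have "map_poly \<phi> (s * p + t * pderiv p) = 1" by simp
  then have "map_poly \<phi> s * map_poly \<phi> p + map_poly \<phi> t * pderiv (map_poly \<phi> p) = 1"
    by (simp only: map_poly_add map_poly_mult map_poly_pderiv)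
  then have "poly (map_poly \<phi> s * map_poly \<phi> p + map_poly \<phi> t * pderiv (map_poly \<phi> p)) \<alpha> = 1" by simp
  with z assms(3) show False by simp
qed

text \<open>Over the Laurent series at infinity \<open>p\<close> has only simple roots; splitting off those among the two
  Riccati solutions leaves a Darboux polynomial that vanishes at neither, hence a constant.\<close>
lemma riccati_darboux_degree:
  fixes p :: "ratfun poly"
  assumes W: "lead_coeff W = 1" "degree W > 0"
    and p: "irreducible p" "p dvd poly_deriv dK [:polyK W, 0, -1:] p"
  shows "degree p \<le> 2"
proof (rule ccontr)
  assume "\<not> degree p \<le> 2"
  interpret embedding "expand_at inf_pt" by (rule embedding_expand_inf)
  let ?\<delta> = "local_deriv inf_pt"
  define w where "w = expand_at inf_pt (polyK W)"
  define P where "P = map_poly (expand_at inf_pt) p"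
  have \<delta>: "derivation ?\<delta>" by (rule derivation_local_deriv)
  obtain u where u: "?\<delta> u = w - u\<^sup>2" "fls_nth u (- int (degree W)) = 1"
      "\<And>i. i < - int (degree W) \<Longrightarrow> fls_nth u i = 0"
    using riccati_solution_inf[OF W, of 1] unfolding w_def by auto
  obtain v where v: "?\<delta> v = w - v\<^sup>2" "fls_nth v (- int (degree W)) = -1"
      "\<And>i. i < - int (degree W) \<Longrightarrow> fls_nth v i = 0"
    using riccati_solution_inf[OF W, of "-1"] unfolding w_def by auto
  have "fls_nth (u - v) (- int (degree W)) \<noteq> 0" using u v by simp
  then have neg: "fls_subdegree (u - v) < 0"
    using fls_subdegree_leI W(2) by (smt (verit) of_nat_0_less_iff)
  have "map_poly (expand_at inf_pt) [:polyK W, 0, -1:] = [:w, 0, -1:]"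
    by (simp add: map_poly_pCons w_def minus)
  then have DP: "P dvd poly_deriv ?\<delta> [:w, 0, -1:] P"
    using map_poly_dvd[OF p(2)] map_poly_poly_deriv[OF derivation_dK \<delta> expand_inf_dK]
    unfolding P_def by simp
  have simple: "poly R \<alpha> \<noteq> 0" if "P = [:- \<alpha>, 1:] * R" for \<alpha> R
  proof -
    have "poly (pderiv P) \<alpha> \<noteq> 0"
      unfolding P_def by (rule irreducible_no_double_root[OF embedding_expand_inf p(1)])
        (simp add: that flip: P_def)
    then show ?thesis unfolding that by (simp only: pderiv_mult) (simp add: pderiv_pCons)
  qed
  have root: "poly Q u = 0 \<or> poly Q v = 0"
    if "degree Q > 0" "Q dvd poly_deriv ?\<delta> [:w, 0, -1:] Q" for Q
    by (rule riccati_darboux_root[OF that u(1) v(1) neg])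
  have deg: "degree Q = Suc (degree R)" if "Q = [:- \<alpha>, 1:] * R" "degree Q > 0" for Q R and \<alpha> :: "complex fls"
  proof -
    have "R \<noteq> 0" using that by auto
    then show ?thesis unfolding that(1) by (subst degree_mult_eq) auto
  qed
  have degP: "degree P > 2" using \<open>\<not> degree p \<le> 2\<close> by (simp add: P_def degree_map_poly_eq)
  \<comment> \<open>Stated for \<open>a\<close>, \<open>b\<close> in either order, since the first
    root found may be \<open>u\<close> or \<open>v\<close>.\<close>
  have main: False
    if a: "?\<delta> a = w - a\<^sup>2" and b: "?\<delta> b = w - b\<^sup>2" and ab: "{a, b} = {u, v}" and "poly P a = 0" for a b
  proof -
    from \<open>poly P a = 0\<close> obtain R where R: "P = [:- a, 1:] * R" by (auto simp: poly_eq_0_iff_dvd)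
    have dR: "degree R > 1" using deg[OF R] degP by simp
    have DR: "R dvd poly_deriv ?\<delta> [:w, 0, -1:] R"
      using riccati_darboux_split[OF \<delta> a, of R] DP R by simp
    have "poly R a \<noteq> 0" using R by (rule simple)
    with root[OF _ DR] dR ab have "poly R b = 0" by (auto simp: doubleton_eq_iff)
    then obtain R2 where R2: "R = [:- b, 1:] * R2" by (auto simp: poly_eq_0_iff_dvd)
    have dR2: "degree R2 > 0" using deg[OF R2] dR by simp
    have DR2: "R2 dvd poly_deriv ?\<delta> [:w, 0, -1:] R2"
      using riccati_darboux_split[OF \<delta> b, of R2] DR R2 by simp
    have "poly ([:- a, 1:] * R2) b \<noteq> 0"
      by (rule simple) (simp only: R R2 mult_ac)
    moreover have "poly R2 a \<noteq> 0" using \<open>poly R a \<noteq> 0\<close> unfolding R2 by auto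
    ultimately show False using root[OF dR2 DR2] ab by (auto simp: doubleton_eq_iff)
  qed
  show False
    using root[OF _ DP] degP main[OF u(1) v(1)] main[OF v(1) u(1)] by auto
qed

text \<open>A linear irreducible factor U - u has a Riccati solution as its root, and a quadratic
  one is refuted through its discriminant. The contrapositive supplies the hypothesis
  \<open>no_darboux\<close> over K.\<close>

theorem riccati_darboux_solution:
  fixes p :: "ratfun poly"
  assumes W: "lead_coeff W = 1" "degree W > 0"
    and p: "degree p > 0" "p dvd poly_deriv dK [:polyK W, 0, -1:] p"
  obtains u where "dK u + u\<^sup>2 = polyK W"
proof -
  let ?\<delta> = "poly_deriv dK [:polyK W, 0, -1:]"
  interpret dK: derivation dK by (rule derivation_dK)
  have \<delta>: "derivation ?\<delta>" by (rule derivation_poly_deriv[OF derivation_dK])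
  have "p \<noteq> 0" using p(1) by auto
  then have "\<not> is_unit p" using p(1) by (simp add: is_unit_iff_degree)
  then obtain q0 where "prime q0" and dvd0: "q0 dvd p"
    using prime_divisor_exists[OF \<open>p \<noteq> 0\<close>] by blast
  then have q0: "prime_elem q0" "q0 dvd p" by (simp_all add: prime_imp_prime_elem)
  define q where "q = smult (inverse (lead_coeff q0)) q0"
  have lq0: "lead_coeff q0 \<noteq> 0" using q0 by auto
  have "q dvd p" "prime_elem q"
  proof -
    show "q dvd p" using q0(2) lq0 by (simp add: q_def smult_dvd_iff)
    have "q = q0 * [:inverse (lead_coeff q0):]" by (simp add: q_def)
    moreover have "is_unit [:inverse (lead_coeff q0):]" using lq0 by (simp add: is_unit_const_poly_iff dvd_field_iff)
    ultimately show "prime_elem q" using q0(1) by (metis prime_elem_mult_unit_left mult.commute)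
  qed
  then have dq: "q dvd ?\<delta> q" using darboux_prime_factor[OF \<delta> \<open>p \<noteq> 0\<close> p(2)] by blast
  have irr: "irreducible q" using \<open>prime_elem q\<close> by (rule prime_elem_imp_irreducible)
  have lq: "lead_coeff q = 1" using lq0 by (simp add: q_def)
  have "degree q \<le> 2" by (rule riccati_darboux_degree[OF W irr dq])
  moreover have "degree q > 0" using irr by (auto simp: irreducible_def is_unit_iff_degree)
  ultimately consider "degree q = 1" | "degree q = 2" by linarith
  then show ?thesis
  proof cases
    case 1
    define u where "u = - coeff q 0"
    have q: "q = [:- u, 1:]"
      using 1 lq by (intro poly_eqI) (auto simp: u_def coeff_pCons coeff_eq_0 split: nat.splits)
    have "poly q u = 0" by (simp add: q)
    with dq have "poly (?\<delta> q) u = 0" by (metis dvd_def poly_mult mult_zero_left)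
    then have "dK u + u\<^sup>2 = polyK W"
      by (simp add: q poly_deriv_def map_poly_pCons pderiv_pCons dK.minus power2_eq_square algebra_simps)
    then show ?thesis by (rule that)
  next
    case 2
    define h c where "h = coeff q 1" and "c = coeff q 0"
    have q: "q = [:c, h, 1:]"
      using 2 lq by (intro poly_eqI) (auto simp: h_def c_def coeff_pCons coeff_eq_0 numeral_2_eq_2 split: nat.splits)
    obtain k0 where "?\<delta> q = [:k0, - of_nat (degree q):] * q"
      using riccati_cofactor[OF derivation_dK _ dq] q by auto
    then have E: "?\<delta> q = [:k0, - 2:] * [:c, h, 1:]" by (simp add: 2 q)
    have F: "?\<delta> q = [:dK c + polyK W * h, dK h + 2 * polyK W, - h, - 2:]"
      by (simp add: q poly_deriv_def map_poly_pCons pderiv_pCons)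
    \<comment> \<open>Coefficients in \<open>?\<delta> q\<close> = (k0 - 2 U) q express the
      derivatives of h and c through h, c and W.\<close>
    have e: "k0 = h" "dK h + 2 * polyK W = h * h - 2 * c" "dK c + polyK W * h = h * c"
    proof -
      have "[:dK c + polyK W * h, dK h + 2 * polyK W, - h, - 2:] = [:k0, - 2:] * [:c, h, 1:]"
        using E F by (rule trans[OF sym, rotated])
      note N = this
      show k: "k0 = h" using N by simp
      show "dK h + 2 * polyK W = h * h - 2 * c" "dK c + polyK W * h = h * c"
        using N unfolding k by (simp_all add: mult.commute)
    qed
    \<comment> \<open>For the roots u1, u2 of \<open>q\<close>, \<Delta> is (u1 - u2)^2, and (u1 -
      u2)' = - (u1 + u2)(u1 - u2) = h (u1 - u2).\<close>
    define \<Delta> where "\<Delta> = h\<^sup>2 - 4 * c"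
    have "\<Delta> \<noteq> 0"
    proof
      assume "\<Delta> = 0"
      then have "c = h / 2 * (h / 2)" by (simp add: \<Delta>_def power2_eq_square)
      then have "q = [:h / 2, 1:] * [:h / 2, 1:]" by (simp add: q)
      then have "is_unit [:h / 2, 1:]" using irreducibleD[OF irr] by blast
      then show False by (simp add: is_unit_iff_degree)
    qed
    have d\<Delta>: "dK \<Delta> = 2 * h * \<Delta>"
    proof -
      have h': "dK h = h * h - 2 * c - 2 * polyK W" and c': "dK c = h * c - polyK W * h"
        using e(2,3) by (simp_all add: eq_diff_eq)
      have "dK \<Delta> = dK h * h + h * dK h - 4 * dK c"
        by (simp add: \<Delta>_def power2_eq_square dK.diff dK.mult)
      also have "\<dots> = 2 * h * \<Delta>"
        unfolding h' c' \<Delta>_def by (simp add: power2_eq_square algebra_simps)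
      finally show ?thesis .
    qed
    \<comment> \<open>The discriminant satisfies \<open>\<Delta>' = 2 h \<Delta>\<close>, so \<open>S\<close> is the square of a solution of the second symmetric power.\<close>
    define S where "S = inverse \<Delta>"
    have S: "S * \<Delta> = 1" using \<open>\<Delta> \<noteq> 0\<close> by (simp add: S_def)
    have dS: "dK S = - 2 * h * S"
      unfolding S_def derivation_inverse[OF derivation_dK \<open>\<Delta> \<noteq> 0\<close>] d\<Delta>
      using \<open>\<Delta> \<noteq> 0\<close> by (simp add: field_simps power2_eq_square)
    have ddS: "dK (dK S) = - 2 * dK h * S + 4 * h * h * S"
      unfolding dS by (simp add: dK.mult dK.minus dS algebra_simps)
    have "16 * polyK W * S\<^sup>2 + 3 * (dK S)\<^sup>2 - 4 * S * dK (dK S) = 4 * S * (S * (4 * polyK W - h * h + 2 * dK h))"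
      unfolding ddS unfolding dS by (simp add: power2_eq_square algebra_simps)
    also have "4 * polyK W - h * h + 2 * dK h = \<Delta>"
    proof -
      have h': "dK h = h * h - 2 * c - 2 * polyK W" using e(2) by (simp add: eq_diff_eq)
      show ?thesis unfolding h' \<Delta>_def by (simp add: power2_eq_square algebra_simps)
    qed
    \<comment> \<open>The constant is 4 because r = 1 / (u1 - u2) has first integral 1, and passing
      to S = r^2 multiplies by 4.\<close>
    also have "4 * S * (S * \<Delta>) = constK 4 * S"
      unfolding S constK_conv_polyK by (simp add: numeral_poly[symmetric])
    finally have "S = 0" by (rule no_rational_solution[OF W(2)])
    then show ?thesis using S by simp
  qed
qed

section \<open>Rational functions and the eigenring\<close>

lemma dK_constK [simp]: "dK (constK c) = 0"
  by (simp add: constK_conv_polyK pderiv_pCons)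

text \<open>For p / q in lowest terms with derivative 0, q divides q' and p divides p', which in
  characteristic zero happens only for constants.\<close>

lemma dK_eq_0_iff: "dK r = 0 \<longleftrightarrow> (\<exists>c. r = constK c)"
proof
  assume d: "dK r = 0"
  obtain p q where pq: "r = to_fract p / to_fract q" "q \<noteq> 0" "coprime p q"
    by (rule Fract_coprime_cases)
  then have "r = polyK p / polyK q" "polyK q \<noteq> 0" by (simp_all add: polyK_def)
  then have "polyK (pderiv p * q - p * pderiv q) = 0"
    using d derivation_divide[OF derivation_dK, of "polyK q" "polyK p"] by simp
  then have e: "pderiv p * q = p * pderiv q"
    by (metis eq_iff_diff_eq_0 polyK_eq_iff polyK_hom(5))
  have "q dvd p * pderiv q" by (simp flip: e)
  then have "q dvd pderiv q" using pq(3) coprime_commute coprime_dvd_mult_right_iff by blast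
  then have "degree q = 0" using not_dvd_pderiv[of q] by blast
  have "p dvd pderiv p * q" by (simp add: e)
  then have "p dvd pderiv p" using pq(3) coprime_dvd_mult_left_iff by blast
  then have "degree p = 0" using not_dvd_pderiv[of p] by blast
  obtain a b where ab: "p = [:a:]" "q = [:b:]"
    using \<open>degree p = 0\<close> \<open>degree q = 0\<close> by (metis degree_eq_zeroE)
  then have "p = [:a / b:] * q" using pq(2) by simp
  then have "to_fract p = to_fract [:a / b:] * to_fract q" by (metis to_fract_mult)
  then have "r = constK (a / b)" using pq by (simp add: constK_def)
  then show "\<exists>c. r = constK c" by blast
qed auto

lemma embedding_constK: "embedding constK"
proof (rule embedding_field)
  show "constK (x + y) = constK x + constK y" "constK (x * y) = constK x * constK y" for x y
    unfolding constK_def to_fract_add[symmetric] to_fract_mult[symmetric] by simp_all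
  show "constK 1 = 1" by (simp only: constK_def one_pCons[symmetric] to_fract_1)
qed

text \<open>Substituting S = r^2 multiplies the first integral by 4 r^2, which reduces the claim to
  \<open>no_rational_solution\<close>.\<close>

lemma no_rational_symmetric_square:
  assumes "degree W > 0" "4 * polyK W * r\<^sup>2 + (dK r)\<^sup>2 - 2 * r * dK (dK r) = constK c"
  shows "r = 0"
proof -
  interpret dK: derivation dK by (rule derivation_dK)
  have "16 * polyK W * (r\<^sup>2)\<^sup>2 + 3 * (dK (r\<^sup>2))\<^sup>2 - 4 * r\<^sup>2 * dK (dK (r\<^sup>2))
      = 4 * (4 * polyK W * r\<^sup>2 + (dK r)\<^sup>2 - 2 * r * dK (dK r)) * r\<^sup>2"
    by (simp add: power2_eq_square dK.mult dK.add algebra_simps)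
  also have "\<dots> = constK (4 * c) * r\<^sup>2"
    unfolding assms(2) using embedding.mult[OF embedding_constK, of 4 c] embedding.numeral[OF embedding_constK] by simp
  finally show ?thesis using no_rational_solution[OF assms(1)] by fastforce
qed

text \<open>If y' = u y, such a g is y^2 times a primitive of c / y^2, hence a product of two
  solutions of y'' = W y. Its first integral is c^2, so g and with it c would vanish.\<close>

lemma no_linear_solution:
  assumes "degree W > 0" and u: "dK u + u\<^sup>2 = polyK W" and "c \<noteq> 0"
  shows "dK g - 2 * u * g \<noteq> constK c"
proof
  assume asm: "dK g - 2 * u * g = constK c"
  interpret dK: derivation dK by (rule derivation_dK)
  define C where "C = constK c"
  have C: "dK C = 0" by (simp add: C_def)
  have u': "dK u = polyK W - u * u" using u by (simp add: power2_eq_square eq_diff_eq)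
  have g': "dK g = 2 * u * g + C" using asm by (simp add: C_def diff_eq_eq add.commute)
  have g'': "dK (dK g) = 2 * (polyK W - u * u) * g + 2 * u * (2 * u * g + C)"
    unfolding g' by (simp add: dK.add dK.mult C u' g' algebra_simps)
  have "4 * polyK W * g\<^sup>2 + (dK g)\<^sup>2 - 2 * g * dK (dK g) = C * C"
    unfolding g'' unfolding g' by (simp add: power2_eq_square algebra_simps)
  also have "\<dots> = constK (c * c)" unfolding C_def by (simp add: embedding.mult[OF embedding_constK])
  finally have "g = 0" by (rule no_rational_symmetric_square[OF assms(1)])
  with asm have "constK c = 0" by simp
  with \<open>c \<noteq> 0\<close> embedding.eq_0_iff[OF embedding_constK] show False by simp
qed

text \<open>A Riccati solution has a pole at infinity because W has one; a logarithmic derivative f'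
  / f has none, since d/dx raises orders there.\<close>

lemma no_exponential_solution:
  assumes W: "degree W > 0" and u: "dK u + u\<^sup>2 = polyK W" and "f \<noteq> 0" "N > 0"
  shows "dK f \<noteq> of_nat N * u * f"
proof
  assume f: "dK f = of_nat N * u * f"
  interpret embedding "expand_at inf_pt" by (rule embedding_expand_inf)
  define U F where "U = expand_at inf_pt u" and "F = expand_at inf_pt f"
  have F: "local_deriv inf_pt F = of_nat N * U * F"
    unfolding F_def U_def expand_inf_dK f by (simp add: mult)
  have U: "local_deriv inf_pt U + U * U = expand_at inf_pt (polyK W)"
    unfolding U_def expand_inf_dK u[symmetric] by (simp add: homs power2_eq_square)
  have "F \<noteq> 0" using assms by (simp add: F_def)
  have neg: "fls_subdegree U < 0"
  proof (rule ccontr)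
    assume "\<not> ?thesis"
    then have z: "fls_nth U i = 0" if "i < 0" for i using that by simp
    let ?i = "- 2 * int (degree W)"
    have "fls_nth (U * U) ?i = 0"
      by (rule fls_times_nth_bound(2)[of 0 _ 0]) (use z W in auto)
    moreover have "fls_nth (local_deriv inf_pt U) ?i = 0"
      using W by (simp add: local_deriv_inf_nth z)
    ultimately have "fls_nth (expand_at inf_pt (polyK W)) ?i = 0" by (simp flip: U)
    then have "coeff W (degree W) = 0" by (simp add: expand_inf_polyK_nth nat_mult_distrib)
    with W show False by auto
  qed
  then have "U \<noteq> 0" by auto
  have N: "(of_nat N :: complex fls) \<noteq> 0" using assms by simp
  have s: "fls_subdegree (of_nat N * U * F) = fls_subdegree U + fls_subdegree F"
    using \<open>U \<noteq> 0\<close> \<open>F \<noteq> 0\<close> N by simp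
  have "fls_nth (local_deriv inf_pt F) (fls_subdegree U + fls_subdegree F) = 0"
    using neg by (simp add: local_deriv_inf_nth)
  then show False unfolding F s[symmetric]
    using \<open>U \<noteq> 0\<close> \<open>F \<noteq> 0\<close> N by (metis mult_eq_0_iff nth_fls_subdegree_zero_iff)
qed

section \<open>Products with the Schroedinger operator, coefficient by coefficient\<close>

lemma dK_funpow_zero [simp]: "(dK ^^ k) 0 = 0"
  by (induction k) (simp_all add: derivation.zero[OF derivation_dK])

lemma dK_funpow_minus_one: "(dK ^^ k) (- 1) = (if k = 0 then - 1 else 0)"
proof (cases k)
  case (Suc n)
  have "dK (- 1) = 0"
    by (simp add: derivation.minus[OF derivation_dK] derivation.one[OF derivation_dK])
  then show ?thesis using Suc by (simp add: funpow_swap1 del: funpow.simps) (simp add: funpow_Suc_right del: funpow.simps)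
qed simp

lemma op_coeff_mult:
  "op_coeff (op_mult A B) m = (\<Sum>i<length A. \<Sum>j<length B. \<Sum>k\<le>i.
     (if i + j - k = m then A ! i * of_nat (i choose k) * (dK ^^ k) (B ! j) else 0))"
proof (cases "m < length A + length B")
  case False
  then have "i + j - k \<noteq> m" if "i < length A" "j < length B" for i j k using that by auto
  then have "(\<Sum>i<length A. \<Sum>j<length B. \<Sum>k\<le>i.
     (if i + j - k = m then A ! i * of_nat (i choose k) * (dK ^^ k) (B ! j) else 0)) = 0"
    by (intro sum.neutral ballI) auto
  with False show ?thesis by (simp add: op_coeff_def op_mult_def)
qed (simp add: op_coeff_def op_mult_def)

text \<open>\<open>N\<close> may exceed the length of \<open>S\<close>, so that the low coefficients
  can be read off uniformly even when the list is very short.\<close>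

lemma op_coeff_mult_schroedinger:
  assumes "length S \<le> N"
  shows "op_coeff (op_mult S [w, 0, - 1]) m =
    (\<Sum>i<N. (if i + 2 = m then - op_coeff S i else 0)
      + (\<Sum>k\<le>i. if i - k = m then op_coeff S i * of_nat (i choose k) * (dK ^^ k) w else 0))"
proof -
  have 3: "{..<3} = {0, 1, 2 :: nat}" by auto
  \<comment> \<open>The coefficient -1 is constant, so only the undifferentiated term k = 0
    survives.\<close>
  have inner: "(\<Sum>k\<le>i. if i + 2 - k = m then s * of_nat (i choose k) * (dK ^^ k) (- 1) else 0)
      = (if i + 2 = m then - s else 0)" for i and s :: ratfun
  proof -
    have "(\<Sum>k\<le>i. if i + 2 - k = m then s * of_nat (i choose k) * (dK ^^ k) (- 1) else 0)
        = (\<Sum>k\<le>i. if k = 0 then (if i + 2 = m then - s else 0) else 0)"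
      by (intro sum.cong) (auto simp: dK_funpow_minus_one)
    then show ?thesis by simp
  qed
  have "op_coeff (op_mult S [w, 0, - 1]) m = (\<Sum>i<length S. (if i + 2 = m then - op_coeff S i else 0)
      + (\<Sum>k\<le>i. if i - k = m then op_coeff S i * of_nat (i choose k) * (dK ^^ k) w else 0))"
    unfolding op_coeff_mult
  proof (intro sum.cong refl)
    fix i assume i: "i \<in> {..<length S}"
    define g where "g j x = (\<Sum>k\<le>i. if i + j - k = m then S ! i * of_nat (i choose k) * (dK ^^ k) x else 0)"
      for j x
    have Si: "S ! i = op_coeff S i" using i by (simp add: op_coeff_def)
    have "g 1 0 = 0" unfolding g_def by (intro sum.neutral) simp
    have "{..<length [w, 0, - 1]} = {0, 1, 2}" by auto
    then have "(\<Sum>j<length [w, 0, - 1]. g j ([w, 0, - 1] ! j)) = g 0 w + g 1 0 + g 2 (- 1)"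
      by (simp only:) simp
    also have "\<dots> = (if i + 2 = m then - op_coeff S i else 0)
      + (\<Sum>k\<le>i. if i - k = m then op_coeff S i * of_nat (i choose k) * (dK ^^ k) w else 0)"
      unfolding \<open>g 1 0 = 0\<close> unfolding g_def inner Si by simp
    finally show "(\<Sum>j<length [w, 0, - 1]. \<Sum>k\<le>i. if i + j - k = m then S ! i * of_nat (i choose k) * (dK ^^ k) ([w, 0, - 1] ! j) else 0)
      = (if i + 2 = m then - op_coeff S i else 0)
      + (\<Sum>k\<le>i. if i - k = m then op_coeff S i * of_nat (i choose k) * (dK ^^ k) w else 0)"
      unfolding g_def .
  qed
  also have "\<dots> = (\<Sum>i<N. (if i + 2 = m then - op_coeff S i else 0)
      + (\<Sum>k\<le>i. if i - k = m then op_coeff S i * of_nat (i choose k) * (dK ^^ k) w else 0))"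
    using assms by (intro sum.mono_neutral_left) (auto simp: op_coeff_def intro!: sum.neutral)
  finally show ?thesis .
qed

lemma op_coeff_schroedinger_mult:
  "op_coeff (op_mult [w, 0, - 1] [r0, r1]) m =
    (if m = 0 then w * r0 - dK (dK r0) else if m = 1 then w * r1 - 2 * dK r0 - dK (dK r1)
     else if m = 2 then - r0 - 2 * dK r1 else if m = 3 then - r1 else 0)"
proof -
  consider "m = 0" | "m = 1" | "m = 2" | "m = 3" | n where "m = Suc (Suc (Suc (Suc n)))"
    by (metis One_nat_def Suc_1 numeral_3_eq_3 not0_implies_Suc)
  then show ?thesis
    unfolding op_coeff_mult by cases (simp_all add: numeral_2_eq_2 numeral_3_eq_3)
qed

text \<open>Coefficients of L R = S L give s1 = r1, s0 = r0 + 2 r1', r1'' = - 2 r0' and finally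
  r1''' = 4 w r1' + 2 w' r1. So the first integral of r1 is constant, r1 = 0 by
  \<open>no_rational_symmetric_square\<close>, and r0 is constant.\<close>

theorem eigenring_trivial_schroedinger:
  assumes "degree (V - [:lam:]) > 0"
  shows "eigenring_trivial (schroedinger_op V lam)"
proof -
  define W where "W = V - [:lam:]"
  define w where "w = polyK W"
  interpret dK: derivation dK by (rule derivation_dK)
  have L: "schroedinger_op V lam = [w, 0, - 1]" by (simp add: schroedinger_op_def w_def W_def)
  have "(\<exists>c. (r0, r1) = (constK c, 0))" if "op_eq (op_mult [w, 0, - 1] [r0, r1]) (op_mult S [w, 0, - 1])" for r0 r1 S
  proof -
    have eq: "(if m = 0 then w * r0 - dK (dK r0) else if m = 1 then w * r1 - 2 * dK r0 - dK (dK r1)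
       else if m = 2 then - r0 - 2 * dK r1 else if m = 3 then - r1 else 0)
      = (\<Sum>i<N. (if i + 2 = m then - op_coeff S i else 0)
      + (\<Sum>k\<le>i. if i - k = m then op_coeff S i * of_nat (i choose k) * (dK ^^ k) w else 0))"
      if "length S \<le> N" for m N
      using that \<open>op_eq _ _\<close> unfolding op_eq_def
      by (simp only: op_coeff_schroedinger_mult op_coeff_mult_schroedinger[OF that])
    \<comment> \<open>A leading coefficient of \<open>S\<close> at i0 >= 2 would reappear up to sign
      at i0 + 2 >= 4, where L R has none.\<close>
    have zero: "op_coeff S i = 0" if "i \<ge> 2" for i
    proof (rule ccontr)
      assume "op_coeff S i \<noteq> 0"
      let ?A = "{i. op_coeff S i \<noteq> 0}"
      have fin: "finite ?A" by (rule finite_subset[of _ "{..<length S}"]) (auto simp: op_coeff_def split: if_splits)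
      define i0 where "i0 = Max ?A"
      have i0: "op_coeff S i0 \<noteq> 0" using Max_in[OF fin] \<open>op_coeff S i \<noteq> 0\<close> unfolding i0_def by blast
      have "i \<le> i0" unfolding i0_def by (rule Max_ge[OF fin]) (use \<open>op_coeff S i \<noteq> 0\<close> in simp)
      have z: "op_coeff S j = 0" if "j > i0" for j
        using Max_ge[OF fin, of j] that unfolding i0_def by fastforce
      have "i0 < length S" using i0 by (auto simp: op_coeff_def split: if_splits)
      have "(\<Sum>j<length S. (if j + 2 = i0 + 2 then - op_coeff S j else 0)
        + (\<Sum>k\<le>j. if j - k = i0 + 2 then op_coeff S j * of_nat (j choose k) * (dK ^^ k) w else 0))
        = (\<Sum>j<length S. if j = i0 then - op_coeff S i0 else 0)"
      proof (intro sum.cong refl)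
        fix j
        have "(if j - k = i0 + 2 then op_coeff S j * of_nat (j choose k) * (dK ^^ k) w else 0) = 0" for k
          using z[of j] by auto
        then show "(if j + 2 = i0 + 2 then - op_coeff S j else 0)
          + (\<Sum>k\<le>j. if j - k = i0 + 2 then op_coeff S j * of_nat (j choose k) * (dK ^^ k) w else 0)
          = (if j = i0 then - op_coeff S i0 else 0)" by simp
      qed
      also have "\<dots> = - op_coeff S i0" using \<open>i0 < length S\<close> by simp
      finally show False using eq[of "length S" "i0 + 2"] \<open>i \<le> i0\<close> that i0 by (simp split: if_splits)
    qed
    define s0 s1 where "s0 = op_coeff S 0" and "s1 = op_coeff S 1"
    have red: "(\<Sum>i<length S + 2. (if i + 2 = m then - op_coeff S i else 0)
      + (\<Sum>k\<le>i. if i - k = m then op_coeff S i * of_nat (i choose k) * (dK ^^ k) w else 0))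
      = (if m = 0 then s0 * w + s1 * dK w else if m = 1 then s1 * w else if m = 2 then - s0 else if m = 3 then - s1 else 0)" for m
    proof -
      have "(\<Sum>i<length S + 2. (if i + 2 = m then - op_coeff S i else 0)
      + (\<Sum>k\<le>i. if i - k = m then op_coeff S i * of_nat (i choose k) * (dK ^^ k) w else 0))
       = (\<Sum>i<2. (if i + 2 = m then - op_coeff S i else 0)
      + (\<Sum>k\<le>i. if i - k = m then op_coeff S i * of_nat (i choose k) * (dK ^^ k) w else 0))"
        using zero by (intro sum.mono_neutral_right) (auto intro!: sum.neutral)
      also have "\<dots> = (if m = 0 then s0 * w + s1 * dK w else if m = 1 then s1 * w else if m = 2 then - s0 else if m = 3 then - s1 else 0)"
        by (auto simp: numeral_2_eq_2 s0_def s1_def)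
      finally show ?thesis .
    qed
    have eqs: "(if m = 0 then w * r0 - dK (dK r0) else if m = 1 then w * r1 - 2 * dK r0 - dK (dK r1)
       else if m = 2 then - r0 - 2 * dK r1 else if m = 3 then - r1 else 0)
      = (if m = 0 then s0 * w + s1 * dK w else if m = 1 then s1 * w else if m = 2 then - s0 else if m = 3 then - s1 else 0)" for m :: nat
      using eq[of "length S + 2" m] unfolding red by simp
    have s: "s1 = r1" "s0 = r0 + 2 * dK r1"
      using eqs[of 3] eqs[of 2] by (simp_all add: algebra_simps)
    have r1'': "dK (dK r1) = - 2 * dK r0"
      using eqs[of 1] s by (simp add: algebra_simps eq_neg_iff_add_eq_0)
    have "dK (dK r0) = w * r0 - (w * r0 - dK (dK r0))" by simp
    also have "w * r0 - dK (dK r0) = (r0 + 2 * dK r1) * w + r1 * dK w"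
      using eqs[of 0] s by simp
    also have "w * r0 - ((r0 + 2 * dK r1) * w + r1 * dK w) = - 2 * w * dK r1 - dK w * r1"
      by (simp add: algebra_simps)
    finally have r0'': "dK (dK r0) = - 2 * w * dK r1 - dK w * r1" .
    have "dK (4 * w * r1\<^sup>2 + (dK r1)\<^sup>2 - 2 * r1 * dK (dK r1)) = 0"
    proof -
      have "dK (4 * w * r1\<^sup>2 + (dK r1)\<^sup>2 - 2 * r1 * dK (dK r1))
          = 4 * dK w * r1 * r1 + 8 * w * r1 * dK r1 - 2 * r1 * dK (dK (dK r1))"
        by (simp add: power2_eq_square dK.add dK.diff dK.mult algebra_simps)
      also have "dK (dK (dK r1)) = - 2 * dK (dK r0)" unfolding r1'' by (simp add: dK.mult dK.minus)
      finally show ?thesis unfolding r0'' by (simp add: algebra_simps)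
    qed
    then have "r1 = 0"
      unfolding dK_eq_0_iff w_def using no_rational_symmetric_square[of W r1] assms W_def by blast
    then have "dK r0 = 0" using r1'' by simp
    with \<open>r1 = 0\<close> show ?thesis by (auto simp: dK_eq_0_iff)
  qed
  moreover have "op_eq (op_mult [w, 0, - 1] [constK c, 0]) (op_mult [constK c] [w, 0, - 1])" for c
    unfolding op_eq_def op_coeff_schroedinger_mult
    by (subst op_coeff_mult_schroedinger[of _ 1]) (auto simp: op_coeff_def)
  ultimately have "eigenring [w, 0, - 1] = {(constK c, 0) | c. True}"
    unfolding eigenring_def by (intro equalityI subsetI) blast+
  then show ?thesis by (simp add: eigenring_trivial_def L)
qed

section \<open>Rational Riccati solutions\<close>

lemma coeff_mult_bound:
  fixes p q :: "'a::idom poly"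
  assumes "degree p \<le> a" "degree q \<le> b"
  shows "coeff (p * q) (a + b) = coeff p a * coeff q b"
proof (cases "degree p = a \<and> degree q = b")
  case True
  then show ?thesis using coeff_mult_degree_sum[of p q] by auto
next
  case False
  then have "degree p + degree q < a + b" using assms by auto
  then have "coeff (p * q) (a + b) = 0"
    using degree_mult_le[of p q] by (intro coeff_eq_0) simp
  moreover have "coeff p a * coeff q b = 0" using False assms by (auto simp: coeff_eq_0)
  ultimately show ?thesis by simp
qed

lemma coeff_sum_monom_less: "coeff (\<Sum>j<n. monom (f j) j) i = (if i < n then f i else 0)"
  by (simp add: coeff_sum)

text \<open>The hypothesis says that y = q exp G with G' = g satisfies y'' = W y; the witness is its
  logarithmic derivative q' / q + g.\<close>

lemma riccati_solution_of_poly: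
  assumes "q \<noteq> 0" and eq: "pderiv (pderiv q) + 2 * g * pderiv q + (pderiv g + g\<^sup>2 - W) * q = 0"
  shows "\<exists>u. dK u + u\<^sup>2 = polyK W"
proof -
  interpret dK: derivation dK by (rule derivation_dK)
  define Q G where "Q = polyK q" and "G = polyK g"
  have "Q \<noteq> 0" using assms(1) by (simp add: Q_def polyK_def)
  have "polyK (pderiv (pderiv q) + 2 * g * pderiv q + (pderiv g + g\<^sup>2 - W) * q) = 0"
    unfolding eq by simp
  then have e: "dK (dK Q) + 2 * G * dK Q + (dK G + G\<^sup>2 - polyK W) * Q = 0"
    by (simp add: Q_def G_def)
  define R where "R = dK Q / Q"
  have R: "dK Q = R * Q" using \<open>Q \<noteq> 0\<close> by (simp add: R_def)
  have R': "dK (dK Q) = dK R * Q + R * (R * Q)"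
    using arg_cong[OF R, of dK] R by (simp only: dK.mult)
  define u where "u = R + G"
  have "(dK u + u\<^sup>2 - polyK W) * Q = dK (dK Q) + 2 * G * dK Q + (dK G + G\<^sup>2 - polyK W) * Q"
    unfolding u_def dK.add R' unfolding R by (simp add: algebra_simps power2_eq_square)
  with e \<open>Q \<noteq> 0\<close> have "dK u + u\<^sup>2 - polyK W = 0" by simp
  then show ?thesis by (metis eq_iff_diff_eq_0)
qed

text \<open>For u = p / q in lowest terms the equation becomes p (p - q') = q (W q - p'), so q
  divides p - q' and g is the quotient. Analytically, every finite pole of u is simple with residue
  1.\<close>

lemma poly_of_riccati_solution:
  assumes u: "dK u + u\<^sup>2 = polyK W"
  obtains g q where "lead_coeff q = 1" "pderiv (pderiv q) + 2 * g * pderiv q + (pderiv g + g\<^sup>2 - W) * q = 0"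
proof -
  obtain p0 q0 where pq0: "u = to_fract p0 / to_fract q0" "q0 \<noteq> 0" "coprime p0 q0"
    by (rule Fract_coprime_cases)
  define l where "l = inverse (lead_coeff q0)"
  have l: "l \<noteq> 0" using pq0 by (simp add: l_def)
  define p q where "p = smult l p0" and "q = smult l q0"
  have q: "lead_coeff q = 1" "q \<noteq> 0" using pq0 by (auto simp: q_def l_def)
  have "p0 * q = p * q0" by (simp add: p_def q_def)
  then have "polyK p0 * polyK q = polyK p * polyK q0" by (metis polyK_hom(2))
  then have uq: "u = polyK p / polyK q" "polyK q \<noteq> 0"
    using pq0 q by (simp_all add: polyK_def frac_eq_eq)
  have cop: "coprime p q"
  proof -
    have "is_unit [:l:]" using l by (simp add: is_unit_const_poly_iff dvd_field_iff)
    moreover have "p = [:l:] * p0" "q = [:l:] * q0" by (simp_all add: p_def q_def)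
    ultimately show ?thesis using pq0(3) by (simp only: coprime_mult_left_iff coprime_mult_right_iff is_unit_left_imp_coprime is_unit_right_imp_coprime)
  qed
  have P: "u * polyK q = polyK p" using uq by simp
  have "dK u * polyK q + u * polyK (pderiv q) = polyK (pderiv p)"
    using derivation.mult[OF derivation_dK, of u "polyK q"] unfolding P dK_polyK by simp
  then have P': "dK u * polyK q = polyK (pderiv p) - u * polyK (pderiv q)" by (simp add: eq_diff_eq)
  have "(dK u + u\<^sup>2) * (polyK q)\<^sup>2 = (dK u * polyK q) * polyK q + (u * polyK q) * (u * polyK q)"
    by (simp add: power2_eq_square algebra_simps)
  also have "\<dots> = polyK (pderiv p) * polyK q - (u * polyK q) * polyK (pderiv q) + (u * polyK q) * (u * polyK q)"
    unfolding P' by (simp only: algebra_simps)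
  also have "\<dots> = polyK (pderiv p * q - p * pderiv q + p\<^sup>2)"
    unfolding P by (simp add: power2_eq_square)
  finally have "(dK u + u\<^sup>2) * (polyK q)\<^sup>2 = polyK (pderiv p * q - p * pderiv q + p\<^sup>2)" .
  then have "polyK (W * q\<^sup>2) = polyK (pderiv p * q - p * pderiv q + p\<^sup>2)" unfolding u by simp
  then have e: "W * q\<^sup>2 = pderiv p * q - p * pderiv q + p\<^sup>2" by (simp only: polyK_eq_iff)
  have "p * (p - pderiv q) = q * (W * q - pderiv p)"
    using e by (simp add: algebra_simps power2_eq_square)
  then have "q dvd p * (p - pderiv q)" by simp
  then have "q dvd p - pderiv q" using cop coprime_commute coprime_dvd_mult_right_iff by blast
  then obtain g where "p - pderiv q = q * g" by (rule dvdE)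
  then have p: "p = pderiv q + q * g" by (simp add: algebra_simps)
  have "q * (pderiv (pderiv q) + 2 * g * pderiv q + (pderiv g + g\<^sup>2 - W) * q) = 0"
    using e unfolding p by (simp add: pderiv_add pderiv_mult algebra_simps power2_eq_square)
  with q show ?thesis by (intro that[of q g]) simp_all
qed

text \<open>With B = W - g^2 the equation reads B q = q'' + 2 g q' + g' q. The right side has degree
  below deg g + deg q, so deg B < deg g; hence g^2 carries the leading term of W, and g = s A with a
  sign s and A monic.\<close>

lemma riccati_poly_shape:
  fixes W :: "complex poly"
  assumes W: "lead_coeff W = 1" "degree W > 0" and q: "lead_coeff q = 1"
    and eq: "pderiv (pderiv q) + 2 * g * pderiv q + (pderiv g + g\<^sup>2 - W) * q = 0"
  obtains s n A B where "s = 1 \<or> s = -1" "n > 0" "degree W = 2 * n" "W = A\<^sup>2 + B"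
    "degree A = n" "lead_coeff A = 1" "degree B < n"
    "pderiv (pderiv q) + 2 * smult s A * pderiv q + (smult s (pderiv A) - B) * q = 0"
    "coeff B (n - 1) = s * of_nat (2 * degree q + n)"
proof -
  define n where "n = degree g"
  define B where "B = W - g\<^sup>2"
  define m where "m = degree q"
  have "q \<noteq> 0" using q by auto
  have Bq: "B * q = pderiv (pderiv q) + 2 * (g * pderiv q) + pderiv g * q"
    using eq by (simp add: B_def algebra_simps power2_eq_square)
  have two: "2 * r = smult 2 r" for r :: "complex poly" by (simp add: numeral_poly)
  have dq: "degree (pderiv q) \<le> m - 1" "degree (pderiv (pderiv q)) \<le> m - 2" "degree (pderiv g) \<le> n - 1"
    by (simp_all add: degree_pderiv m_def n_def)
  have dgq: "degree (g * pderiv q) \<le> n + (m - 1)"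
    using degree_mult_le[of g "pderiv q"] dq by (simp add: n_def)
  have dg'q: "degree (pderiv g * q) \<le> n - 1 + m"
    using degree_mult_le[of "pderiv g" q] dq by (simp add: m_def)
  \<comment> \<open>For constant g the right side has degree at most that of \<open>q\<close>, which
    would make B and then W constant.\<close>
  have "n > 0"
  proof (rule ccontr)
    assume "\<not> n > 0"
    then have "n = 0" by simp
    then have "degree (pderiv (pderiv q) + 2 * (g * pderiv q) + pderiv g * q) \<le> m"
      unfolding two using dq dgq dg'q by (intro degree_add_le) auto
    then have "degree (B * q) \<le> m" by (simp only: Bq)
    then have "degree B = 0" using \<open>q \<noteq> 0\<close> by (cases "B = 0") (auto simp: degree_mult_eq m_def)
    moreover have "degree (g\<^sup>2) = 0" using \<open>n = 0\<close> degree_power_le[of g 2] by (simp add: n_def)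
    ultimately have "degree (B + g\<^sup>2) \<le> 0" by (intro degree_add_le) auto
    then show False using W(2) by (simp add: B_def)
  qed
  have "degree B < n"
  proof (cases "B = 0")
    case False
    have "degree (pderiv (pderiv q) + 2 * (g * pderiv q) + pderiv g * q) \<le> n - 1 + m"
    proof -
      have "degree (g * pderiv q) \<le> n - 1 + m"
      proof (cases "m = 0")
        case True
        then have "pderiv q = 0" by (simp add: pderiv_eq_0_iff m_def)
        then show ?thesis by simp
      qed (use dgq in simp)
      then show ?thesis unfolding two using dq dg'q by (intro degree_add_le) auto
    qed
    then have "degree (B * q) \<le> n - 1 + m" by (simp only: Bq)
    then have "degree B + m \<le> n - 1 + m" using \<open>q \<noteq> 0\<close> False by (simp add: degree_mult_eq m_def)
    then show ?thesis using \<open>n > 0\<close> by simp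
  qed (use \<open>n > 0\<close> in simp)
  have WB: "W = g\<^sup>2 + B" by (simp add: B_def)
  have "g \<noteq> 0" using \<open>n > 0\<close> by (auto simp: n_def)
  have dg2: "degree (g\<^sup>2) = 2 * n" using \<open>g \<noteq> 0\<close> by (simp add: degree_power_eq n_def)
  then have degW: "degree W = 2 * n"
    unfolding WB using \<open>degree B < n\<close> by (subst degree_add_eq_left) auto
  have "coeff W (2 * n) = (lead_coeff g)\<^sup>2"
    unfolding WB using \<open>degree B < n\<close> dg2 lead_coeff_power[of g 2] by (simp add: coeff_eq_0)
  then have lg: "(lead_coeff g)\<^sup>2 = 1" using W(1) degW by simp
  define s where "s = lead_coeff g"
  have s: "s = 1 \<or> s = -1" using lg by (simp add: s_def power2_eq_1_iff)
  then have ss: "s * s = 1" and "s \<noteq> 0" by auto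
  define A where "A = smult s g"
  have gA: "g = smult s A" by (simp add: A_def ss)
  have A: "degree A = n" "lead_coeff A = 1" "W = A\<^sup>2 + B"
  proof -
    show "degree A = n" using \<open>s \<noteq> 0\<close> by (simp add: A_def n_def)
    show "lead_coeff A = 1" using ss \<open>s \<noteq> 0\<close> by (simp add: A_def flip: s_def)
    show "W = A\<^sup>2 + B" unfolding WB A_def by (simp add: power2_eq_square ss)
  qed
  have E: "pderiv (pderiv q) + 2 * smult s A * pderiv q + (smult s (pderiv A) - B) * q = 0"
  proof -
    have "smult s (pderiv A) = pderiv g" unfolding gA by (simp add: pderiv_smult)
    moreover have "pderiv g + g\<^sup>2 - W = pderiv g - B" by (simp add: B_def)
    ultimately show ?thesis using eq by (simp only: flip: gA)
  qed
  \<comment> \<open>Coefficients of x^(n - 1 + m): 2 g q' contributes 2 s m, g' q contributes s n,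
    and q'' nothing.\<close>
  have "coeff B (n - 1) = s * of_nat (2 * m + n)"
  proof -
    have lq: "coeff q m = 1" using q by (simp add: m_def)
    have "coeff (B * q) (n - 1 + m) = coeff B (n - 1)"
      using coeff_mult_bound[of B "n - 1" q m] \<open>degree B < n\<close> lq by (simp add: m_def)
    moreover have "coeff (pderiv (pderiv q)) (n - 1 + m) = 0"
      using \<open>n > 0\<close> by (simp add: coeff_pderiv coeff_eq_0 m_def)
    moreover have "coeff (g * pderiv q) (n - 1 + m) = s * of_nat m"
    proof (cases "m = 0")
      case True
      then have "pderiv q = 0" by (simp add: pderiv_eq_0_iff m_def)
      then show ?thesis using True by simp
    next
      case False
      then have "n - 1 + m = n + (m - 1)" using \<open>n > 0\<close> by simp
      then have "coeff (g * pderiv q) (n - 1 + m) = s * coeff (pderiv q) (m - 1)"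
        using coeff_mult_bound[of g n "pderiv q" "m - 1"] dq by (simp add: n_def s_def)
      then show ?thesis using False lq by (simp add: coeff_pderiv)
    qed
    moreover have "coeff (pderiv g * q) (n - 1 + m) = s * of_nat n"
      using coeff_mult_bound[of "pderiv g" "n - 1" q m] dq lq \<open>n > 0\<close>
      by (simp add: m_def coeff_pderiv n_def s_def mult.commute)
    ultimately show ?thesis
      using arg_cong[OF Bq, of "\<lambda>p. coeff p (n - 1 + m)"] unfolding two by (simp add: algebra_simps)
  qed
  then show ?thesis using that[OF s \<open>n > 0\<close> degW A(3) A(1,2) \<open>degree B < n\<close> E] by (simp add: m_def)
qed

lemma sum_monom_coeff:
  fixes p :: "'a::comm_monoid_add poly"
  assumes "degree p < n"
  shows "(\<Sum>j<n. monom (coeff p j) j) = p"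
  using assms by (intro poly_eqI) (auto simp: coeff_sum_monom_less coeff_eq_0)

lemma monic_sum_monom_coeff:
  assumes "degree p = n" "lead_coeff p = 1"
  shows "monom 1 n + (\<Sum>j<n. monom (coeff p j) j) = p"
  using assms by (intro poly_eqI) (auto simp: coeff_sum_monom_less coeff_eq_0)

lemma pderiv_monic_sum_monom:
  fixes a :: "nat \<Rightarrow> complex"
  assumes "n > 0"
  shows "pderiv (monom 1 n + (\<Sum>j<n. monom (a j) j)) =
    monom (of_nat n) (n - 1) + (\<Sum>j<n - 1. monom (of_nat (j + 1) * a (j + 1)) j)"
  using assms by (intro poly_eqI) (auto simp: coeff_pderiv coeff_sum_monom_less)

text \<open>The two cases are the two signs of g: g = A yields the first differential equation, g =
  - A the second, with P the monic denominator of the Riccati solution.\<close>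

theorem riccati_solvable_iff:
  assumes "lead_coeff V = 1" "degree V > 0"
  shows "(\<exists>u. dK u + u\<^sup>2 = polyK (V - [:lam:])) \<longleftrightarrow>
         (\<exists>n a b. degree V = 2 * n
            \<and> V - [:lam:] = (monom 1 n + (\<Sum>j<n. monom (a j) j))\<^sup>2 + (\<Sum>j<n. monom (b j) j)
            \<and> (\<exists>m::nat.
                 (b (n - 1) - of_nat n = 2 * of_nat m
                  \<and> (\<exists>P. lead_coeff P = 1 \<and> degree P = m
                     \<and> pderiv (pderiv P) + smult 2 (monom 1 n + (\<Sum>j<n. monom (a j) j)) * pderiv P
                       + (monom (of_nat n) (n - 1) + (\<Sum>j<n - 1. monom (of_nat (j + 1) * a (j + 1)) j)
                          - (\<Sum>j<n. monom (b j) j)) * P = 0))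
               \<or> (- b (n - 1) - of_nat n = 2 * of_nat m
                  \<and> (\<exists>P. lead_coeff P = 1 \<and> degree P = m
                     \<and> pderiv (pderiv P) - smult 2 (monom 1 n + (\<Sum>j<n. monom (a j) j)) * pderiv P
                       - (monom (of_nat n) (n - 1) + (\<Sum>j<n - 1. monom (of_nat (j + 1) * a (j + 1)) j)
                          + (\<Sum>j<n. monom (b j) j)) * P = 0))))"
    (is "?L \<longleftrightarrow> ?R")
proof
  define W where "W = V - [:lam:]"
  have degW: "degree W = degree V"
    unfolding W_def using assms(2) by (subst diff_conv_add_uminus, subst degree_add_eq_left) auto
  then have W: "lead_coeff W = 1" "degree W > 0"
    using assms by (auto simp: W_def coeff_pCons split: nat.splits)
  have two: "2 * r = smult 2 r" "r * 2 = smult 2 r" for r :: "complex poly" by (simp_all add: numeral_poly)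
  {
    assume ?L
    then obtain u where "dK u + u\<^sup>2 = polyK W" unfolding W_def by blast
    then obtain g q where gq: "lead_coeff q = 1"
      "pderiv (pderiv q) + 2 * g * pderiv q + (pderiv g + g\<^sup>2 - W) * q = 0"
      by (rule poly_of_riccati_solution)
    from riccati_poly_shape[OF W gq] obtain s n A B where *: "s = 1 \<or> s = -1" "n > 0" "degree W = 2 * n"
      "W = A\<^sup>2 + B" "degree A = n" "lead_coeff A = 1" "degree B < n"
      "pderiv (pderiv q) + 2 * smult s A * pderiv q + (smult s (pderiv A) - B) * q = 0"
      "coeff B (n - 1) = s * of_nat (2 * degree q + n)"
      by blast
    have A: "monom 1 n + (\<Sum>j<n. monom (coeff A j) j) = A" using *(5,6) by (rule monic_sum_monom_coeff)
    have B: "(\<Sum>j<n. monom (coeff B j) j) = B" using *(7) by (rule sum_monom_coeff)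
    have A': "monom (of_nat n) (n - 1) + (\<Sum>j<n - 1. monom (of_nat (j + 1) * coeff A (j + 1)) j) = pderiv A"
      using pderiv_monic_sum_monom[OF *(2), of "coeff A"] unfolding A by simp
    have "coeff B (n - 1) - of_nat n = 2 * of_nat (degree q)
          \<and> pderiv (pderiv q) + smult 2 A * pderiv q + (pderiv A - B) * q = 0
        \<or> - coeff B (n - 1) - of_nat n = 2 * of_nat (degree q)
          \<and> pderiv (pderiv q) - smult 2 A * pderiv q - (pderiv A + B) * q = 0"
    proof (rule disjE[OF *(1)])
      assume "s = 1"
      then show ?thesis using *(8,9) by (simp add: two)
    next
      assume s: "s = -1"
      then have "pderiv (pderiv q) - smult 2 A * pderiv q - (pderiv A + B) * q = 0"
        using *(8) by (simp add: two algebra_simps)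
      then show ?thesis using *(9) s by simp
    qed
    then show ?R
      unfolding W_def[symmetric]
      by (intro exI[of _ n] exI[of _ "coeff A"] exI[of _ "coeff B"], unfold A A' B)
        (use *(3,4) gq(1) degW in auto)
  }
  {
    assume ?R
    then obtain n a b where deg: "degree V = 2 * n" and
      V: "V - [:lam:] = (monom 1 n + (\<Sum>j<n. monom (a j) j))\<^sup>2 + (\<Sum>j<n. monom (b j) j)" and
      P: "(\<exists>P. lead_coeff P = 1 \<and> pderiv (pderiv P) + smult 2 (monom 1 n + (\<Sum>j<n. monom (a j) j)) * pderiv P
                       + (monom (of_nat n) (n - 1) + (\<Sum>j<n - 1. monom (of_nat (j + 1) * a (j + 1)) j)
                          - (\<Sum>j<n. monom (b j) j)) * P = 0) \<or>
          (\<exists>P. lead_coeff P = 1 \<and> pderiv (pderiv P) - smult 2 (monom 1 n + (\<Sum>j<n. monom (a j) j)) * pderiv P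
                       - (monom (of_nat n) (n - 1) + (\<Sum>j<n - 1. monom (of_nat (j + 1) * a (j + 1)) j)
                          + (\<Sum>j<n. monom (b j) j)) * P = 0)"
      by blast
    have "n > 0" using deg assms(2) by simp
    define A B where "A = monom 1 n + (\<Sum>j<n. monom (a j) j)" and "B = (\<Sum>j<n. monom (b j) j)"
    have VAB: "W = A\<^sup>2 + B" unfolding A_def B_def W_def by (rule V)
    note P' = P[folded pderiv_monic_sum_monom[OF \<open>n > 0\<close>], folded A_def B_def]
    show ?L unfolding W_def[symmetric]
    proof (rule disjE[OF P'])
      assume "\<exists>P. lead_coeff P = 1 \<and> pderiv (pderiv P) + smult 2 A * pderiv P + (pderiv A - B) * P = 0"
      then obtain P where P: "lead_coeff P = 1" "pderiv (pderiv P) + smult 2 A * pderiv P + (pderiv A - B) * P = 0"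
        by blast
      show "\<exists>u. dK u + u\<^sup>2 = polyK W"
        by (rule riccati_solution_of_poly[of P A]) (use P in \<open>auto simp: VAB two\<close>)
    next
      assume "\<exists>P. lead_coeff P = 1 \<and> pderiv (pderiv P) - smult 2 A * pderiv P - (pderiv A + B) * P = 0"
      then obtain P where P: "lead_coeff P = 1" "pderiv (pderiv P) - smult 2 A * pderiv P - (pderiv A + B) * P = 0"
        by blast
      show "\<exists>u. dK u + u\<^sup>2 = polyK W"
        by (rule riccati_solution_of_poly[of P "- A"]) (use P in \<open>auto simp: VAB two pderiv_minus algebra_simps\<close>)
    qed
  }
qed

text \<open>A factor s with s^2 = 1 treats e^f and e^-f together: the second derivative of P e^(s f)
  carries the factor P'' + 2 s A P' + s A' P + A^2 P, which the equation turns into (A^2 + B)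
  P.\<close>

lemma exponential_solution:
  fixes P A B V :: "complex poly" and s :: complex
  assumes f: "\<And>z. (f has_field_derivative poly A z) (at z)"
    and V: "V - [:lam:] = A\<^sup>2 + B" and s: "s * s = 1"
    and eq: "pderiv (pderiv P) + smult (2 * s) A * pderiv P + (smult s (pderiv A) - B) * P = 0"
  shows "\<exists>\<Psi>'. \<forall>z. ((\<lambda>z. poly P z * exp (s * f z)) has_field_derivative \<Psi>' z) (at z)
    \<and> (\<Psi>' has_field_derivative (poly V z - lam) * (poly P z * exp (s * f z))) (at z)"
proof (intro exI allI conjI)
  fix z
  let ?Q = "\<lambda>z. (poly (pderiv P) z + s * poly A z * poly P z) * exp (s * f z)"
  show "((\<lambda>z. poly P z * exp (s * f z)) has_field_derivative ?Q z) (at z)"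
    by (rule derivative_eq_intros f refl)+ (simp add: algebra_simps)
  have "poly (pderiv (pderiv P) + smult (2 * s) A * pderiv P + (smult s (pderiv A) - B) * P) z = 0"
    by (simp only: eq poly_0)
  then have e: "poly (pderiv (pderiv P)) z = - (2 * s * poly A z * poly (pderiv P) z) - (s * poly (pderiv A) z - poly B z) * poly P z"
    by (simp add: algebra_simps eq_neg_iff_add_eq_0)
  have "poly (V - [:lam:]) z = poly (A\<^sup>2 + B) z" by (simp only: V)
  then have v: "poly V z - lam = poly A z * poly A z + poly B z" by (simp add: power2_eq_square)
  have "(poly (pderiv (pderiv P)) z + (s * poly (pderiv A) z * poly P z + s * poly A z * poly (pderiv P) z)) * exp (s * f z)
    + (poly (pderiv P) z + s * poly A z * poly P z) * (exp (s * f z) * (s * poly A z))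
    = (poly B z + (s * s) * poly A z * poly A z) * (poly P z * exp (s * f z))"
    unfolding e by (simp add: algebra_simps)
  then have e2: "(poly (pderiv (pderiv P)) z + (s * poly (pderiv A) z * poly P z + s * poly A z * poly (pderiv P) z)) * exp (s * f z)
    + (poly (pderiv P) z + s * poly A z * poly P z) * (exp (s * f z) * (s * poly A z))
    = (poly V z - lam) * (poly P z * exp (s * f z))"
    unfolding s v by (simp add: algebra_simps)
  show "(?Q has_field_derivative (poly V z - lam) * (poly P z * exp (s * f z))) (at z)"
    unfolding e2[symmetric]
    by (rule derivative_eq_intros f refl)+ (simp add: algebra_simps)
qed

section \<open>Picard--Vessiot extensions\<close>

unbundle no fps_syntax

section \<open>Obstructions over the field k(U) with U' = w - U^2\<close>

context
  fixes w :: "'k::{field_gcd,ring_char_0}" and d :: "'k \<Rightarrow> 'k"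
  assumes d: "derivation d"
    and no_darboux: "\<And>p. p \<noteq> 0 \<Longrightarrow> p dvd poly_deriv d [:w, 0, -1:] p \<Longrightarrow> degree p = 0"
begin

private abbreviation "\<delta> \<equiv> poly_deriv d [:w, 0, -1:]"

lemma riccati_deriv_quotient:
  assumes "b \<noteq> 0"
  shows "fract_deriv \<delta> (to_fract a / to_fract b) * (to_fract b)\<^sup>2 = to_fract (\<delta> a * b - a * \<delta> b)"
proof -
  have \<delta>: "derivation \<delta>" using d by (rule derivation_poly_deriv)
  show ?thesis
    using derivation_divide[OF derivation_fract_deriv[OF \<delta>], of "to_fract b" "to_fract a"] assms
    by (simp add: fract_deriv_to_fract[OF \<delta>])
qed

text \<open>For f = a / b in lowest terms, a and b each divide their own derivative and are thus
  constant in U; then f' / f lies in the base field and cannot be N U.\<close>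

lemma riccati_no_exponential:
  assumes "f \<noteq> 0" "N > 0"
  shows "fract_deriv \<delta> f \<noteq> of_nat N * to_fract [:0, 1:] * f"
proof
  assume asm: "fract_deriv \<delta> f = of_nat N * to_fract [:0, 1:] * f"
  obtain a b where ab: "f = to_fract a / to_fract b" "b \<noteq> 0" "coprime a b"
    by (rule Fract_coprime_cases)
  have "a \<noteq> 0" using ab assms by auto
  have "to_fract (\<delta> a * b - a * \<delta> b) = of_nat N * to_fract [:0, 1:] * f * (to_fract b)\<^sup>2"
    using riccati_deriv_quotient[OF ab(2), of a] unfolding ab(1)[symmetric] asm by simp
  also have "\<dots> = to_fract (of_nat N * [:0, 1:] * a * b)"
  proof -
    have "of_nat N = to_fract (of_nat N :: 'k poly)" by (simp add: of_nat_fract to_fract_def)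
    then have "of_nat N * to_fract [:0, 1:] * f * (to_fract b)\<^sup>2
      = to_fract (of_nat N) * to_fract [:0, 1:] * to_fract a * to_fract b"
      using ab by (simp add: power2_eq_square)
    then show ?thesis by (simp only: to_fract_mult)
  qed
  finally have e: "\<delta> a * b - a * \<delta> b = of_nat N * [:0, 1:] * a * b" by (simp only: to_fract_eq_iff)
  have "\<delta> a * b = a * (of_nat N * [:0, 1:] * b + \<delta> b)" using e by (simp only: algebra_simps)
  then have "a dvd \<delta> a * b" by simp
  then have "a dvd \<delta> a" using ab(3) coprime_dvd_mult_left_iff by blast
  then have a0: "degree a = 0" using no_darboux \<open>a \<noteq> 0\<close> by blast
  have "a * \<delta> b = b * (\<delta> a - of_nat N * [:0, 1:] * a)" using e by (simp only: algebra_simps)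
  then have "b dvd a * \<delta> b" by simp
  then have "b dvd \<delta> b" using ab(3) coprime_commute coprime_dvd_mult_right_iff by blast
  then have b0: "degree b = 0" using no_darboux ab(2) by blast
  obtain \<alpha> \<beta> where \<alpha>\<beta>: "a = [:\<alpha>:]" "b = [:\<beta>:]" using a0 b0 by (metis degree_eq_zeroE)
  have "coeff (of_nat N * [:0, 1:] * a * b) 1 = of_nat N * \<alpha> * \<beta>"
    by (simp add: \<alpha>\<beta> of_nat_poly)
  moreover have "coeff (\<delta> a * b - a * \<delta> b) 1 = 0"
    by (simp add: \<alpha>\<beta> poly_deriv_const[OF d])
  ultimately have "of_nat N * \<alpha> * \<beta> = 0" using e by simp
  then show False using \<alpha>\<beta> ab(2) \<open>a \<noteq> 0\<close> assms(2) by simp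
qed

text \<open>The denominator divides its own derivative, so g is a polynomial in U. If it has degree
  n, then U' = w - U^2 gives g' - 2 U g the coefficient - (n + 2) times the leading one at U^(n+1),
  which a constant cannot have.\<close>

lemma riccati_no_linear:
  assumes "c \<noteq> 0"
  shows "fract_deriv \<delta> g - 2 * to_fract [:0, 1:] * g \<noteq> to_fract [:c:]"
proof
  assume asm: "fract_deriv \<delta> g - 2 * to_fract [:0, 1:] * g = to_fract [:c:]"
  obtain a b where ab: "g = to_fract a / to_fract b" "b \<noteq> 0" "coprime a b"
    by (rule Fract_coprime_cases)
  have eq: "\<delta> a * b - a * \<delta> b - 2 * [:0, 1:] * a * b = [:c:] * b * b"
    if g: "g = to_fract a / to_fract b" and "b \<noteq> 0" for a b
  proof -
    have "to_fract (\<delta> a * b - a * \<delta> b) = (to_fract [:c:] + 2 * to_fract [:0, 1:] * g) * (to_fract b)\<^sup>2"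
      using riccati_deriv_quotient[OF that(2), of a] asm unfolding g[symmetric] by (simp add: algebra_simps)
    also have "\<dots> = to_fract ([:c:] * b * b + 2 * [:0, 1:] * a * b)"
    proof -
      have "2 = to_fract (2 :: 'k poly)"
        by (metis of_nat_fract of_nat_numeral to_fract_def)
      then have "(to_fract [:c:] + 2 * to_fract [:0, 1:] * g) * (to_fract b)\<^sup>2
        = to_fract [:c:] * to_fract b * to_fract b + to_fract 2 * to_fract [:0, 1:] * to_fract a * to_fract b"
        using that by (simp add: power2_eq_square algebra_simps)
      then show ?thesis by (simp only: to_fract_mult to_fract_add)
    qed
    finally have "\<delta> a * b - a * \<delta> b = [:c:] * b * b + 2 * [:0, 1:] * a * b" by (simp only: to_fract_eq_iff)
    then show ?thesis by (simp only: diff_eq_eq)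
  qed
  have "a * \<delta> b = b * (\<delta> a - 2 * [:0, 1:] * a - [:c:] * b)"
    using eq[OF ab(1,2)] by (simp only: algebra_simps)
  then have "b dvd a * \<delta> b" by simp
  then have "b dvd \<delta> b" using ab(3) coprime_commute coprime_dvd_mult_right_iff by blast
  then have b0: "degree b = 0" using no_darboux ab(2) by blast
  then obtain \<beta> where \<beta>: "b = [:\<beta>:]" by (metis degree_eq_zeroE)
  have "\<beta> \<noteq> 0" using \<beta> ab by simp
  define a' where "a' = smult (inverse \<beta>) a"
  have "a' * b = a" using \<beta> \<open>\<beta> \<noteq> 0\<close> by (simp add: a'_def)
  then have "to_fract a' * to_fract b = to_fract a" by (metis to_fract_mult)
  moreover have "g * to_fract b = to_fract a" "to_fract b \<noteq> 0" using ab by simp_all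
  ultimately have "g = to_fract a'" by (metis mult_right_cancel)
  then have "g = to_fract a' / to_fract 1" by simp
  from eq[OF this] have e: "\<delta> a' - 2 * [:0, 1:] * a' = [:c:]"
    using poly_deriv_const[OF d, of _ 1] derivation.one[OF d] by (simp add: one_pCons)
  show False
  proof (cases "a' = 0")
    case True
    then show False using e assms by (simp add: poly_deriv_def)
  next
    case False
    have "2 * [:0, 1:] * a' = pCons 0 (smult 2 a')" by (simp add: numeral_poly)
    then have "coeff (\<delta> a' - 2 * [:0, 1:] * a') (Suc (degree a')) = - of_nat (degree a') * lead_coeff a' - 2 * lead_coeff a'"
      using derivation.zero[OF d] by (simp add: coeff_riccati_deriv[OF d] coeff_eq_0)
    then have "- of_nat (degree a') * lead_coeff a' - 2 * lead_coeff a' = 0" unfolding e by simp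
    moreover have "of_nat (degree a' + 2) * lead_coeff a' = - (- of_nat (degree a') * lead_coeff a' - 2 * lead_coeff a')"
      by (simp add: algebra_simps)
    ultimately have "of_nat (degree a' + 2) * lead_coeff a' = 0" by (simp only: minus_zero)
    then have "of_nat (degree a' + 2) = (0 :: 'k)" using False by (simp del: of_nat_add)
    then show False by (simp only: of_nat_eq_0_iff)
  qed
qed

end

text \<open>Two parametrizations of \<open>L\<close> by one differential field, in which \<kappa> is
  the inclusion of K, differ by \<Psi>2 composed with the inverse of \<Psi>1.\<close>

lemma diff_automorphism_of_embeddings:
  fixes \<Psi>1 \<Psi>2 :: "'T::field \<Rightarrow> 'L::field" and \<delta> :: "'T \<Rightarrow> 'T"
  assumes "embedding \<Psi>1" "surj \<Psi>1" "\<And>r. D (\<Psi>1 r) = \<Psi>1 (\<delta> r)" "\<And>k. \<Psi>1 (\<kappa> k) = emb k"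
    and "embedding \<Psi>2" "surj \<Psi>2" "\<And>r. D (\<Psi>2 r) = \<Psi>2 (\<delta> r)" "\<And>k. \<Psi>2 (\<kappa> k) = emb k"
  obtains \<sigma> where "diff_K_automorphism emb D \<sigma>" "\<And>r. \<sigma> (\<Psi>1 r) = \<Psi>2 r"
proof -
  interpret p1: embedding \<Psi>1 by fact
  interpret p2: embedding \<Psi>2 by fact
  define \<sigma> where "\<sigma> = \<Psi>2 \<circ> inv \<Psi>1"
  have \<sigma>: "\<sigma> (\<Psi>1 r) = \<Psi>2 r" for r by (simp add: \<sigma>_def inv_f_f p1.inj)
  have "bij \<Psi>1" "bij \<Psi>2" using assms(2,6) p1.inj p2.inj by (simp_all add: bij_def)
  then have "bij \<sigma>" unfolding \<sigma>_def by (intro bij_comp bij_imp_bij_inv)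
  have ex: "\<exists>r. x = \<Psi>1 r" for x using assms(2) by (metis surjD)
  have "diff_K_automorphism emb D \<sigma>"
    unfolding diff_K_automorphism_def
  proof (intro conjI allI)
    fix x y
    obtain r s where rs: "x = \<Psi>1 r" "y = \<Psi>1 s" using ex by meson
    show "\<sigma> (x + y) = \<sigma> x + \<sigma> y" "\<sigma> (x * y) = \<sigma> x * \<sigma> y"
      unfolding rs p1.add[symmetric] p1.mult[symmetric] \<sigma> by (simp_all add: p2.add p2.mult)
    show "\<sigma> (D x) = D (\<sigma> x)" unfolding rs assms(3) \<sigma> assms(7) ..
  next
    show "\<sigma> (emb k) = emb k" for k using \<sigma>[of "\<kappa> k"] by (simp add: assms)
  qed fact
  then show ?thesis using \<sigma> by (rule that)
qed

section \<open>The field \<open>L\<close>: constants, Wronskian and changes of basis\<close>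

locale picard_vessiot =
  fixes emb :: "ratfun \<Rightarrow> 'L::field" and D :: "'L \<Rightarrow> 'L" and W :: "complex poly" and y1 y2 :: 'L
  assumes PV: "PV_extension emb D W y1 y2"
begin

definition scalar :: "complex \<Rightarrow> 'L" where "scalar c = emb (constK c)"

definition wronskian :: 'L where "wronskian = y1 * D y2 - D y1 * y2"

lemma derivation_D: "derivation D"
  using PV unfolding PV_extension_def is_derivation_def derivation_def by blast

sublocale D: derivation D by (rule derivation_D)

lemma embedding_emb: "embedding emb"
  using PV by (intro embedding_field) (auto simp: PV_extension_def diff_field_emb_def)

sublocale emb: embedding emb by (rule embedding_emb)

lemma D_emb [simp]: "D (emb a) = emb (dK a)"
  using PV by (auto simp: PV_extension_def diff_field_emb_def)

lemma D_D: "D (D y1) = emb (polyK W) * y1" "D (D y2) = emb (polyK W) * y2"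
  using PV by (auto simp: PV_extension_def)

lemma wronskian_nonzero: "wronskian \<noteq> 0"
  using PV by (auto simp: PV_extension_def wronskian_def)

lemma embedding_scalar: "embedding scalar"
proof -
  interpret c: embedding constK by (rule embedding_constK)
  show ?thesis by unfold_locales (auto simp: scalar_def c.add c.mult emb.add emb.mult)
qed

sublocale scalar: embedding scalar by (rule embedding_scalar)

lemma D_scalar [simp]: "D (scalar c) = 0"
  unfolding scalar_def D_emb dK_constK by (rule emb.zero)

lemma constantE:
  assumes "D x = 0"
  obtains c where "x = scalar c"
proof -
  have "x \<in> emb ` {c. dK c = 0}" using assms PV unfolding PV_extension_def by blast
  then show ?thesis using that by (auto simp: dK_eq_0_iff scalar_def)
qed

lemma wronskianE:
  obtains c0 where "c0 \<noteq> 0" "wronskian = scalar c0"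
proof -
  have "D wronskian = 0" by (simp add: wronskian_def D.diff D.mult D_D)
  then obtain c0 where c0: "wronskian = scalar c0" by (rule constantE)
  moreover have "c0 \<noteq> 0" using wronskian_nonzero c0 by auto
  ultimately show ?thesis using that by blast
qed

lemma field_induct:
  assumes "range emb \<subseteq> F" "y1 \<in> F" "y2 \<in> F" "D y1 \<in> F" "D y2 \<in> F"
    and "\<And>a b. a \<in> F \<Longrightarrow> b \<in> F \<Longrightarrow> a + b \<in> F" "\<And>a b. a \<in> F \<Longrightarrow> b \<in> F \<Longrightarrow> a * b \<in> F"
    and "\<And>a. a \<in> F \<Longrightarrow> - a \<in> F" "\<And>a. a \<in> F \<Longrightarrow> inverse a \<in> F"
  shows "F = UNIV"
proof -
  have "emb 0 \<in> F" "emb 1 \<in> F" using assms(1) by blast+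
  then have "generated_field (range emb \<union> {y1, y2, D y1, D y2}) \<subseteq> F"
    unfolding generated_field_def using assms by (intro Inter_lower) simp
  then show ?thesis using PV unfolding PV_extension_def by blast
qed

lemma surj_embedding:
  fixes \<Psi> :: "'T::field \<Rightarrow> 'L"
  assumes "embedding \<Psi>" "range emb \<subseteq> range \<Psi>" "{y1, y2, D y1, D y2} \<subseteq> range \<Psi>"
  shows "surj \<Psi>"
proof -
  interpret p: embedding \<Psi> by fact
  show ?thesis
  proof (rule field_induct)
    fix a b assume "a \<in> range \<Psi>" "b \<in> range \<Psi>"
    then show "a + b \<in> range \<Psi>" "a * b \<in> range \<Psi>"
      by (auto simp flip: p.add p.mult)
  next
    fix a assume "a \<in> range \<Psi>"
    then show "- a \<in> range \<Psi>" "inverse a \<in> range \<Psi>"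
      by (auto simp flip: p.minus embedding_inverse[OF assms(1)])
  qed (use assms in auto)
qed

definition lincomb :: "complex^2 \<Rightarrow> 'L" where
  "lincomb v = scalar (v $ 1) * y1 + scalar (v $ 2) * y2"

lemma D_lincomb: "D (lincomb v) = scalar (v $ 1) * D y1 + scalar (v $ 2) * D y2"
  by (simp add: lincomb_def D.add D.mult)

lemma wronskian_lincomb:
  "lincomb (column 1 Q) * D (lincomb (column 2 Q)) - D (lincomb (column 1 Q)) * lincomb (column 2 Q)
    = scalar (det Q) * wronskian"
  unfolding D_lincomb unfolding lincomb_def column_def wronskian_def det_2
  by (simp add: scalar.diff scalar.mult algebra_simps)

text \<open>Makes the locale available for every fundamental system of the same \<open>L\<close>;
  images of y1, y2 under a prescribed matrix are handled this way.\<close>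

lemma basis_change:
  assumes "det Q \<noteq> 0"
  shows "PV_extension emb D W (lincomb (column 1 Q)) (lincomb (column 2 Q))"
proof -
  let ?z1 = "lincomb (column 1 Q)" and ?z2 = "lincomb (column 2 Q)"
  have "D (D (lincomb v)) = emb (polyK W) * lincomb v" for v
    unfolding D_lincomb by (simp add: D.add D.mult D_D lincomb_def algebra_simps)
  moreover have "?z1 * D ?z2 - D ?z1 * ?z2 \<noteq> 0"
    unfolding wronskian_lincomb using assms wronskian_nonzero by simp
  moreover have "generated_field (range emb \<union> {?z1, ?z2, D ?z1, D ?z2}) = UNIV"
  proof (rule antisym[OF subset_UNIV], unfold generated_field_def, rule Inter_greatest)
    fix F assume "F \<in> {F. range emb \<union> {?z1, ?z2, D ?z1, D ?z2} \<subseteq> F \<and> 0 \<in> F \<and> 1 \<in> F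
      \<and> (\<forall>a\<in>F. \<forall>b\<in>F. a + b \<in> F \<and> a * b \<in> F) \<and> (\<forall>a\<in>F. - a \<in> F \<and> inverse a \<in> F)}"
    then have F: "range emb \<subseteq> F" "?z1 \<in> F" "?z2 \<in> F" "D ?z1 \<in> F" "D ?z2 \<in> F"
      "\<And>a b. a \<in> F \<Longrightarrow> b \<in> F \<Longrightarrow> a + b \<in> F" "\<And>a b. a \<in> F \<Longrightarrow> b \<in> F \<Longrightarrow> a * b \<in> F"
      "\<And>a. a \<in> F \<Longrightarrow> - a \<in> F" "\<And>a. a \<in> F \<Longrightarrow> inverse a \<in> F"
      unfolding mem_Collect_eq by blast+
    have sF: "scalar c \<in> F" for c unfolding scalar_def using F(1) by blast
    define e where "e = inverse (det Q)"
    have e: "e * det Q = 1" using assms by (simp add: e_def)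
    \<comment> \<open>Cramer's rule, with \<open>e\<close> the inverse of the determinant.\<close>
    have "y1 = scalar (e * Q $ 2 $ 2) * ?z1 + scalar (- e * Q $ 2 $ 1) * ?z2"
      "y2 = scalar (- e * Q $ 1 $ 2) * ?z1 + scalar (e * Q $ 1 $ 1) * ?z2"
      "D y1 = scalar (e * Q $ 2 $ 2) * D ?z1 + scalar (- e * Q $ 2 $ 1) * D ?z2"
      "D y2 = scalar (- e * Q $ 1 $ 2) * D ?z1 + scalar (e * Q $ 1 $ 1) * D ?z2"
    proof -
      have s: "scalar e * scalar (Q $ 1 $ 1) * scalar (Q $ 2 $ 2) - scalar e * scalar (Q $ 1 $ 2) * scalar (Q $ 2 $ 1) = 1"
        using arg_cong[OF e, of scalar] by (simp add: det_2 scalar.mult scalar.diff algebra_simps)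
      have "scalar (e * Q $ 2 $ 2) * lincomb (column 1 Q) + scalar (- e * Q $ 2 $ 1) * lincomb (column 2 Q)
        = (scalar e * scalar (Q $ 1 $ 1) * scalar (Q $ 2 $ 2) - scalar e * scalar (Q $ 1 $ 2) * scalar (Q $ 2 $ 1)) * y1"
        by (simp add: lincomb_def column_def scalar.mult scalar.minus algebra_simps)
      then show "y1 = scalar (e * Q $ 2 $ 2) * ?z1 + scalar (- e * Q $ 2 $ 1) * ?z2" by (simp only: s mult_1_left)
      note Y1 = this
      show "D y1 = scalar (e * Q $ 2 $ 2) * D ?z1 + scalar (- e * Q $ 2 $ 1) * D ?z2"
        using arg_cong[OF Y1, of D] by (simp only: D.add D.mult D_scalar mult_zero_left add_0_left)
      have "scalar (- e * Q $ 1 $ 2) * ?z1 + scalar (e * Q $ 1 $ 1) * ?z2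
        = (scalar e * scalar (Q $ 1 $ 1) * scalar (Q $ 2 $ 2) - scalar e * scalar (Q $ 1 $ 2) * scalar (Q $ 2 $ 1)) * y2"
        by (simp add: lincomb_def column_def scalar.mult scalar.minus algebra_simps)
      then show "y2 = scalar (- e * Q $ 1 $ 2) * ?z1 + scalar (e * Q $ 1 $ 1) * ?z2" by (simp only: s mult_1_left)
      note Y2 = this
      show "D y2 = scalar (- e * Q $ 1 $ 2) * D ?z1 + scalar (e * Q $ 1 $ 1) * D ?z2"
        using arg_cong[OF Y2, of D] by (simp only: D.add D.mult D_scalar mult_zero_left add_0_left)
    qed
    note eqs = this
    have mem: "scalar p * x + scalar q * y \<in> F" if "x \<in> F" "y \<in> F" for p q x y
      by (intro F(6,7) sF that)
    have "y1 \<in> F" by (subst eqs(1)) (rule mem[OF F(2,3)])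
    moreover have "y2 \<in> F" by (subst eqs(2)) (rule mem[OF F(2,3)])
    moreover have "D y1 \<in> F" by (subst eqs(3)) (rule mem[OF F(4,5)])
    moreover have "D y2 \<in> F" by (subst eqs(4)) (rule mem[OF F(4,5)])
    ultimately have "F = UNIV" by (rule field_induct[OF F(1) _ _ _ _ F(6-9)])
    then show "UNIV \<subseteq> F" by simp
  qed
  moreover have "is_derivation D" "diff_field_emb emb D" "{c. D c = 0} = emb ` {c. dK c = 0}"
    using PV unfolding PV_extension_def by blast+
  ultimately show ?thesis unfolding PV_extension_def by (intro conjI)
qed

lemma DGal_iff:
  "M \<in> DGal emb D y1 y2 \<longleftrightarrow>
    (\<exists>\<sigma>. diff_K_automorphism emb D \<sigma> \<and> \<sigma> y1 = lincomb (column 1 M) \<and> \<sigma> y2 = lincomb (column 2 M))"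
  by (simp add: DGal_def lincomb_def scalar_def column_def)

lemma automorphism_lincomb:
  assumes "diff_K_automorphism emb D \<sigma>" "\<sigma> y1 = lincomb (column 1 M)" "\<sigma> y2 = lincomb (column 2 M)"
  shows "\<sigma> (lincomb v) = lincomb (M *v v)"
proof -
  have "\<sigma> (lincomb v) = scalar (v $ 1) * lincomb (column 1 M) + scalar (v $ 2) * lincomb (column 2 M)"
    using assms unfolding lincomb_def[of v] by (simp add: diff_K_automorphism_def scalar_def)
  then show ?thesis
    by (simp add: lincomb_def column_def matrix_vector_mult_def sum_2 scalar.add scalar.mult algebra_simps)
qed

text \<open>The Wronskian is a constant of K, hence fixed by every automorphism, while a change of
  basis multiplies it by the determinant.\<close>

lemma DGal_subset_SL2: "DGal emb D y1 y2 \<subseteq> SL2"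
proof
  fix M assume "M \<in> DGal emb D y1 y2"
  then obtain \<sigma> where \<sigma>: "diff_K_automorphism emb D \<sigma>"
    "\<sigma> y1 = lincomb (column 1 M)" "\<sigma> y2 = lincomb (column 2 M)" unfolding DGal_iff by blast
  have h: "\<sigma> (a + b) = \<sigma> a + \<sigma> b" "\<sigma> (a * b) = \<sigma> a * \<sigma> b" "\<sigma> (D a) = D (\<sigma> a)" "\<sigma> (emb k) = emb k" for a b k
    using \<sigma>(1) by (auto simp: diff_K_automorphism_def)
  have diff: "\<sigma> (a - b) = \<sigma> a - \<sigma> b" for a b
    using h(1)[of "a - b" b] by (simp add: eq_diff_eq)
  obtain c0 where "wronskian = scalar c0" by (rule wronskianE)
  then have "\<sigma> wronskian = wronskian" by (simp add: scalar_def h)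
  moreover have "\<sigma> wronskian = scalar (det M) * wronskian"
    unfolding wronskian_lincomb[symmetric] by (simp add: wronskian_def diff h(2,3) \<sigma>(2,3))
  ultimately have "scalar (det M) = 1" using wronskian_nonzero by simp
  then have "det M = 1" using scalar.eq_iff[of "det M" 1] by simp
  then show "M \<in> SL2" by (simp add: SL2_def)
qed

text \<open>One inclusion between the groups in two bases; the other is the same statement read from
  the new basis, with \<open>Q\<close> and \<open>R\<close> interchanged.\<close>

lemma DGal_basis_change:
  assumes "Q ** R = mat 1" "M \<in> DGal emb D y1 y2"
  shows "R ** M ** Q \<in> DGal emb D (lincomb (column 1 Q)) (lincomb (column 2 Q))"
proof -
  obtain \<sigma> where \<sigma>: "diff_K_automorphism emb D \<sigma>"
    "\<sigma> y1 = lincomb (column 1 M)" "\<sigma> y2 = lincomb (column 2 M)" using assms(2) unfolding DGal_iff by blast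
  have "det Q * det R = 1" using assms(1) by (metis det_I det_mul)
  then have "det Q \<noteq> 0" by auto
  then interpret z: picard_vessiot emb D W "lincomb (column 1 Q)" "lincomb (column 2 Q)"
    by unfold_locales (rule basis_change)
  have zl: "z.lincomb v = lincomb (Q *v v)" for v
    unfolding z.lincomb_def unfolding lincomb_def column_def
    by (simp add: matrix_vector_mult_def sum_2 scalar.add scalar.mult algebra_simps)
  have col: "A *v column i B = column i (A ** B)" for A B :: "complex^2^2" and i
    by (simp add: vec_eq_iff matrix_vector_mult_def matrix_matrix_mult_def column_def)
  have "\<sigma> (lincomb (column i Q)) = z.lincomb (column i (R ** M ** Q))" for i
    unfolding automorphism_lincomb[OF \<sigma>] zl col
    by (simp add: matrix_mul_assoc assms(1))
  then show ?thesis unfolding z.DGal_iff using \<sigma>(1) by blast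
qed

lemma y1_nonzero: "y1 \<noteq> 0"
  using wronskian_nonzero by (auto simp: wronskian_def)

lemma D_quotient: "D (y2 / y1) = wronskian / y1\<^sup>2"
  using y1_nonzero by (simp add: derivation_divide[OF derivation_D] wronskian_def mult.commute)

end

section \<open>The differential Galois group\<close>

lemma matrix_inv_inverse:
  assumes "invertible Q"
  shows "Q ** matrix_inv Q = mat 1" "matrix_inv Q ** Q = mat 1"
  using someI_ex[OF assms[unfolded invertible_def]] unfolding matrix_inv_def by blast+

context picard_vessiot
begin

lemma surj_if_generators:
  fixes \<Psi> :: "'T::field \<Rightarrow> 'L"
  assumes "embedding \<Psi>" "\<And>r. D (\<Psi> r) = \<Psi> (\<delta> r)" "\<And>k. \<Psi> (\<kappa> k) = emb k" "\<Psi> a = y1" "\<Psi> b = y2"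
  shows "surj \<Psi>"
proof (rule surj_embedding[OF assms(1)])
  show "range emb \<subseteq> range \<Psi>" using assms(3) by (metis image_subsetI rangeI)
  have "D y1 = \<Psi> (\<delta> a)" "D y2 = \<Psi> (\<delta> b)" by (simp_all flip: assms(2,4,5))
  then show "{y1, y2, D y1, D y2} \<subseteq> range \<Psi>" using assms(4,5) by auto
qed

text \<open>The derivation on the function field involves only \<open>u\<close> and
  \<open>c0\<close>, so every basis with the same Wronskian whose first member satisfies y' = u y is
  parametrized by the same differential field.\<close>

lemma borel_parametrization:
  assumes W: "degree W > 0" and u: "dK u + u\<^sup>2 = polyK W" and y1: "D y1 = emb u * y1"
    and c0: "wronskian = scalar c0"
  obtains \<Psi> where "embedding \<Psi>" "surj \<Psi>"
    "\<And>r. D (\<Psi> r) = \<Psi> (exp_int_deriv dK u (constK c0) r)"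
    "\<And>k. \<Psi> (to_fract [:to_fract [:k:]:]) = emb k"
    "\<Psi> (to_fract [:to_fract [:0, 1:]:]) = y1"
    "\<Psi> (to_fract [:to_fract [:0, 1:]:] * to_fract [:0, 1:]) = y2"
proof -
  have c0': "c0 \<noteq> 0" using c0 wronskian_nonzero by auto
  have z: "D (y2 / y1) = emb (constK c0) / y1\<^sup>2" unfolding D_quotient c0 scalar_def ..
  obtain \<Psi> where \<Psi>: "embedding \<Psi>" "\<And>r. D (\<Psi> r) = \<Psi> (exp_int_deriv dK u (constK c0) r)"
    "\<And>a. \<Psi> (to_fract [:to_fract [:a:]:]) = emb a"
    "\<Psi> (to_fract [:to_fract [:0, 1:]:]) = y1" "\<Psi> (to_fract [:0, 1:]) = y2 / y1"
    using exp_int_embedding[OF embedding_emb derivation_dK derivation_D D_emb y1_nonzero y1 z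
        no_exponential_solution[OF W u] no_linear_solution[OF W u c0']] by blast
  have y2: "\<Psi> (to_fract [:to_fract [:0, 1:]:] * to_fract [:0, 1:]) = y2"
    unfolding embedding.mult[OF \<Psi>(1)] \<Psi>(4,5) using y1_nonzero by simp
  show ?thesis
    by (rule that[OF \<Psi>(1) surj_if_generators[OF \<Psi>(1-4) y2] \<Psi>(2-4) y2])
qed

text \<open>A third transcendental sits below the tower: U goes to y1' / y1, and y1 is then an
  exponential over K(U) with h = U. Only \<open>W\<close> and \<open>c0\<close> enter the
  derivation, so any basis with Wronskian \<open>c0\<close> is covered.\<close>

lemma generic_parametrization:
  assumes W: "lead_coeff W = 1" "degree W > 0" and no_sol: "\<nexists>u. dK u + u\<^sup>2 = polyK W"
    and c0: "wronskian = scalar c0"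
  obtains \<Psi> where "embedding \<Psi>" "surj \<Psi>"
    "\<And>r. D (\<Psi> r) = \<Psi> (exp_int_deriv (fract_deriv (poly_deriv dK [:polyK W, 0, -1:]))
        (to_fract [:0, 1:]) (to_fract [:constK c0:]) r)"
    "\<And>k. \<Psi> (to_fract [:to_fract [:to_fract [:k:]:]:]) = emb k"
    "\<Psi> (to_fract [:to_fract [:0, 1:]:]) = y1"
    "\<Psi> (to_fract [:to_fract [:0, 1:]:] * to_fract [:0, 1:]) = y2"
proof -
  have c0': "constK c0 \<noteq> 0"
    using c0 wronskian_nonzero by (auto simp: scalar_def)
  have no_darboux: "degree p = 0" if "p \<noteq> 0" "p dvd poly_deriv dK [:polyK W, 0, -1:] p" for p
    using riccati_darboux_solution[OF W _ that(2)] no_sol by blast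
  define u where "u = D y1 / y1"
  have y1: "D y1 = u * y1" using y1_nonzero by (simp add: u_def)
  have u: "D u = peval emb u [:polyK W, 0, -1:]"
  proof -
    have "D u * y1 + u * (u * y1) = emb (polyK W) * y1"
      using arg_cong[OF y1, of D] D_D(1) y1 by (simp only: D.mult)
    then have "(D u + u * u) * y1 = emb (polyK W) * y1" by (simp only: algebra_simps)
    then have "D u + u * u = emb (polyK W)" using y1_nonzero mult_right_cancel by blast
    then show ?thesis by (simp add: emb.minus eq_diff_eq)
  qed
  define d2 where "d2 = fract_deriv (poly_deriv dK [:polyK W, 0, -1:])"
  define \<phi> where "\<phi> = fract_lift (peval emb u)"
  have E: "embedding (peval emb u)"
  proof (rule emb.embedding_peval, rule ccontr)
    fix p0 assume "peval emb u p0 = 0" "p0 \<noteq> 0"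
    then obtain p where p: "lead_coeff p = 1" "peval emb u p = 0" "irreducible p"
      "\<And>q. peval emb u q = 0 \<Longrightarrow> p dvd q"
      using minimal_annihilator[OF embedding_emb] by blast
    have "peval emb u (poly_deriv dK [:polyK W, 0, -1:] p) = D (peval emb u p)"
      by (rule emb.peval_deriv[OF derivation_dK derivation_D D_emb u, symmetric])
    then have "p dvd poly_deriv dK [:polyK W, 0, -1:] p" using p(2,4) by simp
    moreover have "p \<noteq> 0" using p(1) by auto
    ultimately have "degree p = 0" using no_darboux by blast
    then show False using p(3) \<open>p \<noteq> 0\<close> by (simp add: irreducible_def is_unit_iff_degree)
  qed
  have dd: "derivation (poly_deriv dK [:polyK W, 0, -1:])" by (rule derivation_poly_deriv[OF derivation_dK])
  have d2: "derivation d2" unfolding d2_def by (rule derivation_fract_deriv[OF dd])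
  have \<phi>: "embedding \<phi>" unfolding \<phi>_def by (rule embedding_fract_lift[OF E])
  have D2: "D (\<phi> r) = \<phi> (d2 r)" for r
    unfolding \<phi>_def d2_def
    by (rule fract_lift_deriv[OF E dd derivation_D], rule emb.peval_deriv[OF derivation_dK derivation_D D_emb u])
  have \<phi>_const: "\<phi> (to_fract [:k:]) = emb k" for k
    unfolding \<phi>_def fract_lift_to_fract[OF E] by simp
  have \<phi>_X: "\<phi> (to_fract [:0, 1:]) = u"
    unfolding \<phi>_def fract_lift_to_fract[OF E] by simp
  have y1': "D y1 = \<phi> (to_fract [:0, 1:]) * y1" unfolding \<phi>_X by (rule y1)
  have z: "D (y2 / y1) = \<phi> (to_fract [:constK c0:]) / y1\<^sup>2"
    unfolding \<phi>_const D_quotient c0 scalar_def ..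
  have no_exp: "d2 f \<noteq> of_nat N * to_fract [:0, 1:] * f" if "f \<noteq> 0" "N > 0" for f N
    unfolding d2_def by (rule riccati_no_exponential[OF derivation_dK no_darboux that])
  have no_lin: "d2 g - 2 * to_fract [:0, 1:] * g \<noteq> to_fract [:constK c0:]" for g
    unfolding d2_def by (rule riccati_no_linear[OF derivation_dK no_darboux c0'])
  obtain \<Psi> where \<Psi>: "embedding \<Psi>"
    "\<And>r. D (\<Psi> r) = \<Psi> (exp_int_deriv d2 (to_fract [:0, 1:]) (to_fract [:constK c0:]) r)"
    "\<And>a. \<Psi> (to_fract [:to_fract [:a:]:]) = \<phi> a"
    "\<Psi> (to_fract [:to_fract [:0, 1:]:]) = y1" "\<Psi> (to_fract [:0, 1:]) = y2 / y1"
    using exp_int_embedding[OF \<phi> d2 derivation_D D2 y1_nonzero y1' z no_exp no_lin] by blast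
  have y2: "\<Psi> (to_fract [:to_fract [:0, 1:]:] * to_fract [:0, 1:]) = y2"
    unfolding embedding.mult[OF \<Psi>(1)] \<Psi>(4,5) using y1_nonzero by simp
  have k: "\<Psi> (to_fract [:to_fract [:to_fract [:k:]:]:]) = emb k" for k
    unfolding \<Psi>(3) by (rule \<phi>_const)
  show ?thesis
    by (rule that[OF \<Psi>(1) surj_if_generators[OF \<Psi>(1,2) k \<Psi>(4) y2] \<Psi>(2)[unfolded d2_def] k \<Psi>(4) y2])
qed

lemma DGal_eq_SL2:
  assumes W: "lead_coeff W = 1" "degree W > 0" and no_sol: "\<nexists>u. dK u + u\<^sup>2 = polyK W"
  shows "DGal emb D y1 y2 = SL2"
proof (rule antisym[OF DGal_subset_SL2], rule subsetI)
  fix M :: "complex^2^2" assume "M \<in> SL2"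
  then have det: "det M = 1" by (simp add: SL2_def)
  interpret z: picard_vessiot emb D W "lincomb (column 1 M)" "lincomb (column 2 M)"
    by unfold_locales (rule basis_change, simp add: det)
  obtain c0 where c0: "wronskian = scalar c0" by (rule wronskianE)
  \<comment> \<open>Determinant 1 makes both parametrizing differential fields the same one.\<close>
  have w: "z.wronskian = scalar c0"
    unfolding z.wronskian_def wronskian_lincomb det c0 by simp
  obtain \<Psi>2 where \<Psi>2: "embedding \<Psi>2" "surj \<Psi>2"
    "\<And>r. D (\<Psi>2 r) = \<Psi>2 (exp_int_deriv (fract_deriv (poly_deriv dK [:polyK W, 0, -1:]))
        (to_fract [:0, 1:]) (to_fract [:constK c0:]) r)"
    "\<And>k. \<Psi>2 (to_fract [:to_fract [:to_fract [:k:]:]:]) = emb k"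
    "\<Psi>2 (to_fract [:to_fract [:0, 1:]:]) = lincomb (column 1 M)"
    "\<Psi>2 (to_fract [:to_fract [:0, 1:]:] * to_fract [:0, 1:]) = lincomb (column 2 M)"
    by (rule z.generic_parametrization[OF W no_sol w]) (rule that)
  obtain \<Psi>1 where \<Psi>1: "embedding \<Psi>1" "surj \<Psi>1"
    "\<And>r. D (\<Psi>1 r) = \<Psi>1 (exp_int_deriv (fract_deriv (poly_deriv dK [:polyK W, 0, -1:]))
        (to_fract [:0, 1:]) (to_fract [:constK c0:]) r)"
    "\<And>k. \<Psi>1 (to_fract [:to_fract [:to_fract [:k:]:]:]) = emb k"
    "\<Psi>1 (to_fract [:to_fract [:0, 1:]:]) = y1"
    "\<Psi>1 (to_fract [:to_fract [:0, 1:]:] * to_fract [:0, 1:]) = y2"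
    by (rule generic_parametrization[OF W no_sol c0]) (rule that)
  obtain \<sigma> where \<sigma>: "diff_K_automorphism emb D \<sigma>" "\<And>r. \<sigma> (\<Psi>1 r) = \<Psi>2 r"
    by (rule diff_automorphism_of_embeddings[OF \<Psi>1(1-4) \<Psi>2(1-4)]) (rule that)
  have "\<sigma> y1 = lincomb (column 1 M)" "\<sigma> y2 = lincomb (column 2 M)"
    using \<sigma>(2)[of "to_fract [:to_fract [:0, 1:]:]"] \<sigma>(2)[of "to_fract [:to_fract [:0, 1:]:] * to_fract [:0, 1:]"]
    unfolding \<Psi>1(5,6) \<Psi>2(5,6) .
  then show "M \<in> DGal emb D y1 y2" unfolding DGal_iff using \<sigma>(1) by blast
qed

text \<open>A matrix with \<open>M $ 2 $ 1 = 0\<close> scales y1 and keeps its logarithmic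
  derivative u. Conversely u lies in K and is fixed, which forces the image of y1 to be a multiple
  of y1.\<close>

lemma DGal_eq_Borel:
  assumes W: "degree W > 0" and u: "dK u + u\<^sup>2 = polyK W" and y1: "D y1 = emb u * y1"
  shows "DGal emb D y1 y2 = Borel"
proof (rule antisym; rule subsetI)
  fix M :: "complex^2^2" assume "M \<in> Borel"
  then have M: "M $ 2 $ 1 = 0" and det: "det M = 1" by (simp_all add: Borel_def)
  interpret z: picard_vessiot emb D W "lincomb (column 1 M)" "lincomb (column 2 M)"
    by unfold_locales (rule basis_change, simp add: det)
  obtain c0 where c0: "wronskian = scalar c0" by (rule wronskianE)
  have w: "z.wronskian = scalar c0"
    unfolding z.wronskian_def wronskian_lincomb det c0 by simp
  have z1: "D (lincomb (column 1 M)) = emb u * lincomb (column 1 M)"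
    unfolding D_lincomb unfolding lincomb_def by (simp add: column_def M y1)
  obtain \<Psi>2 where \<Psi>2: "embedding \<Psi>2" "surj \<Psi>2"
    "\<And>r. D (\<Psi>2 r) = \<Psi>2 (exp_int_deriv dK u (constK c0) r)"
    "\<And>k. \<Psi>2 (to_fract [:to_fract [:k:]:]) = emb k"
    "\<Psi>2 (to_fract [:to_fract [:0, 1:]:]) = lincomb (column 1 M)"
    "\<Psi>2 (to_fract [:to_fract [:0, 1:]:] * to_fract [:0, 1:]) = lincomb (column 2 M)"
    by (rule z.borel_parametrization[OF W u z1 w]) (rule that)
  obtain \<Psi>1 where \<Psi>1: "embedding \<Psi>1" "surj \<Psi>1"
    "\<And>r. D (\<Psi>1 r) = \<Psi>1 (exp_int_deriv dK u (constK c0) r)"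
    "\<And>k. \<Psi>1 (to_fract [:to_fract [:k:]:]) = emb k"
    "\<Psi>1 (to_fract [:to_fract [:0, 1:]:]) = y1"
    "\<Psi>1 (to_fract [:to_fract [:0, 1:]:] * to_fract [:0, 1:]) = y2"
    by (rule borel_parametrization[OF W u y1 c0]) (rule that)
  obtain \<sigma> where \<sigma>: "diff_K_automorphism emb D \<sigma>" "\<And>r. \<sigma> (\<Psi>1 r) = \<Psi>2 r"
    by (rule diff_automorphism_of_embeddings[OF \<Psi>1(1-4) \<Psi>2(1-4)]) (rule that)
  have "\<sigma> y1 = lincomb (column 1 M)" "\<sigma> y2 = lincomb (column 2 M)"
    using \<sigma>(2)[of "to_fract [:to_fract [:0, 1:]:]"] \<sigma>(2)[of "to_fract [:to_fract [:0, 1:]:] * to_fract [:0, 1:]"]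
    unfolding \<Psi>1(5,6) \<Psi>2(5,6) .
  then show "M \<in> DGal emb D y1 y2" unfolding DGal_iff using \<sigma>(1) by blast
next
  fix M assume M: "M \<in> DGal emb D y1 y2"
  then have det: "det M = 1" using DGal_subset_SL2 by (auto simp: SL2_def)
  obtain \<sigma> where \<sigma>: "diff_K_automorphism emb D \<sigma>" "\<sigma> y1 = lincomb (column 1 M)"
    using M unfolding DGal_iff by blast
  have "D (\<sigma> y1) = \<sigma> (emb u * y1)" unfolding y1[symmetric] using \<sigma>(1) by (simp add: diff_K_automorphism_def)
  also have "\<dots> = emb u * \<sigma> y1" using \<sigma>(1) by (simp add: diff_K_automorphism_def)
  finally have "scalar (M $ 1 $ 1) * D y1 + scalar (M $ 2 $ 1) * D y2
      = emb u * (scalar (M $ 1 $ 1) * y1 + scalar (M $ 2 $ 1) * y2)"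
    unfolding \<sigma>(2) D_lincomb unfolding lincomb_def by (simp add: column_def)
  then have "scalar (M $ 2 $ 1) * (D y2 - emb u * y2) = 0"
    unfolding y1 by (simp add: algebra_simps)
  moreover have "wronskian = y1 * (D y2 - emb u * y2)"
    unfolding wronskian_def y1 by (simp add: algebra_simps)
  then have "D y2 - emb u * y2 \<noteq> 0" using wronskian_nonzero by auto
  ultimately have "M $ 2 $ 1 = 0" by simp
  with det show "M \<in> Borel" by (simp add: Borel_def)
qed

text \<open>The operator D - u sends solutions of y'' = W y to solutions of t' = - u t. These form
  at most a line over the constants, so a nontrivial combination of y1, y2 is sent to 0.\<close>

lemma riccati_solution_basis:
  assumes u: "dK u + u\<^sup>2 = polyK W"
  obtains Q where "det Q \<noteq> 0" "D (lincomb (column 1 Q)) = emb u * lincomb (column 1 Q)"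
proof -
  define t1 t2 where "t1 = D y1 - emb u * y1" and "t2 = D y2 - emb u * y2"
  have u': "dK u = polyK W - u * u" using u by (simp add: power2_eq_square eq_diff_eq)
  have Dt: "D t1 = - emb u * t1" "D t2 = - emb u * t2"
    unfolding t1_def t2_def by (simp_all add: D.diff D.mult D_D u' emb.diff emb.mult algebra_simps)
  show ?thesis
  proof (cases "t2 = 0")
    case True
    \<comment> \<open>Here y2 itself is the exponential solution, so the basis is swapped.\<close>
    define Q :: "complex^2^2" where "Q = vector [vector [0, 1], vector [1, 0]]"
    have "det Q \<noteq> 0" by (simp add: Q_def det_2)
    moreover have "D (lincomb (column 1 Q)) = emb u * lincomb (column 1 Q)"
      unfolding D_lincomb unfolding lincomb_def using True by (simp add: Q_def column_def t2_def)
    ultimately show ?thesis by (rule that)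
  next
    case False
    have "D (t1 / t2) = 0"
      unfolding derivation_divide[OF derivation_D False] Dt by simp
    then obtain \<gamma> where \<gamma>: "t1 / t2 = scalar \<gamma>" by (rule constantE)
    then have t1: "t1 = scalar \<gamma> * t2" using False by (simp add: field_simps)
    \<comment> \<open>The first column selects y1 - \<gamma> y2, on which D - u vanishes; the second
      completes it to a basis.\<close>
    define Q :: "complex^2^2" where "Q = vector [vector [1, 0], vector [- \<gamma>, 1]]"
    have "det Q \<noteq> 0" by (simp add: Q_def det_2)
    moreover have "D y1 - scalar \<gamma> * D y2 = emb u * (y1 - scalar \<gamma> * y2)"
      using t1 unfolding t1_def t2_def by (simp add: algebra_simps)
    then have "D (lincomb (column 1 Q)) = emb u * lincomb (column 1 Q)"
      unfolding D_lincomb unfolding lincomb_def by (simp add: Q_def column_def scalar.minus)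
    ultimately show ?thesis by (rule that)
  qed
qed

lemma DGal_conj_to_Borel:
  assumes W: "degree W > 0" and u: "dK u + u\<^sup>2 = polyK W"
  shows "conj_to_Borel (DGal emb D y1 y2)"
proof -
  obtain Q where Q: "det Q \<noteq> 0" "D (lincomb (column 1 Q)) = emb u * lincomb (column 1 Q)"
    using riccati_solution_basis[OF u] .
  interpret z: picard_vessiot emb D W "lincomb (column 1 Q)" "lincomb (column 2 Q)"
    by unfold_locales (rule basis_change[OF Q(1)])
  have B: "DGal emb D (lincomb (column 1 Q)) (lincomb (column 2 Q)) = Borel"
    by (rule z.DGal_eq_Borel[OF W u Q(2)])
  have inv: "invertible Q" using Q(1) by (simp add: invertible_det_nz)
  define R where "R = matrix_inv Q"
  have QR: "Q ** R = mat 1" "R ** Q = mat 1"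
    using inv by (simp_all add: R_def matrix_inv_inverse)
  have zl: "z.lincomb v = lincomb (Q *v v)" for v
    unfolding z.lincomb_def unfolding lincomb_def column_def
    by (simp add: matrix_vector_mult_def sum_2 scalar.add scalar.mult algebra_simps)
  \<comment> \<open>Changing back with \<open>R\<close> returns y1, y2, so
    \<open>DGal_basis_change\<close> also runs from the new basis to the old one.\<close>
  have "z.lincomb (column 1 R) = y1" "z.lincomb (column 2 R) = y2"
  proof -
    have "Q *v column i R = column i (mat 1)" for i
      by (simp add: vec_eq_iff matrix_vector_mult_def matrix_matrix_mult_def column_def flip: QR(1))
    then show "z.lincomb (column 1 R) = y1" "z.lincomb (column 2 R) = y2"
      unfolding zl by (simp_all add: lincomb_def column_def mat_def)
  qed
  note y = this
  have "DGal emb D y1 y2 = (\<lambda>M. Q ** M ** matrix_inv Q) ` Borel"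
  proof (intro equalityI subsetI)
    fix M assume M: "M \<in> DGal emb D y1 y2"
    have "R ** M ** Q \<in> Borel" using DGal_basis_change[OF QR(1) M] unfolding B .
    moreover have "Q ** (R ** M ** Q) ** R = M"
      by (metis QR(1) matrix_mul_assoc matrix_mul_lid matrix_mul_rid)
    ultimately show "M \<in> (\<lambda>M. Q ** M ** matrix_inv Q) ` Borel"
      unfolding R_def by (metis imageI)
  next
    fix M assume "M \<in> (\<lambda>M. Q ** M ** matrix_inv Q) ` Borel"
    then obtain N where N: "N \<in> Borel" "M = Q ** N ** R" by (auto simp: R_def)
    show "M \<in> DGal emb D y1 y2"
      using z.DGal_basis_change[OF QR(2), of N] N B unfolding y by simp
  qed
  then show ?thesis unfolding conj_to_Borel_def using inv by blast
qed

end

text \<open>\<open>SL2\<close> is stable under conjugation, so such a \<open>P\<close> would give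
  \<open>Borel = SL2\<close>, refuted by the lower unipotent matrix \<open>N\<close>.\<close>

lemma not_conj_to_Borel_SL2: "\<not> conj_to_Borel SL2"
proof
  assume "conj_to_Borel SL2"
  then obtain P where P: "invertible P" "SL2 = (\<lambda>M. P ** M ** matrix_inv P) ` Borel"
    unfolding conj_to_Borel_def by blast
  define R where "R = matrix_inv P"
  have PR: "P ** R = mat 1" "R ** P = mat 1"
    using P(1) by (simp_all add: R_def matrix_inv_inverse)
  define N :: "complex^2^2" where "N = vector [vector [1, 0], vector [1, 1]]"
  have "det (P ** N ** R) = det (P ** R) * det N" by (simp only: det_mul mult_ac)
  also have "\<dots> = 1" unfolding PR det_I by (simp add: N_def det_2)
  finally have "P ** N ** R \<in> SL2" by (simp only: SL2_def mem_Collect_eq)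
  then have "P ** N ** R \<in> (\<lambda>M. P ** M ** R) ` Borel" by (simp only: P(2) R_def)
  then obtain M where M: "P ** N ** R = P ** M ** R" "M \<in> Borel" by (rule imageE)
  have cancel: "R ** (P ** X ** R) ** P = X" for X
  proof -
    have "R ** (P ** X ** R) ** P = (R ** P) ** X ** (R ** P)" by (simp only: matrix_mul_assoc)
    then show ?thesis by (simp only: PR(2) matrix_mul_lid matrix_mul_rid)
  qed
  have "N = M" using cancel[of N] cancel[of M] unfolding M(1) by (rule trans[OF sym])
  with M(2) have "N $ 2 $ 1 = 0" by (simp add: Borel_def)
  then show False by (simp add: N_def)
qed

theorem theorem2p2p2:
  fixes V :: "complex poly" and lam :: complex
    and emb :: "ratfun \<Rightarrow> 'L::field" and D :: "'L \<Rightarrow> 'L" and y1 y2 :: 'L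
  assumes monic: "lead_coeff V = 1" and deg: "degree V > 0"
    and PV: "PV_extension emb D (V - [:lam:]) y1 y2"
  shows "(DGal emb D y1 y2 = SL2 \<or> conj_to_Borel (DGal emb D y1 y2))
     \<and> eigenring_trivial (schroedinger_op V lam)
     \<and> (conj_to_Borel (DGal emb D y1 y2) \<longleftrightarrow>
         (\<exists>n a b. degree V = 2 * n
            \<and> V - [:lam:] = (monom 1 n + (\<Sum>j<n. monom (a j) j))\<^sup>2 + (\<Sum>j<n. monom (b j) j)
            \<and> (\<exists>m::nat.
                 (b (n - 1) - of_nat n = 2 * of_nat m
                  \<and> (\<exists>P. lead_coeff P = 1 \<and> degree P = m
                     \<and> pderiv (pderiv P) + smult 2 (monom 1 n + (\<Sum>j<n. monom (a j) j)) * pderiv P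
                       + (monom (of_nat n) (n - 1) + (\<Sum>j<n - 1. monom (of_nat (j + 1) * a (j + 1)) j)
                          - (\<Sum>j<n. monom (b j) j)) * P = 0))
               \<or> (- b (n - 1) - of_nat n = 2 * of_nat m
                  \<and> (\<exists>P. lead_coeff P = 1 \<and> degree P = m
                     \<and> pderiv (pderiv P) - smult 2 (monom 1 n + (\<Sum>j<n. monom (a j) j)) * pderiv P
                       - (monom (of_nat n) (n - 1) + (\<Sum>j<n - 1. monom (of_nat (j + 1) * a (j + 1)) j)
                          + (\<Sum>j<n. monom (b j) j)) * P = 0)))))
     \<and> (\<forall>n a b (m::nat) P s. degree V = 2 * n
            \<and> V - [:lam:] = (monom 1 n + (\<Sum>j<n. monom (a j) j))\<^sup>2 + (\<Sum>j<n. monom (b j) j)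
            \<and> lead_coeff P = 1 \<and> degree P = m
            \<and> ((s = (1::complex) \<and> b (n - 1) - of_nat n = 2 * of_nat m
                \<and> pderiv (pderiv P) + smult 2 (monom 1 n + (\<Sum>j<n. monom (a j) j)) * pderiv P
                  + (monom (of_nat n) (n - 1) + (\<Sum>j<n - 1. monom (of_nat (j + 1) * a (j + 1)) j)
                     - (\<Sum>j<n. monom (b j) j)) * P = 0)
             \<or> (s = -1 \<and> - b (n - 1) - of_nat n = 2 * of_nat m
                \<and> pderiv (pderiv P) - smult 2 (monom 1 n + (\<Sum>j<n. monom (a j) j)) * pderiv P
                  - (monom (of_nat n) (n - 1) + (\<Sum>j<n - 1. monom (of_nat (j + 1) * a (j + 1)) j)
                     + (\<Sum>j<n. monom (b j) j)) * P = 0))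
          \<longrightarrow> (let f = (\<lambda>z. z ^ (n + 1) / of_nat (n + 1) + (\<Sum>j<n. a j * z ^ (j + 1) / of_nat (j + 1)));
                  \<Psi> = (\<lambda>z. poly P z * exp (s * f z))
              in \<exists>\<Psi>'. \<forall>z. (\<Psi> has_field_derivative \<Psi>' z) (at z)
                        \<and> (\<Psi>' has_field_derivative (poly V z - lam) * \<Psi> z) (at z)))"
proof -
  define W where "W = V - [:lam:]"
  have "degree W = degree V"
    unfolding W_def using deg by (subst diff_conv_add_uminus, subst degree_add_eq_left) auto
  then have W: "lead_coeff W = 1" "degree W > 0"
    using monic deg by (auto simp: W_def coeff_pCons split: nat.splits)
  interpret picard_vessiot emb D W y1 y2
    using PV unfolding W_def by unfold_locales
  \<comment> \<open>In the unsolvable case the group is \<open>SL2\<close>, and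
    \<open>not_conj_to_Borel_SL2\<close> turns the dichotomy into an equivalence.\<close>
  have gal: "(DGal emb D y1 y2 = SL2 \<or> conj_to_Borel (DGal emb D y1 y2)) \<and>
    (conj_to_Borel (DGal emb D y1 y2) \<longleftrightarrow> (\<exists>u. dK u + u\<^sup>2 = polyK W))"
  proof (cases "\<exists>u. dK u + u\<^sup>2 = polyK W")
    case True
    then obtain u where "dK u + u\<^sup>2 = polyK W" by blast
    then have "conj_to_Borel (DGal emb D y1 y2)" by (rule DGal_conj_to_Borel[OF W(2)])
    with True show ?thesis by blast
  next
    case False
    then have "DGal emb D y1 y2 = SL2" by (rule DGal_eq_SL2[OF W])
    with False not_conj_to_Borel_SL2 show ?thesis by simp
  qed
  have eig: "eigenring_trivial (schroedinger_op V lam)"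
    using eigenring_trivial_schroedinger W(2) unfolding W_def .
  note iff = conjunct2[OF gal, unfolded W_def riccati_solvable_iff[OF monic deg]]
  show ?thesis
  proof (rule conjI[OF conjunct1[OF gal] conjI[OF eig conjI[OF iff]]], intro allI impI)
    fix n and a b :: "nat \<Rightarrow> complex" and m and P :: "complex poly" and s :: complex
    define A B where "A = monom 1 n + (\<Sum>j<n. monom (a j) j)" and "B = (\<Sum>j<n. monom (b j) j)"
    assume asm: "degree V = 2 * n
            \<and> V - [:lam:] = (monom 1 n + (\<Sum>j<n. monom (a j) j))\<^sup>2 + (\<Sum>j<n. monom (b j) j)
            \<and> lead_coeff P = 1 \<and> degree P = m
            \<and> ((s = (1::complex) \<and> b (n - 1) - of_nat n = 2 * of_nat m
                \<and> pderiv (pderiv P) + smult 2 (monom 1 n + (\<Sum>j<n. monom (a j) j)) * pderiv P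
                  + (monom (of_nat n) (n - 1) + (\<Sum>j<n - 1. monom (of_nat (j + 1) * a (j + 1)) j)
                     - (\<Sum>j<n. monom (b j) j)) * P = 0)
             \<or> (s = -1 \<and> - b (n - 1) - of_nat n = 2 * of_nat m
                \<and> pderiv (pderiv P) - smult 2 (monom 1 n + (\<Sum>j<n. monom (a j) j)) * pderiv P
                  - (monom (of_nat n) (n - 1) + (\<Sum>j<n - 1. monom (of_nat (j + 1) * a (j + 1)) j)
                     + (\<Sum>j<n. monom (b j) j)) * P = 0))"
    \<comment> \<open>Positivity makes the index n - 1 genuine, so that the written-out sum is the
      derivative of \<open>A\<close>.\<close>
    then have "n > 0" using deg by simp
    note asm' = asm[folded pderiv_monic_sum_monom[OF \<open>n > 0\<close>], folded A_def B_def]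
    have V: "V - [:lam:] = A\<^sup>2 + B" using asm' by blast
    have s: "s * s = 1" using asm' by auto
    have eq: "pderiv (pderiv P) + smult (2 * s) A * pderiv P + (smult s (pderiv A) - B) * P = 0"
    proof -
      consider "s = 1" "pderiv (pderiv P) + smult 2 A * pderiv P + (pderiv A - B) * P = 0"
        | "s = -1" "pderiv (pderiv P) - smult 2 A * pderiv P - (pderiv A + B) * P = 0"
        using asm' by blast
      then show ?thesis by cases (simp_all add: algebra_simps)
    qed
    define f where "f z = z ^ (n + 1) / of_nat (n + 1) + (\<Sum>j<n. a j * z ^ (j + 1) / of_nat (j + 1))" for z
    have f: "(f has_field_derivative poly A z) (at z)" for z
    proof -
      have mono: "((\<lambda>z. z ^ (j + 1) / of_nat (j + 1)) has_field_derivative z ^ j) (at z)" for j and z :: complex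
      proof -
        have "((\<lambda>z. z ^ (j + 1)) has_field_derivative of_nat (j + 1) * z ^ j) (at z)"
          by (rule derivative_eq_intros refl)+ simp
        from DERIV_cdivide[OF this, of "of_nat (j + 1)"] show ?thesis
          by (simp del: of_nat_Suc)
      qed
      have "(f has_field_derivative z ^ n + (\<Sum>j<n. a j * z ^ j)) (at z)"
        unfolding f_def times_divide_eq_right[symmetric]
        by (intro DERIV_add DERIV_sum DERIV_cmult mono)
      then show ?thesis by (simp add: A_def poly_monom poly_sum)
    qed
    show "let f = (\<lambda>z. z ^ (n + 1) / of_nat (n + 1) + (\<Sum>j<n. a j * z ^ (j + 1) / of_nat (j + 1)));
                  \<Psi> = (\<lambda>z. poly P z * exp (s * f z))
              in \<exists>\<Psi>'. \<forall>z. (\<Psi> has_field_derivative \<Psi>' z) (at z)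
                        \<and> (\<Psi>' has_field_derivative (poly V z - lam) * \<Psi> z) (at z)"
      unfolding Let_def f_def[symmetric] by (rule exponential_solution[OF f V s eq])
  qed
qed

end
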